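(* Let $(S,\mathcal{C})$ be an $n$-dimensional stratifold, let $W$ be an $s$-dimensional manifold with compact boundary $\partial W$ endowed with a collar $c:\partial W\times[0,\varepsilon)\to W$, where $s>n$, and let $f:\partial W\to S$ be a morphism of stratifolds. Then the natural map $$l:k(S,\mathcal{C})\cup_{k(f)}k(W,\mathcal{C}_W)\to k(S\cup_fW,\mathcal{C}_{\mathrm{ad}}^{(S,W)})$$ is a smooth homotopy equivalence in $\mathsf{Diff}$, where $(W,\mathcal{C}_W)$ denotes the stratifold $(\partial W\cup_{id}W,\mathcal{C}_{\mathrm{ad}}^{(\partial W,W)})$.
   Context: A differential space is a pair $(S,\mathcal{C})$ of a topological space $S$ and an $\mathbb{R}$-subalgebra $\mathcal{C}\subset C^0(S)$ which is locally detectable ($f\in\mathcal{C}$ iff each $x\in S$ has an open neighborhood $U$ and $g\in\mathcal{C}$ with $f|_U=g|_U$) and $C^\infty$-closed ($g(f_1,\dots,f_n)\in\mathcal{C}$ for $f_i\in\mathcal{C}$ and smooth $g:\mathbb{R}^n\to\mathbb{R}$). $T_xS$ is the vector space of derivations on the algebra $\mathcal{C}_x$ of germs at $x$. An $n$-dimensional stratifold is a differential space such that: (1) $S$ is locally compact Hausdorff with countable basis; (2) $\dim T_xS\le n$ for all $x$ and the skeleta $sk_t(S)=\{x\mid\dim T_xS\le t\}$ are closed; (3) for each $x\in S$ and open neighborhood $U$ there is a non-negative $\phi\in\mathcal{C}$ with $\phi(x)\ne0$ and support in $U$; (4) the strata $S^t=sk_t(S)-sk_{t-1}(S)$ are $t$-dimensional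 smooth manifolds such that restriction induces isomorphisms of stalks $\mathcal{C}_x\cong C^\infty(S^t)_x$ for $x\in S^t$. A morphism $h:(S_1,\mathcal{C}_1)\to(S_2,\mathcal{C}_2)$ is a continuous map with $\phi\circ h\in\mathcal{C}_1$ for all $\phi\in\mathcal{C}_2$. A manifold $M$ without boundary is a stratifold with $\mathcal{C}_M=C^\infty(M)$. On the adjunction topological space $S'=S\cup_fW$, $\mathcal{C}_{\mathrm{ad}}^{(S,W)}$ is the set of $g:S'\to\mathbb{R}$ such that $g|_S\in\mathcal{C}$, $g|_{W\setminus\partial W}$ is smooth, and for some positive $\delta<\varepsilon$, $g c(w,t)=gf(w)$ for $w\in\partial W$ and $t<\delta$. The pair $(S',\mathcal{C}_{\mathrm{ad}}^{(S,W)})$ is a stratifold. The functor $k$ from stratifolds to diffeological spaces is $k(S,\mathcal{C})=(S,\mathcal{D}_{\mathcal{C}})$, $k(f)=f$, where $\mathcal{D}_{\mathcal{C}}$ is the set of maps $u:U\to S$, $U$ open in some $\mathbb{R}^q$, with $\phi\circ u\in C^\infty(U)$ for all $\phi\in\mathcal{C}$. The adjunction space in $\mathsf{Diff}$ is the quotient of the coproduct, with the quotient diffeology (parametrizations which locally lift to plots of the coproduct). The map $l$ is induced by the inclusions and is the identity on underlying sets. Two smooth maps $X\to Y$ are smoothly homotopic if there is a smooth map $X\times\mathbb{R}\to Y$ restricting to them at $0$ and $1$; a smooth homotopy equivalence is a smooth map with an inverse up to smooth homotopy. *)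

theory Defs
  imports "HOL-Analysis.Analysis" "HOL-Library.Function_Algebras"
begin

section \<open>Smooth functions on subsets of Euclidean space\<close>

text \<open>
  Since the dimension varies inside the definitions below, the space of dimension \<open>q\<close> is the
  library's \<^const>\<open>Euclidean_space\<close> \<open>q\<close>, i.e. the sequences that vanish from index \<open>q\<close> on.
  \<open>Ck q k U f\<close> says that on the open set \<open>U\<close> all iterated partial derivatives of \<open>f\<close> of order
  at most \<open>k\<close> exist and are continuous.
\<close>

primrec Ck :: "nat \<Rightarrow> nat \<Rightarrow> (nat \<Rightarrow> real) set \<Rightarrow> ((nat \<Rightarrow> real) \<Rightarrow> real) \<Rightarrow> bool" where
  "Ck q 0 U f \<longleftrightarrow> continuous_map (subtopology (Euclidean_space q) U) euclideanreal f"
| "Ck q (Suc k) U f \<longleftrightarrow>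
     continuous_map (subtopology (Euclidean_space q) U) euclideanreal f \<and>
     (\<forall>i<q. \<exists>f'. (\<forall>x\<in>U. ((\<lambda>t. f (x(i := t))) has_real_derivative f' x) (at (x i))) \<and>
                Ck q k U f')"

text \<open>
  On an arbitrary subset, smooth means locally extendable to a smooth function on an open set;
  this covers open subsets of half-spaces.
\<close>

definition smooth_on :: "nat \<Rightarrow> (nat \<Rightarrow> real) set \<Rightarrow> ((nat \<Rightarrow> real) \<Rightarrow> real) \<Rightarrow> bool" where
  "smooth_on q V f \<longleftrightarrow>
     (\<forall>x\<in>V. \<exists>U g. openin (Euclidean_space q) U \<and> x \<in> U \<and> (\<forall>k. Ck q k U g) \<and>
                  (\<forall>y\<in>U \<inter> V. g y = f y))"


section \<open>Smooth manifolds with and without boundary\<close>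

type_synonym 'a atlas = "('a set \<times> ('a \<Rightarrow> nat \<Rightarrow> real)) set"

definition half_space :: "nat \<Rightarrow> (nat \<Rightarrow> real) set" where
  "half_space n = {x \<in> topspace (Euclidean_space n). 0 \<le> x 0}"

definition smooth_atlas :: "(nat \<Rightarrow> real) set \<Rightarrow> nat \<Rightarrow> 'a topology \<Rightarrow> 'a atlas \<Rightarrow> bool" where
  "smooth_atlas E n X A \<longleftrightarrow>
     (\<forall>(U, \<phi>)\<in>A. openin X U \<and>
        openin (subtopology (Euclidean_space n) E) (\<phi> ` U) \<and>
        homeomorphic_map (subtopology X U) (subtopology (Euclidean_space n) (\<phi> ` U)) \<phi>) \<and>
     (\<Union>(U, \<phi>)\<in>A. U) = topspace X \<and>
     (\<forall>(U, \<phi>)\<in>A. \<forall>(V, \<psi>)\<in>A. \<forall>i<n.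
        smooth_on n (\<phi> ` (U \<inter> V)) (\<lambda>y. \<psi> (inv_into U \<phi> y) i))"

definition countable_basis :: "'a topology \<Rightarrow> bool" where
  "countable_basis X \<longleftrightarrow>
     (\<exists>\<B>. countable \<B> \<and> (\<forall>B\<in>\<B>. openin X B) \<and>
          (\<forall>U x. openin X U \<and> x \<in> U \<longrightarrow> (\<exists>B\<in>\<B>. x \<in> B \<and> B \<subseteq> U)))"

definition smooth_manifold :: "nat \<Rightarrow> 'a topology \<Rightarrow> 'a atlas \<Rightarrow> bool" where
  "smooth_manifold n X A \<longleftrightarrow>
     Hausdorff_space X \<and> countable_basis X \<and> smooth_atlas (topspace (Euclidean_space n)) n X A"

definition smooth_manifold_with_boundary :: "nat \<Rightarrow> 'a topology \<Rightarrow> 'a atlas \<Rightarrow> bool" where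
  "smooth_manifold_with_boundary n X A \<longleftrightarrow>
     Hausdorff_space X \<and> countable_basis X \<and> smooth_atlas (half_space n) n X A"

text \<open>
  In dimension 0 the half-space is a single point and carries no boundary, hence the
  condition \<open>0 < n\<close>.
\<close>

definition mfd_boundary :: "nat \<Rightarrow> 'a atlas \<Rightarrow> 'a set" where
  "mfd_boundary n A = {x. 0 < n \<and> (\<exists>(U, \<phi>)\<in>A. x \<in> U \<and> \<phi> x 0 = 0)}"

text \<open>The charts of the boundary are obtained by dropping the coordinate normal to it.\<close>

definition boundary_atlas :: "nat \<Rightarrow> 'a atlas \<Rightarrow> 'a atlas" where
  "boundary_atlas n A = (\<lambda>(U, \<phi>). (U \<inter> mfd_boundary n A, \<lambda>x i. \<phi> x (Suc i))) ` A"

definition restrict_atlas :: "'a atlas \<Rightarrow> 'a set \<Rightarrow> 'a atlas" where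
  "restrict_atlas A V = (\<lambda>(U, \<phi>). (U \<inter> V, \<phi>)) ` A"

text \<open>
  Functions on a space are represented by total functions of which only the values on the
  space matter: the sets of functions below are closed under changing values elsewhere.
  In particular, restriction to a subspace leaves the total function unchanged.
\<close>

definition Cinf :: "nat \<Rightarrow> 'a atlas \<Rightarrow> ('a \<Rightarrow> real) set" where
  "Cinf n A = {f. \<forall>(U, \<phi>)\<in>A. smooth_on n (\<phi> ` U) (\<lambda>y. f (inv_into U \<phi> y))}"

definition smooth_mfd_map ::
  "nat \<Rightarrow> 'a topology \<Rightarrow> 'a atlas \<Rightarrow> nat \<Rightarrow> 'b topology \<Rightarrow> 'b atlas \<Rightarrow> ('a \<Rightarrow> 'b) \<Rightarrow> bool" where
  "smooth_mfd_map n X A m Y B h \<longleftrightarrow>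
     continuous_map X Y h \<and>
     (\<forall>(U, \<phi>)\<in>A. \<forall>(V, \<psi>)\<in>B. \<forall>i<m.
        smooth_on n (\<phi> ` (U \<inter> h -` V)) (\<lambda>y. \<psi> (h (inv_into U \<phi> y)) i))"

definition mfd_diffeomorphism ::
  "nat \<Rightarrow> 'a topology \<Rightarrow> 'a atlas \<Rightarrow> 'b topology \<Rightarrow> 'b atlas \<Rightarrow> ('a \<Rightarrow> 'b) \<Rightarrow> bool" where
  "mfd_diffeomorphism n X A Y B h \<longleftrightarrow>
     bij_betw h (topspace X) (topspace Y) \<and>
     smooth_mfd_map n X A n Y B h \<and>
     smooth_mfd_map n Y B n X A (inv_into (topspace X) h)"

text \<open>
  The product of the boundary with \<open>[0, \<epsilon>)\<close> is a manifold with boundary; the parameter in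
  \<open>[0, \<epsilon>)\<close> serves as the normal coordinate of its charts.
\<close>

definition half_cylinder :: "nat \<Rightarrow> 'a topology \<Rightarrow> 'a atlas \<Rightarrow> real \<Rightarrow> ('a \<times> real) topology" where
  "half_cylinder s W A \<epsilon> =
     prod_topology (subtopology W (mfd_boundary s A)) (top_of_set {0..<\<epsilon>})"

definition half_cylinder_atlas :: "nat \<Rightarrow> 'a atlas \<Rightarrow> real \<Rightarrow> ('a \<times> real) atlas" where
  "half_cylinder_atlas s A \<epsilon> =
     (\<lambda>(U, \<phi>). (U \<times> {0..<\<epsilon>}, \<lambda>(w, t). case_nat t (\<phi> w))) ` boundary_atlas s A"

definition collar :: "nat \<Rightarrow> 'a topology \<Rightarrow> 'a atlas \<Rightarrow> real \<Rightarrow> ('a \<times> real \<Rightarrow> 'a) \<Rightarrow> bool" where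
  "collar s W A \<epsilon> c \<longleftrightarrow>
     0 < \<epsilon> \<and>
     (\<forall>w\<in>mfd_boundary s A. c (w, 0) = w) \<and>
     (let N = c ` (mfd_boundary s A \<times> {0..<\<epsilon>}) in
        openin W N \<and>
        mfd_diffeomorphism s (half_cylinder s W A \<epsilon>) (half_cylinder_atlas s A \<epsilon>)
          (subtopology W N) (restrict_atlas A N) c)"


section \<open>Differential spaces and their tangent spaces\<close>

text \<open>The fifth conjunct is local detectability, the sixth is closure under smooth functions.\<close>

definition differential_space :: "'a topology \<Rightarrow> ('a \<Rightarrow> real) set \<Rightarrow> bool" where
  "differential_space X C \<longleftrightarrow>
     (\<forall>f\<in>C. continuous_map X euclideanreal f) \<and>
     (\<forall>r. (\<lambda>_. r) \<in> C) \<and>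
     (\<forall>f\<in>C. \<forall>g\<in>C. (\<lambda>x. f x + g x) \<in> C) \<and>
     (\<forall>f\<in>C. \<forall>g\<in>C. (\<lambda>x. f x * g x) \<in> C) \<and>
     (\<forall>f. f \<in> C \<longleftrightarrow>
        (\<forall>x\<in>topspace X. \<exists>U. openin X U \<and> x \<in> U \<and> (\<exists>g\<in>C. \<forall>y\<in>U. f y = g y))) \<and>
     (\<forall>m g F. smooth_on m (topspace (Euclidean_space m)) g \<and> (\<forall>i<m. F i \<in> C) \<longrightarrow>
        (\<lambda>x. g (\<lambda>i. if i < m then F i x else 0)) \<in> C)"

definition germ :: "'a topology \<Rightarrow> ('a \<Rightarrow> real) set \<Rightarrow> 'a \<Rightarrow> ('a \<Rightarrow> real) \<Rightarrow> ('a \<Rightarrow> real) set" where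
  "germ X C x f = {g \<in> C. \<exists>U. openin X U \<and> x \<in> U \<and> (\<forall>y\<in>U. g y = f y)}"

definition stalk :: "'a topology \<Rightarrow> ('a \<Rightarrow> real) set \<Rightarrow> 'a \<Rightarrow> ('a \<Rightarrow> real) set set" where
  "stalk X C x = germ X C x ` C"

text \<open>
  A derivation on the algebra of germs is a function on the stalk. Being represented by a total
  function, it is required to vanish elsewhere, so that distinct derivations are distinct functions.
\<close>

definition tangent_space ::
  "'a topology \<Rightarrow> ('a \<Rightarrow> real) set \<Rightarrow> 'a \<Rightarrow> (('a \<Rightarrow> real) set \<Rightarrow> real) set" where
  "tangent_space X C x =
     {D. (\<forall>\<gamma>. \<gamma> \<notin> stalk X C x \<longrightarrow> D \<gamma> = 0) \<and>
         (\<forall>f\<in>C. \<forall>g\<in>C. D (germ X C x (\<lambda>y. f y + g y)) = D (germ X C x f) + D (germ X C x g)) \<and>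
         (\<forall>r. \<forall>f\<in>C. D (germ X C x (\<lambda>y. r * f y)) = r * D (germ X C x f)) \<and>
         (\<forall>f\<in>C. \<forall>g\<in>C. D (germ X C x (\<lambda>y. f y * g y)) =
            f x * D (germ X C x g) + g x * D (germ X C x f))}"

interpretation fun_vs: vector_space "\<lambda>(r::real) (D::'b \<Rightarrow> real) \<gamma>. r * D \<gamma>"
  by unfold_locales (auto simp: fun_eq_iff algebra_simps)

text \<open>
  Bounding the dimension through a finite spanning set avoids the library's convention that
  an infinite-dimensional space has dimension 0.
\<close>

definition tangent_dim_le :: "'a topology \<Rightarrow> ('a \<Rightarrow> real) set \<Rightarrow> 'a \<Rightarrow> nat \<Rightarrow> bool" where
  "tangent_dim_le X C x t \<longleftrightarrow>
     (\<exists>B. finite B \<and> card B \<le> t \<and> B \<subseteq> tangent_space X C x \<and>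
          tangent_space X C x \<subseteq> fun_vs.span B)"


section \<open>Stratifolds\<close>

definition skeleton :: "'a topology \<Rightarrow> ('a \<Rightarrow> real) set \<Rightarrow> nat \<Rightarrow> 'a set" where
  "skeleton X C t = {x \<in> topspace X. tangent_dim_le X C x t}"

definition stratum :: "'a topology \<Rightarrow> ('a \<Rightarrow> real) set \<Rightarrow> nat \<Rightarrow> 'a set" where
  "stratum X C t = skeleton X C t - (case t of 0 \<Rightarrow> {} | Suc r \<Rightarrow> skeleton X C r)"

text \<open>
  In the last conjunct, \<open>C \<subseteq> Cinf t A\<close> expresses that restriction to the stratum defines a map of
  stalks (into the germs of smooth functions), and \<open>h\<close> is this map; being induced by restriction,
  it is an algebra homomorphism.
\<close>

definition stratifold :: "nat \<Rightarrow> 'a topology \<Rightarrow> ('a \<Rightarrow> real) set \<Rightarrow> bool" where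
  "stratifold n X C \<longleftrightarrow>
     differential_space X C \<and>
     locally_compact_space X \<and> Hausdorff_space X \<and> countable_basis X \<and>
     (\<forall>x\<in>topspace X. tangent_dim_le X C x n) \<and>
     (\<forall>t. closedin X (skeleton X C t)) \<and>
     (\<forall>x U. openin X U \<and> x \<in> U \<longrightarrow>
        (\<exists>\<phi>\<in>C. (\<forall>y\<in>topspace X. 0 \<le> \<phi> y) \<and> \<phi> x \<noteq> 0 \<and>
               X closure_of {y \<in> topspace X. \<phi> y \<noteq> 0} \<subseteq> U)) \<and>
     (\<forall>t. let Xt = subtopology X (stratum X C t) in
        \<exists>A. smooth_manifold t Xt A \<and> C \<subseteq> Cinf t A \<and>
            (\<forall>x\<in>stratum X C t. \<exists>h.
               (\<forall>\<phi>\<in>C. h (germ X C x \<phi>) = germ Xt (Cinf t A) x \<phi>) \<and>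
               bij_betw h (stalk X C x) (stalk Xt (Cinf t A) x)))"

definition stratifold_morphism ::
  "'a topology \<Rightarrow> ('a \<Rightarrow> real) set \<Rightarrow> 'b topology \<Rightarrow> ('b \<Rightarrow> real) set \<Rightarrow> ('a \<Rightarrow> 'b) \<Rightarrow> bool" where
  "stratifold_morphism X C Y D h \<longleftrightarrow> continuous_map X Y h \<and> (\<forall>\<phi>\<in>D. \<phi> \<circ> h \<in> C)"


section \<open>Adjunction spaces\<close>

text \<open>
  The relation on the disjoint union of \<open>P\<close> and \<open>Q\<close> generated by \<open>b \<sim> f b\<close> for \<open>b \<in> B \<subseteq> Q\<close>.
\<close>

definition glue_rel :: "'a set \<Rightarrow> 'b set \<Rightarrow> 'b set \<Rightarrow> ('b \<Rightarrow> 'a) \<Rightarrow> (('a + 'b) \<times> ('a + 'b)) set" where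
  "glue_rel P Q B f =
     {(p, q). p \<in> P <+> Q \<and> q \<in> P <+> Q \<and> equivclp (\<lambda>u v. \<exists>b\<in>B. u = Inr b \<and> v = Inl (f b)) p q}"

definition glue_class :: "'a set \<Rightarrow> 'b set \<Rightarrow> 'b set \<Rightarrow> ('b \<Rightarrow> 'a) \<Rightarrow> 'a + 'b \<Rightarrow> ('a + 'b) set" where
  "glue_class P Q B f p = glue_rel P Q B f `` {p}"

definition adjunction_space ::
  "'a topology \<Rightarrow> 'b topology \<Rightarrow> 'b set \<Rightarrow> ('b \<Rightarrow> 'a) \<Rightarrow> ('a + 'b) set topology" where
  "adjunction_space X Y B f =
     (let cl = glue_class (topspace X) (topspace Y) B f in
        topology (\<lambda>U. U \<subseteq> (topspace X <+> topspace Y) // glue_rel (topspace X) (topspace Y) B f \<and>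
          openin X {x \<in> topspace X. cl (Inl x) \<in> U} \<and>
          openin Y {y \<in> topspace Y. cl (Inr y) \<in> U}))"

lemma equiv_glue_rel: "equiv (P <+> Q) (glue_rel P Q B f)"
proof (rule equivI)
  show "glue_rel P Q B f \<subseteq> (P <+> Q) \<times> (P <+> Q)"
    by (auto simp: glue_rel_def)
  show "refl_on (P <+> Q) (glue_rel P Q B f)"
    by (auto simp: glue_rel_def refl_on_def)
  show "sym (glue_rel P Q B f)"
    by (auto simp: glue_rel_def sym_def intro: equivclp_sym)
  show "trans (glue_rel P Q B f)"
    unfolding glue_rel_def trans_def by (blast intro: equivclp_trans)
qed

lemma openin_adjunction_space:
  "openin (adjunction_space X Y B f) U \<longleftrightarrow>
     U \<subseteq> (topspace X <+> topspace Y) // glue_rel (topspace X) (topspace Y) B f \<and>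
     openin X {x \<in> topspace X. glue_class (topspace X) (topspace Y) B f (Inl x) \<in> U} \<and>
     openin Y {y \<in> topspace Y. glue_class (topspace X) (topspace Y) B f (Inr y) \<in> U}"
proof -
  let ?cl = "glue_class (topspace X) (topspace Y) B f"
  let ?Q = "(topspace X <+> topspace Y) // glue_rel (topspace X) (topspace Y) B f"
  have "istopology (\<lambda>U. U \<subseteq> ?Q \<and> openin X {x \<in> topspace X. ?cl (Inl x) \<in> U} \<and>
          openin Y {y \<in> topspace Y. ?cl (Inr y) \<in> U})"
    unfolding istopology_def
  proof (intro conjI allI impI; (elim conjE)?)
    fix U V
    assume "openin X {x \<in> topspace X. ?cl (Inl x) \<in> U}" "openin X {x \<in> topspace X. ?cl (Inl x) \<in> V}"
    from openin_Int[OF this] show "openin X {x \<in> topspace X. ?cl (Inl x) \<in> U \<inter> V}"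
      by (rule back_subst[of "openin X"]) auto
  next
    fix U V
    assume "openin Y {x \<in> topspace Y. ?cl (Inr x) \<in> U}" "openin Y {x \<in> topspace Y. ?cl (Inr x) \<in> V}"
    from openin_Int[OF this] show "openin Y {x \<in> topspace Y. ?cl (Inr x) \<in> U \<inter> V}"
      by (rule back_subst[of "openin Y"]) auto
  next
    fix \<K>
    assume *: "\<forall>K\<in>\<K>. K \<subseteq> ?Q \<and> openin X {x \<in> topspace X. ?cl (Inl x) \<in> K} \<and>
          openin Y {y \<in> topspace Y. ?cl (Inr y) \<in> K}"
    have "openin X (\<Union>K\<in>\<K>. {x \<in> topspace X. ?cl (Inl x) \<in> K})" using * by blast
    then show "openin X {x \<in> topspace X. ?cl (Inl x) \<in> \<Union>\<K>}"
      by (rule back_subst[of "openin X"]) auto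
    have "openin Y (\<Union>K\<in>\<K>. {x \<in> topspace Y. ?cl (Inr x) \<in> K})" using * by blast
    then show "openin Y {x \<in> topspace Y. ?cl (Inr x) \<in> \<Union>\<K>}"
      by (rule back_subst[of "openin Y"]) auto
    show "\<Union>\<K> \<subseteq> ?Q" using * by blast
  qed blast
  then show ?thesis
    unfolding adjunction_space_def Let_def by (subst topology_inverse') (assumption, rule refl)
qed

lemma topspace_adjunction_space:
  "topspace (adjunction_space X Y B f) =
     (topspace X <+> topspace Y) // glue_rel (topspace X) (topspace Y) B f"
  (is "_ = ?Q")
proof -
  have *: "glue_class (topspace X) (topspace Y) B f p \<in> ?Q" if "p \<in> topspace X <+> topspace Y" for p
    using that unfolding glue_class_def by (rule quotientI)
  have "openin (adjunction_space X Y B f) ?Q"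
  proof -
    have "{x \<in> topspace X. glue_class (topspace X) (topspace Y) B f (Inl x) \<in> ?Q} = topspace X"
      "{y \<in> topspace Y. glue_class (topspace X) (topspace Y) B f (Inr y) \<in> ?Q} = topspace Y"
      using * by blast+
    then show ?thesis unfolding openin_adjunction_space by simp
  qed
  then show ?thesis
    using openin_subset openin_adjunction_space[of X Y B f "topspace (adjunction_space X Y B f)"]
    by (intro subset_antisym) auto
qed

text \<open>The map out of an adjunction space induced by maps that agree on glued points.\<close>

definition glue_desc :: "('a \<Rightarrow> 'z) \<Rightarrow> ('b \<Rightarrow> 'z) \<Rightarrow> ('a + 'b) set \<Rightarrow> 'z" where
  "glue_desc a b z = case_sum a b (SOME p. p \<in> z)"

text \<open>
  The algebra of the adjunction of a collared manifold \<open>W\<close> along a map \<open>f\<close> from its boundary;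
  \<open>c\<close> is a collar of width \<open>\<epsilon>\<close>.
\<close>

definition C_ad ::
  "'a topology \<Rightarrow> ('a \<Rightarrow> real) set \<Rightarrow> nat \<Rightarrow> 'b topology \<Rightarrow> 'b atlas \<Rightarrow> real \<Rightarrow> ('b \<times> real \<Rightarrow> 'b) \<Rightarrow>
   ('b \<Rightarrow> 'a) \<Rightarrow> (('a + 'b) set \<Rightarrow> real) set" where
  "C_ad S C s W A \<epsilon> c f =
     (let dW = mfd_boundary s A;
          cl = glue_class (topspace S) (topspace W) dW f
      in {g. (\<lambda>x. g (cl (Inl x))) \<in> C \<and>
             (\<lambda>w. g (cl (Inr w))) \<in> Cinf s (restrict_atlas A (topspace W - dW)) \<and>
             (\<exists>\<delta>>0. \<delta> < \<epsilon> \<and>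
                (\<forall>w\<in>dW. \<forall>t. 0 \<le> t \<and> t < \<delta> \<longrightarrow> g (cl (Inr (c (w, t)))) = g (cl (Inl (f w)))))})"

text \<open>
  The algebra \<open>C_W\<close> on the manifold \<open>W\<close>: that of the adjunction of \<open>W\<close> to its boundary along the
  identity, transported along the canonical bijection of \<open>W\<close> with this adjunction.
\<close>

definition C_mfd ::
  "nat \<Rightarrow> 'b topology \<Rightarrow> 'b atlas \<Rightarrow> real \<Rightarrow> ('b \<times> real \<Rightarrow> 'b) \<Rightarrow> ('b \<Rightarrow> real) set" where
  "C_mfd s W A \<epsilon> c =
     (let dW = mfd_boundary s A
      in {g. \<exists>g'\<in>C_ad (subtopology W dW) (Cinf (s - 1) (boundary_atlas s A)) s W A \<epsilon> c id.
               \<forall>w\<in>topspace W. g w = g' (glue_class dW (topspace W) dW id (Inr w))})"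


section \<open>Diffeological spaces\<close>

text \<open>
  A plot is given by the dimension \<open>q\<close> of its domain, its open domain, and the parametrization,
  of which only the values on the domain matter.
\<close>

type_synonym 'a parametrization = "nat \<times> (nat \<Rightarrow> real) set \<times> ((nat \<Rightarrow> real) \<Rightarrow> 'a)"

record 'a diffeology =
  points :: "'a set"
  plots :: "'a parametrization set"

definition parametrizations :: "'a set \<Rightarrow> 'a parametrization set" where
  "parametrizations X = {(q, U, u). openin (Euclidean_space q) U \<and> u ` U \<subseteq> X}"

definition smooth_map :: "'a diffeology \<Rightarrow> 'b diffeology \<Rightarrow> ('a \<Rightarrow> 'b) \<Rightarrow> bool" where
  "smooth_map X Y h \<longleftrightarrow>
     h ` points X \<subseteq> points Y \<and> (\<forall>(q, U, u)\<in>plots X. (q, U, h \<circ> u) \<in> plots Y)"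

definition real_diffeology :: "real diffeology" where
  "real_diffeology =
     \<lparr>points = UNIV, plots = {(q, U, u) \<in> parametrizations UNIV. smooth_on q U u}\<rparr>"

definition prod_diffeology :: "'a diffeology \<Rightarrow> 'b diffeology \<Rightarrow> ('a \<times> 'b) diffeology" where
  "prod_diffeology X Y =
     \<lparr>points = points X \<times> points Y,
      plots = {(q, U, u). (q, U, fst \<circ> u) \<in> plots X \<and> (q, U, snd \<circ> u) \<in> plots Y}\<rparr>"

definition coprod_diffeology :: "'a diffeology \<Rightarrow> 'b diffeology \<Rightarrow> ('a + 'b) diffeology" where
  "coprod_diffeology X Y =
     \<lparr>points = points X <+> points Y,
      plots = {(q, U, u) \<in> parametrizations (points X <+> points Y).
        \<forall>x\<in>U. \<exists>V. openin (Euclidean_space q) V \<and> x \<in> V \<and> V \<subseteq> U \<and>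
          ((\<exists>v. (q, V, v) \<in> plots X \<and> (\<forall>y\<in>V. u y = Inl (v y))) \<or>
           (\<exists>v. (q, V, v) \<in> plots Y \<and> (\<forall>y\<in>V. u y = Inr (v y))))}\<rparr>"

definition quotient_diffeology :: "'a diffeology \<Rightarrow> ('a \<times> 'a) set \<Rightarrow> 'a set diffeology" where
  "quotient_diffeology X r =
     \<lparr>points = points X // r,
      plots = {(q, U, u) \<in> parametrizations (points X // r).
        \<forall>x\<in>U. \<exists>V v. openin (Euclidean_space q) V \<and> x \<in> V \<and> V \<subseteq> U \<and>
          (q, V, v) \<in> plots X \<and> (\<forall>y\<in>V. u y = r `` {v y})}\<rparr>"

definition adjunction_diffeology ::
  "'a diffeology \<Rightarrow> 'b diffeology \<Rightarrow> 'b set \<Rightarrow> ('b \<Rightarrow> 'a) \<Rightarrow> ('a + 'b) set diffeology" where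
  "adjunction_diffeology X Y B f =
     quotient_diffeology (coprod_diffeology X Y) (glue_rel (points X) (points Y) B f)"

definition smoothly_homotopic ::
  "'a diffeology \<Rightarrow> 'b diffeology \<Rightarrow> ('a \<Rightarrow> 'b) \<Rightarrow> ('a \<Rightarrow> 'b) \<Rightarrow> bool" where
  "smoothly_homotopic X Y h0 h1 \<longleftrightarrow>
     (\<exists>H. smooth_map (prod_diffeology X real_diffeology) Y H \<and>
          (\<forall>x\<in>points X. H (x, 0) = h0 x \<and> H (x, 1) = h1 x))"

definition smooth_homotopy_equivalence ::
  "'a diffeology \<Rightarrow> 'b diffeology \<Rightarrow> ('a \<Rightarrow> 'b) \<Rightarrow> bool" where
  "smooth_homotopy_equivalence X Y h \<longleftrightarrow>
     smooth_map X Y h \<and>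
     (\<exists>h'. smooth_map Y X h' \<and>
           smoothly_homotopic X X (h' \<circ> h) id \<and> smoothly_homotopic Y Y (h \<circ> h') id)"

text \<open>
  The functor \<open>k\<close> is the identity on maps. It takes \<open>(X, C)\<close> to \<open>X\<close> with the parametrizations that
  all functions in \<open>C\<close> pull back to smooth functions.
\<close>

definition k_diff :: "'a topology \<Rightarrow> ('a \<Rightarrow> real) set \<Rightarrow> 'a diffeology" where
  "k_diff X C =
     \<lparr>points = topspace X,
      plots = {(q, U, u) \<in> parametrizations (topspace X). \<forall>\<phi>\<in>C. smooth_on q U (\<phi> \<circ> u)}\<rparr>"

text \<open>The map from the adjunction in diffeological spaces induced by the inclusions of \<open>S\<close> and \<open>W\<close>.\<close>

definition l_map ::
  "'a topology \<Rightarrow> 'b topology \<Rightarrow> 'b set \<Rightarrow> ('b \<Rightarrow> 'a) \<Rightarrow> ('a + 'b) set \<Rightarrow> ('a + 'b) set" where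
  "l_map S W B f =
     (let cl = glue_class (topspace S) (topspace W) B f
      in glue_desc (\<lambda>x. cl (Inl x)) (\<lambda>w. cl (Inr w)))"

lemma l_map_eq_id:
  assumes "z \<in> topspace (adjunction_space S W B f)"
  shows "l_map S W B f z = z"
proof -
  let ?r = "glue_rel (topspace S) (topspace W) B f"
  have z: "z \<in> (topspace S <+> topspace W) // ?r"
    using assms by (simp add: topspace_adjunction_space)
  then obtain p0 where p0: "p0 \<in> topspace S <+> topspace W" "z = ?r `` {p0}"
    by (auto elim: quotientE)
  then have "p0 \<in> z"
    using equiv_class_self[OF equiv_glue_rel] by blast
  then have p: "(SOME p. p \<in> z) \<in> z" by (rule someI)
  then have "?r `` {SOME p. p \<in> z} = z"
  proof -
    have "(p0, SOME p. p \<in> z) \<in> ?r" using p p0(2) by blast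
    from equiv_class_eq[OF equiv_glue_rel this] p0(2) show ?thesis by metis
  qed
  then show ?thesis
    by (cases "SOME p. p \<in> z") (auto simp: l_map_def glue_desc_def glue_class_def Let_def)
qed

end

theory Submission
  imports Defs
begin

text \<open>
  Fix a smooth step function and push the points \<open>c (w, t)\<close> of the collar towards the boundary by
  \<open>H \<tau> (c (w, t)) = c (w, t * (1 - \<mu> \<tau> * \<sigma> t))\<close>, where \<open>\<mu>\<close> falls from 1 to 0 on \<open>[0, 1]\<close> and \<open>\<sigma>\<close> is 1 for
  small \<open>t\<close> and 0 far from the boundary; off the collar and on \<open>S\<close>, \<open>H \<tau>\<close> is the identity. Then \<open>H 1\<close> is the
  identity and \<open>H 0\<close> retracts a neighbourhood of \<open>S\<close> onto \<open>S\<close>. A plot of the stratifold \<open>S \<union>\<^sub>f W\<close> therefore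
  becomes, after \<open>H 0\<close>, locally a plot of \<open>S\<close> or of \<open>W\<close>, so that \<open>H 0\<close> is a smooth map into the diffeological
  adjunction space. It is homotopy inverse to \<open>l\<close> because \<open>H\<close> is smooth for both diffeologies.

  The functions available to test plots are the products \<open>\<sigma> t * b w\<close>, extended by zero off the collar.
  They detect where in the collar a plot runs, and recover its coordinates there. Functions of the
  algebra are constant in \<open>t\<close> near the boundary, which makes \<open>H\<close> harmless where \<open>t\<close> is small.
\<close>

section \<open>Calculus on sequence-indexed Euclidean spaces\<close>

text \<open>On points \<open>l\<close> is the identity, but its inverse need not be smooth: a plot
  of the stratifold may run from \<open>S\<close> across the seam into \<open>W\<close>, and then it
  lifts locally to neither piece. A homotopy inverse therefore has to move points, and it must land
  in \<open>S\<close> throughout a neighbourhood of the seam. The obstacle to proving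
  \<open>H\<close> smooth is that charts of \<open>W\<close> cannot be used along a plot near the
  boundary: each test function is constant in \<open>t\<close> on a strip of its own width \<delta>,
  so \<open>t\<close> is accessible only where it stays away from 0. Smoothness is checked for one
  test function \<open>g\<close> at a time, and the zones into which the parameter domain is cut
  depend on the \<delta> of that \<open>g\<close>. Points of positive depth that \<open>H\<close>
  pushes onto the boundary need separate care, because \<open>g\<close> is given as smooth on the
  boundary and on the interior separately, linked only by its constancy in \<open>t\<close>.
  Compactness of the boundary is what makes extension by zero off the collar smooth.\<close>

abbreviation euc :: "nat \<Rightarrow> (nat \<Rightarrow> real) set" where
  "euc q \<equiv> topspace (Euclidean_space q)"

lemma euc_fun_upd: "x \<in> euc q \<Longrightarrow> i < q \<Longrightarrow> x(i := t) \<in> euc q"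
  by (auto simp: topspace_Euclidean_space)

text \<open>A basic open set of the full product constrains infinitely many coordinates, but those
  from \<open>q\<close> on are 0 for all points of the space, so a minimum over finitely many radii
  is enough.\<close>

lemma openin_Euclidean_space_box:
  assumes "openin (Euclidean_space q) U" "x \<in> U"
  obtains r where "r > 0" "\<And>y. y \<in> euc q \<Longrightarrow> (\<And>i. i < q \<Longrightarrow> \<bar>y i - x i\<bar> < r) \<Longrightarrow> y \<in> U"
proof -
  obtain T where T: "openin (powertop_real UNIV) T" "U = T \<inter> {x. \<forall>i\<ge>q. x i = 0}"
    using assms(1) unfolding Euclidean_space_def openin_subtopology by blast
  then obtain X where X: "x \<in> (\<Pi>\<^sub>E i\<in>UNIV. X i)" "\<And>i. open (X i)" "(\<Pi>\<^sub>E i\<in>UNIV. X i) \<subseteq> T"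
    using product_topology_open_contains_basis[OF T(1), of x] assms(2) by auto
  have "\<exists>e>0. ball (x i) e \<subseteq> X i" for i
    using X(1,2) by (metis PiE_mem UNIV_I open_contains_ball)
  then obtain e where e: "\<And>i. e i > 0" "\<And>i. ball (x i) (e i) \<subseteq> X i" by metis
  \<comment> \<open>The inserted 1 keeps the set nonempty when \<open>q = 0\<close>.\<close>
  define r where "r = Min (insert 1 (e ` {..<q}))"
  have r: "r > 0" "\<And>i. i < q \<Longrightarrow> r \<le> e i"
    using e(1) by (auto simp: r_def)
  show thesis
  proof (rule that[OF r(1)])
    fix y assume y: "y \<in> euc q" "\<And>i. i < q \<Longrightarrow> \<bar>y i - x i\<bar> < r"
    have "y i \<in> X i" for i
    proof (cases "i < q")
      case True
      then have "y i \<in> ball (x i) (e i)" using y(2)[of i] r(2)[of i]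
        by (auto simp: dist_real_def)
      then show ?thesis using e(2) by blast
    next
      case False
      then have "y i = x i" using y(1) assms(2) T(2) by (auto simp: topspace_Euclidean_space)
      then show ?thesis using X(1) by (auto simp: PiE_iff)
    qed
    then show "y \<in> U" using X(3) T(2) y(1) by (auto simp: PiE_iff topspace_Euclidean_space)
  qed
qed

text \<open>The endpoints come in either order or coincide. This spares the telescoping argument
  below a distinction by the sign of a coordinate increment.\<close>

lemma mean_value_two_sided:
  fixes g g' :: "real \<Rightarrow> real"
  assumes "\<And>x. min a b \<le> x \<Longrightarrow> x \<le> max a b \<Longrightarrow> (g has_real_derivative g' x) (at x)"
  obtains \<xi> where "min a b \<le> \<xi>" "\<xi> \<le> max a b" "g b - g a = (b - a) * g' \<xi>"
proof (cases a b rule: linorder_cases)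
  case less
  with MVT2[of a b g g'] assms obtain z where "a < z" "z < b" "g b - g a = (b - a) * g' z" by auto
  then show ?thesis using that[of z] by auto
next
  case equal
  then show ?thesis using that[of a] by auto
next
  case greater
  with MVT2[of b a g g'] assms obtain z where "b < z" "z < a" "g a - g b = (a - b) * g' z" by auto
  then show ?thesis using that[of z] by (auto simp: algebra_simps)
qed

text \<open>The increment of \<open>F\<close> is telescoped, changing one coordinate at a time.\<close>

lemma has_real_derivative_along_curve:
  assumes U: "openin (Euclidean_space m) U"
    and dF: "\<And>j x. j < m \<Longrightarrow> x \<in> U \<Longrightarrow> ((\<lambda>t. F (x(j := t))) has_real_derivative F' j x) (at (x j))"
    and cF: "\<And>j. j < m \<Longrightarrow> continuous_map (subtopology (Euclidean_space m) U) euclideanreal (F' j)"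
    and u: "\<And>j. j < m \<Longrightarrow> ((\<lambda>t. u t j) has_real_derivative d j) (at t0)"
    and ue: "\<And>t. u t \<in> euc m" and u0: "u t0 \<in> U"
  shows "((\<lambda>t. F (u t)) has_real_derivative (\<Sum>j<m. F' j (u t0) * d j)) (at t0)"
proof -
  define x0 where "x0 = u t0"
  \<comment> \<open>\<open>z j t\<close> interpolates between the base point and \<open>u t\<close>:
    the coordinates below \<open>j\<close> have already moved.\<close>
  define z where "z j t = (\<lambda>i. if i < j then u t i else x0 i)" for j t
  have zSuc: "z (Suc j) t = (z j t)(j := u t j)" for j t
    by (auto simp: z_def less_Suc_eq)
  have zm: "z m t = u t" for t
    using ue[of t] ue[of t0] by (auto simp: z_def x0_def topspace_Euclidean_space)
  have incr: "((\<lambda>t. F (z (Suc j) t) - F (z j t)) has_real_derivative F' j x0 * d j) (at t0)" if j: "j < m" for j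
  proof -
    define D where "D t = F (z (Suc j) t) - F (z j t)" for t
    \<comment> \<open>The difference quotient in coordinate \<open>j\<close>, completed by the
      partial derivative at times when that coordinate has not moved. The factorisation of
      \<open>D\<close> then holds without division by zero, and the limit of \<open>Q\<close>
      suffices.\<close>
    define Q where "Q t = (if u t j = x0 j then F' j x0 else D t / (u t j - x0 j))" for t
    have Deq: "D t = Q t * (u t j - x0 j)" for t
    proof (cases "u t j = x0 j")
      case True
      then have "z (Suc j) t = z j t" unfolding zSuc by (auto simp: z_def)
      then show ?thesis using True by (simp add: D_def)
    qed (simp add: Q_def)
    have Q: "(Q \<longlongrightarrow> F' j x0) (at t0)"
      unfolding tendsto_iff
    proof (intro allI impI)
      fix e :: real assume e: "0 < e"
      define U' where "U' = {y \<in> topspace (subtopology (Euclidean_space m) U). F' j y \<in> ball (F' j x0) e}"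
      have "openin (subtopology (Euclidean_space m) U) U'"
        unfolding U'_def by (rule openin_continuous_map_preimage[OF cF[OF j]]) auto
      then have U': "openin (Euclidean_space m) U'" using U by (simp add: openin_open_subtopology)
      have "x0 \<in> U'" using u0 ue[of t0] e by (auto simp: U'_def x0_def)
      from openin_Euclidean_space_box[OF U' this] obtain r where r: "r > 0"
        "\<And>y. y \<in> euc m \<Longrightarrow> (\<And>i. i < m \<Longrightarrow> \<bar>y i - x0 i\<bar> < r) \<Longrightarrow> y \<in> U'" by blast
      have "\<forall>\<^sub>F t in at t0. \<bar>u t i - x0 i\<bar> < r" if "i < m" for i
      proof -
        have "isCont (\<lambda>t. u t i) t0" using u[OF that] by (rule DERIV_isCont)
        then have "((\<lambda>t. u t i) \<longlongrightarrow> x0 i) (at t0)" by (simp add: isCont_def x0_def)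
        from tendstoD[OF this r(1)] show ?thesis by (simp add: dist_real_def)
      qed
      then have "\<forall>\<^sub>F t in at t0. \<forall>i\<in>{..<m}. \<bar>u t i - x0 i\<bar> < r"
        by (intro eventually_ball_finite) auto
      then show "\<forall>\<^sub>F t in at t0. dist (Q t) (F' j x0) < e"
      proof eventually_elim
        case (elim t)
        have box: "(z j t)(j := b) \<in> U'" if "min (x0 j) (u t j) \<le> b" "b \<le> max (x0 j) (u t j)" for b
        proof (rule r(2))
          show "(z j t)(j := b) \<in> euc m"
            using ue[of t] ue[of t0] j by (auto simp: z_def x0_def topspace_Euclidean_space)
          fix i assume i: "i < m"
          have "\<bar>b - x0 j\<bar> \<le> \<bar>u t j - x0 j\<bar>" using that by (auto simp: min_def max_def split: if_splits)
          also have "\<dots> < r" using elim j by simp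
          finally show "\<bar>((z j t)(j := b)) i - x0 i\<bar> < r"
            using elim i r(1) by (auto simp: z_def)
        qed
        have "((\<lambda>b. F ((z j t)(j := b))) has_real_derivative F' j ((z j t)(j := b))) (at b)"
          if "min (x0 j) (u t j) \<le> b" "b \<le> max (x0 j) (u t j)" for b
          using dF[OF j, of "(z j t)(j := b)"] box[OF that] by (auto simp: U'_def)
        from mean_value_two_sided[of "x0 j" "u t j", OF this] obtain \<xi>
          where \<xi>: "min (x0 j) (u t j) \<le> \<xi>" "\<xi> \<le> max (x0 j) (u t j)"
            "F ((z j t)(j := u t j)) - F ((z j t)(j := x0 j)) = (u t j - x0 j) * F' j ((z j t)(j := \<xi>))"
          by blast
        have "(z j t)(j := x0 j) = z j t" by (auto simp: z_def)
        then have "D t = (u t j - x0 j) * F' j ((z j t)(j := \<xi>))"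
          using \<xi>(3) by (simp add: D_def zSuc)
        then have "Q t = F' j x0 \<or> Q t = F' j ((z j t)(j := \<xi>))" by (auto simp: Q_def)
        moreover have "dist (F' j x0) (F' j ((z j t)(j := \<xi>))) < e"
          using box[OF \<xi>(1,2)] by (auto simp: U'_def)
        ultimately show ?case using e by (auto simp: dist_commute)
      qed
    qed
    have D0: "D t0 = 0" by (simp add: Deq x0_def)
    have "((\<lambda>t. Q t * ((u t j - u t0 j) / (t - t0))) \<longlongrightarrow> F' j x0 * d j) (at t0)"
      using u[OF j] by (intro tendsto_mult Q) (simp add: has_field_derivative_iff)
    then show ?thesis
      unfolding D_def[symmetric] has_field_derivative_iff D0 by (simp add: Deq x0_def)
  qed
  have "((\<lambda>t. F (z j t)) has_real_derivative (\<Sum>i<j. F' i x0 * d i)) (at t0)" if "j \<le> m" for j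
    using that
  proof (induction j)
    case 0
    then show ?case by (simp add: z_def)
  next
    case (Suc j)
    have "((\<lambda>t. F (z j t) + (F (z (Suc j) t) - F (z j t))) has_real_derivative
       (\<Sum>i<j. F' i x0 * d i) + F' j x0 * d j) (at t0)"
      using Suc by (intro DERIV_add incr) auto
    then show ?case by simp
  qed
  from this[of m] show ?thesis by (simp add: zm x0_def)
qed

section \<open>Iterated partial derivatives and the chain rule\<close>

lemma Ck_continuous: "Ck q k U f \<Longrightarrow> continuous_map (subtopology (Euclidean_space q) U) euclideanreal f"
  by (cases k) auto

lemma Ck_SucE:
  assumes "Ck q (Suc k) U f" "i < q"
  obtains f' where "\<forall>x\<in>U. ((\<lambda>t. f (x(i := t))) has_real_derivative f' x) (at (x i))" "Ck q k U f'"
  using assms by auto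

lemma Ck_partials:
  assumes "Ck q (Suc k) U f"
  obtains f' where
    "\<forall>i<q. \<forall>x\<in>U. ((\<lambda>t. f (x(i := t))) has_real_derivative f' i x) (at (x i))"
    "\<forall>i<q. Ck q k U (f' i)"
proof -
  have "\<forall>i\<in>{..<q}. \<exists>f'. (\<forall>x\<in>U. ((\<lambda>t. f (x(i := t))) has_real_derivative f' x) (at (x i))) \<and> Ck q k U f'"
    using assms by simp
  from bchoice[OF this] show thesis using that by auto
qed

lemma Ck_SucD: "Ck q (Suc k) U f \<Longrightarrow> Ck q k U f"
proof (induction k arbitrary: f)
  case (Suc k)
  then show ?case unfolding Ck.simps(2)[of q "Suc k"] Ck.simps(2)[of q k] by blast
qed simp

lemma Ck_subset: "Ck q k U f \<Longrightarrow> V \<subseteq> U \<Longrightarrow> Ck q k V f"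
proof (induction k arbitrary: f)
  case 0
  then show ?case using continuous_map_from_subtopology_mono by auto
next
  case (Suc k)
  have "\<exists>f'. (\<forall>x\<in>V. ((\<lambda>t. f (x(i := t))) has_real_derivative f' x) (at (x i))) \<and> Ck q k V f'"
    if i: "i < q" for i
  proof -
    obtain f' where "\<forall>x\<in>U. ((\<lambda>t. f (x(i := t))) has_real_derivative f' x) (at (x i))" "Ck q k U f'"
      by (rule Ck_SucE[OF Suc.prems(1) i])
    then show ?thesis using Suc.IH Suc.prems(2) by blast
  qed
  then show ?case
    using continuous_map_from_subtopology_mono[OF Ck_continuous[OF Suc.prems(1)] Suc.prems(2)] by simp
qed

lemma Ck_const: "Ck q k U (\<lambda>_. a)"
proof (induction k arbitrary: a)
  case (Suc k)
  have "\<exists>f'. (\<forall>x\<in>U. ((\<lambda>t. a) has_real_derivative f' x) (at (x i))) \<and> Ck q k U f'" for i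
    using Suc[of 0] by (intro exI[of _ "\<lambda>_. 0"]) auto
  then show ?case by simp
qed simp

lemma continuous_map_Euclidean_coord:
  "continuous_map (subtopology (Euclidean_space q) U) euclideanreal (\<lambda>x. x j)"
  unfolding Euclidean_space_def
  by (intro continuous_map_from_subtopology continuous_map_product_projection) auto

lemma Ck_coord: "Ck q k U (\<lambda>x. x j)"
proof (cases k)
  case (Suc k')
  have "\<exists>f'. (\<forall>x\<in>U. ((\<lambda>t. (x(i := t)) j) has_real_derivative f' x) (at (x i))) \<and> Ck q k' U f'" for i
    by (intro exI[of _ "\<lambda>_. if i = j then 1 else 0"] conjI Ck_const) auto
  then show ?thesis using Suc by (simp add: continuous_map_Euclidean_coord)
qed (simp add: continuous_map_Euclidean_coord)

lemma Ck_add: "Ck q k U f \<Longrightarrow> Ck q k U g \<Longrightarrow> Ck q k U (\<lambda>x. f x + g x)"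
proof (induction k arbitrary: f g)
  case (Suc k)
  have "\<exists>h'. (\<forall>x\<in>U. ((\<lambda>t. f (x(i := t)) + g (x(i := t))) has_real_derivative h' x) (at (x i))) \<and> Ck q k U h'"
    if i: "i < q" for i
  proof -
    obtain f' where f': "\<forall>x\<in>U. ((\<lambda>t. f (x(i := t))) has_real_derivative f' x) (at (x i))" "Ck q k U f'"
      by (rule Ck_SucE[OF Suc.prems(1) i])
    obtain g' where g': "\<forall>x\<in>U. ((\<lambda>t. g (x(i := t))) has_real_derivative g' x) (at (x i))" "Ck q k U g'"
      by (rule Ck_SucE[OF Suc.prems(2) i])
    show ?thesis
      by (intro exI[of _ "\<lambda>x. f' x + g' x"] conjI ballI Suc.IH DERIV_add f'[rule_format] g'[rule_format])
  qed
  then show ?case using Suc.prems by (auto intro!: continuous_map_add)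
qed (auto intro!: continuous_map_add)

lemma Ck_mult: "Ck q k U f \<Longrightarrow> Ck q k U g \<Longrightarrow> Ck q k U (\<lambda>x. f x * g x)"
proof (induction k arbitrary: f g)
  case (Suc k)
  have *: "Ck q k U f' \<Longrightarrow> Ck q k U (\<lambda>x. f' x * g x)" for f'
    by (rule Suc.IH[OF _ Ck_SucD[OF Suc.prems(2)]])
  have **: "Ck q k U f' \<Longrightarrow> Ck q k U (\<lambda>x. f' x * f x)" for f'
    by (rule Suc.IH[OF _ Ck_SucD[OF Suc.prems(1)]])
  have "\<exists>h'. (\<forall>x\<in>U. ((\<lambda>t. f (x(i := t)) * g (x(i := t))) has_real_derivative h' x) (at (x i))) \<and> Ck q k U h'"
    if i: "i < q" for i
  proof -
    obtain f' where f': "\<forall>x\<in>U. ((\<lambda>t. f (x(i := t))) has_real_derivative f' x) (at (x i))" "Ck q k U f'"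
      by (rule Ck_SucE[OF Suc.prems(1) i])
    obtain g' where g': "\<forall>x\<in>U. ((\<lambda>t. g (x(i := t))) has_real_derivative g' x) (at (x i))" "Ck q k U g'"
      by (rule Ck_SucE[OF Suc.prems(2) i])
    have "((\<lambda>t. f (x(i := t)) * g (x(i := t))) has_real_derivative f' x * g x + g' x * f x) (at (x i))" if "x \<in> U" for x
      using DERIV_mult[OF f'(1)[rule_format, OF that] g'(1)[rule_format, OF that]] by simp
    moreover have "Ck q k U (\<lambda>x. f' x * g x + g' x * f x)"
      by (rule Ck_add[OF *[OF f'(2)] **[OF g'(2)]])
    ultimately show ?thesis by (intro exI[of _ "\<lambda>x. f' x * g x + g' x * f x"]) simp
  qed
  then show ?case using Suc.prems by (auto intro!: continuous_map_real_mult)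
qed (auto intro!: continuous_map_real_mult)

lemma Ck_sum: "finite I \<Longrightarrow> (\<And>i. i \<in> I \<Longrightarrow> Ck q k U (f i)) \<Longrightarrow> Ck q k U (\<lambda>x. \<Sum>i\<in>I. f i x)"
  by (induction I rule: finite_induct) (auto intro: Ck_const Ck_add)

text \<open>Packs \<open>m\<close> component functions into a map to the space of dimension
  \<open>m\<close>, whose points must vanish from index \<open>m\<close> on.\<close>

definition trunc :: "nat \<Rightarrow> (nat \<Rightarrow> real) \<Rightarrow> nat \<Rightarrow> real" where
  "trunc m y = (\<lambda>i. if i < m then y i else 0)"

lemma trunc_in_euc [simp]: "trunc m y \<in> euc m"
  by (auto simp: trunc_def topspace_Euclidean_space)

lemma trunc_id: "y \<in> euc m \<Longrightarrow> trunc m y = y"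
  by (auto simp: trunc_def topspace_Euclidean_space)

lemma trunc_nth [simp]: "i < m \<Longrightarrow> trunc m y i = y i"
  by (auto simp: trunc_def)

lemma continuous_map_trunc:
  "continuous_map X (Euclidean_space m) (\<lambda>x. trunc m (\<lambda>i. u i x)) \<longleftrightarrow>
    (\<forall>j<m. continuous_map X euclideanreal (u j))"
  unfolding trunc_def by (simp add: continuous_map_componentwise_Euclidean_space eta_contract_eq)

text \<open>Induction on \<open>k\<close>: by the chain rule a partial derivative of the composite
  is a finite sum of products of a partial derivative of \<open>F\<close> along \<open>u\<close>
  with one of \<open>u\<close>. The first factor is of class \<open>k\<close> by the induction
  hypothesis, since \<open>F\<close> is arbitrary there.\<close>

lemma Ck_compose:
  assumes V: "openin (Euclidean_space q) V" and U: "openin (Euclidean_space m) U"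
  shows "(\<And>j. j < m \<Longrightarrow> Ck q k V (u j)) \<Longrightarrow> (\<And>x. x \<in> V \<Longrightarrow> trunc m (\<lambda>j. u j x) \<in> U) \<Longrightarrow> Ck m k U F
    \<Longrightarrow> Ck q k V (\<lambda>x. F (trunc m (\<lambda>j. u j x)))"
proof (induction k arbitrary: F)
  case 0
  have "continuous_map (subtopology (Euclidean_space q) V) (subtopology (Euclidean_space m) U) (\<lambda>x. trunc m (\<lambda>j. u j x))"
    using 0(1,2) by (auto simp: continuous_map_in_subtopology continuous_map_trunc)
  from continuous_map_compose[OF this, of euclideanreal F] 0(3) show ?case by (simp add: o_def)
next
  case (Suc k)
  define v where "v x = trunc m (\<lambda>j. u j x)" for x
  have veq: "v = (\<lambda>x. trunc m (\<lambda>j. u j x))" by (simp add: v_def fun_eq_iff)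
  have "continuous_map (subtopology (Euclidean_space q) V) (subtopology (Euclidean_space m) U) v"
    using Ck_continuous[OF Suc.prems(1)] Suc.prems(2)
    by (auto simp: continuous_map_in_subtopology continuous_map_trunc veq)
  from continuous_map_compose[OF this, of euclideanreal F] Ck_continuous[OF Suc.prems(3)]
  have cont: "continuous_map (subtopology (Euclidean_space q) V) euclideanreal (\<lambda>x. F (v x))" by (simp add: o_def)
  obtain F' where F': "\<forall>j<m. \<forall>x\<in>U. ((\<lambda>t. F (x(j := t))) has_real_derivative F' j x) (at (x j))"
    "\<forall>j<m. Ck m k U (F' j)"
    by (rule Ck_partials[OF Suc.prems(3)])
  have "\<exists>h'. (\<forall>x\<in>V. ((\<lambda>t. F (v (x(i := t)))) has_real_derivative h' x) (at (x i))) \<and> Ck q k V h'"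
    if i: "i < q" for i
  proof -
    have "\<forall>j\<in>{..<m}. \<exists>u'. (\<forall>x\<in>V. ((\<lambda>t. u j (x(i := t))) has_real_derivative u' x) (at (x i))) \<and> Ck q k V u'"
      using Suc.prems(1) i by simp
    from bchoice[OF this] obtain u' where
      u': "\<forall>j\<in>{..<m}. (\<forall>x\<in>V. ((\<lambda>t. u j (x(i := t))) has_real_derivative u' j x) (at (x i))) \<and> Ck q k V (u' j)" ..
    have "((\<lambda>t. F (v (x(i := t)))) has_real_derivative (\<Sum>j<m. F' j (v (x(i := x i))) * u' j x)) (at (x i))"
      if x: "x \<in> V" for x
    proof (rule has_real_derivative_along_curve[OF U])
      show "v (x(i := x i)) \<in> U" using Suc.prems(2)[OF x] by (simp add: v_def)
      show "continuous_map (subtopology (Euclidean_space m) U) euclideanreal (F' j)" if "j < m" for j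
        using F'(2) that Ck_continuous by blast
      show "((\<lambda>t. F (x(j := t))) has_real_derivative F' j x) (at (x j))" if "j < m" "x \<in> U" for j x
        using F'(1) that by blast
      show "((\<lambda>t. v (x(i := t)) j) has_real_derivative u' j x) (at (x i))" if "j < m" for j
        using u' x that unfolding v_def by simp
    qed (simp add: v_def)
    moreover have "Ck q k V (\<lambda>x. \<Sum>j<m. F' j (v x) * u' j x)"
    proof (intro Ck_sum Ck_mult)
      fix j assume j: "j \<in> {..<m}"
      show "Ck q k V (\<lambda>x. F' j (v x))" unfolding v_def
        using F'(2) j by (intro Suc.IH[OF Ck_SucD[OF Suc.prems(1)] Suc.prems(2)]) auto
      show "Ck q k V (u' j)" using u' j by blast
    qed simp
    ultimately show ?thesis by (intro exI[of _ "\<lambda>x. \<Sum>j<m. F' j (v x) * u' j x"]) simp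
  qed
  then show ?case using cont by (simp add: v_def)
qed

section \<open>Smooth functions on subsets\<close>

lemma smooth_onI:
  "(\<And>x. x \<in> V \<Longrightarrow> \<exists>U g. openin (Euclidean_space q) U \<and> x \<in> U \<and> (\<forall>k. Ck q k U g) \<and> (\<forall>y\<in>U \<inter> V. g y = f y))
   \<Longrightarrow> smooth_on q V f"
  by (simp add: smooth_on_def)

lemma smooth_onE:
  assumes "smooth_on q V f" "x \<in> V"
  obtains U g where "openin (Euclidean_space q) U" "x \<in> U" "\<forall>k. Ck q k U g" "\<forall>y\<in>U \<inter> V. g y = f y"
  using assms unfolding smooth_on_def by auto

lemma smooth_on_in_euc: "smooth_on q V f \<Longrightarrow> V \<subseteq> euc q"
  using openin_subset unfolding smooth_on_def by fastforce

lemma smooth_on_subset: "smooth_on q V f \<Longrightarrow> V' \<subseteq> V \<Longrightarrow> smooth_on q V' f"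
  unfolding smooth_on_def by (meson Int_iff subsetD)

lemma smooth_on_cong: "smooth_on q V f \<Longrightarrow> (\<And>x. x \<in> V \<Longrightarrow> f x = g x) \<Longrightarrow> smooth_on q V g"
  unfolding smooth_on_def by (metis Int_iff)

text \<open>This is how case distinctions at a point become proofs of smoothness. The neighbourhoods
  are intersected with \<open>V\<close> because images of charts of \<open>W\<close> are open only
  in the half-space.\<close>

lemma smooth_on_local:
  assumes "\<And>x. x \<in> V \<Longrightarrow> \<exists>O'. openin (Euclidean_space q) O' \<and> x \<in> O' \<and> smooth_on q (V \<inter> O') f"
  shows "smooth_on q V f"
proof (rule smooth_onI)
  fix x assume x: "x \<in> V"
  with assms obtain O' where O: "openin (Euclidean_space q) O'" "x \<in> O'" "smooth_on q (V \<inter> O') f" by blast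
  have "x \<in> V \<inter> O'" using x O(2) by simp
  then obtain U g where U: "openin (Euclidean_space q) U" "x \<in> U" "\<forall>k. Ck q k U g" 
     "\<forall>y\<in>U \<inter> (V \<inter> O'). g y = f y" by (rule smooth_onE[OF O(3)])
  then have "\<forall>k. Ck q k (U \<inter> O') g" by (simp add: Ck_subset[of _ _ U])
  then show "\<exists>U g. openin (Euclidean_space q) U \<and> x \<in> U \<and> (\<forall>k. Ck q k U g) \<and> (\<forall>y\<in>U \<inter> V. g y = f y)"
    using O U by (intro exI[of _ "U \<inter> O'"] exI[of _ g]) auto
qed

lemma smooth_on_const: "V \<subseteq> euc q \<Longrightarrow> smooth_on q V (\<lambda>_. a)"
  by (rule smooth_onI) (auto intro!: exI[of _ "euc q"] exI[of _ "\<lambda>_. a"] Ck_const)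

lemma smooth_on_coord: "V \<subseteq> euc q \<Longrightarrow> smooth_on q V (\<lambda>x. x j)"
  by (rule smooth_onI) (auto intro!: exI[of _ "euc q"] exI[of _ "\<lambda>x. x j"] Ck_coord)

lemma openin_INT_lessThan:
  fixes m :: nat
  assumes "\<And>j. j < m \<Longrightarrow> openin (Euclidean_space q) (O' j)"
  shows "openin (Euclidean_space q) (euc q \<inter> (\<Inter>j<m. O' j))"
  using assms
proof (induction m)
  case (Suc m)
  have "euc q \<inter> (\<Inter>j<Suc m. O' j) = (euc q \<inter> (\<Inter>j<m. O' j)) \<inter> O' m"
    by (auto simp: less_Suc_eq)
  then show ?case using Suc by auto
qed simp

text \<open>Extensions of the components of \<open>u\<close> may leave \<open>V'\<close>, but they
  take the base point into the open domain on which \<open>F\<close> is extended. Shrinking to the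
  preimage \<open>R\<close> of that domain reduces the claim to \<open>Ck_compose\<close>.\<close>

lemma smooth_on_compose:
  assumes F: "smooth_on m V' F" and u: "\<And>j. j < m \<Longrightarrow> smooth_on q V (\<lambda>x. u x j)"
    and V: "V \<subseteq> euc q" "\<And>x. x \<in> V \<Longrightarrow> u x \<in> V'"
  shows "smooth_on q V (\<lambda>x. F (u x))"
proof (rule smooth_onI)
  fix x assume x: "x \<in> V"
  obtain U G where G: "openin (Euclidean_space m) U" "u x \<in> U" "\<forall>k. Ck m k U G" "\<forall>y\<in>U \<inter> V'. G y = F y"
    by (rule smooth_onE[OF F V(2)[OF x]])
  have "\<forall>j\<in>{..<m}. \<exists>Og. openin (Euclidean_space q) (fst Og) \<and> x \<in> fst Og \<and>
      (\<forall>k. Ck q k (fst Og) (snd Og)) \<and> (\<forall>y\<in>fst Og \<inter> V. snd Og y = u y j)"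
    using u x unfolding smooth_on_def by simp
  from bchoice[OF this] obtain Og where Og: "\<forall>j\<in>{..<m}. openin (Euclidean_space q) (fst (Og j)) \<and>
      x \<in> fst (Og j) \<and> (\<forall>k. Ck q k (fst (Og j)) (snd (Og j))) \<and> (\<forall>y\<in>fst (Og j) \<inter> V. snd (Og j) y = u y j)" ..
  define O' where "O' j = fst (Og j)" for j
  define g where "g j = snd (Og j)" for j
  have g: "\<And>j. j < m \<Longrightarrow> openin (Euclidean_space q) (O' j)" "\<And>j. j < m \<Longrightarrow> x \<in> O' j"
      "\<And>j k. j < m \<Longrightarrow> Ck q k (O' j) (g j)" "\<And>j y. j < m \<Longrightarrow> y \<in> O' j \<Longrightarrow> y \<in> V \<Longrightarrow> g j y = u y j"
    using Og by (auto simp: O'_def g_def)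
  define P where "P = euc q \<inter> (\<Inter>j<m. O' j)"
  have P: "openin (Euclidean_space q) P" "x \<in> P"
    unfolding P_def using g V(1) x by (auto intro!: openin_INT_lessThan)
  have gP: "Ck q k P (g j)" if "j < m" for j k
    by (rule Ck_subset[OF g(3)[OF that]]) (use that in \<open>auto simp: P_def\<close>)
  define v where "v y = trunc m (\<lambda>j. g j y)" for y
  have vu: "v y = u y" if "y \<in> P" "y \<in> V" for y
  proof -
    have "v y = trunc m (u y)" using g(4) that by (auto simp: v_def trunc_def P_def)
    then show ?thesis using trunc_id V(2)[OF that(2)] smooth_on_in_euc[OF F] by fastforce
  qed
  have cv: "continuous_map (subtopology (Euclidean_space q) P) (Euclidean_space m) v"
    unfolding v_def continuous_map_trunc using Ck_continuous[OF gP] by blast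
  define R where "R = {y \<in> topspace (subtopology (Euclidean_space q) P). v y \<in> U}"
  have "openin (subtopology (Euclidean_space q) P) R"
    unfolding R_def by (rule openin_continuous_map_preimage[OF cv G(1)])
  then have R: "openin (Euclidean_space q) R" using P by (simp add: openin_open_subtopology)
  have RP: "R \<subseteq> P" by (auto simp: R_def)
  show "\<exists>U g. openin (Euclidean_space q) U \<and> x \<in> U \<and> (\<forall>k. Ck q k U g) \<and> (\<forall>y\<in>U \<inter> V. g y = F (u y))"
  proof (intro exI conjI allI ballI)
    show "x \<in> R" using P x vu G(2) V(1) by (auto simp: R_def)
    show "Ck q k R (\<lambda>y. G (v y))" for k
      unfolding v_def
      by (rule Ck_compose[OF R G(1) Ck_subset[OF gP RP] _ G(3)[rule_format]]) (auto simp: R_def v_def)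
    fix y assume "y \<in> R \<inter> V"
    then show "G (v y) = F (u y)" using vu RP G(4) V(2) by (auto simp: R_def)
  qed (rule R)
qed

lemma smooth_on_add:
  assumes f: "smooth_on q V f" and g: "smooth_on q V g"
  shows "smooth_on q V (\<lambda>x. f x + g x)"
proof (rule smooth_onI)
  fix x assume x: "x \<in> V"
  obtain U F where F: "openin (Euclidean_space q) U" "x \<in> U" "\<forall>k. Ck q k U F" "\<forall>y\<in>U \<inter> V. F y = f y"
    by (rule smooth_onE[OF f x])
  obtain U' G where G: "openin (Euclidean_space q) U'" "x \<in> U'" "\<forall>k. Ck q k U' G" "\<forall>y\<in>U' \<inter> V. G y = g y"
    by (rule smooth_onE[OF g x])
  have "Ck q k (U \<inter> U') (\<lambda>y. F y + G y)" for k
    by (intro Ck_add Ck_subset[OF F(3)[rule_format]] Ck_subset[OF G(3)[rule_format]]) auto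
  then show "\<exists>U h. openin (Euclidean_space q) U \<and> x \<in> U \<and> (\<forall>k. Ck q k U h) \<and> (\<forall>y\<in>U \<inter> V. h y = f y + g y)"
    using F G by (intro exI[of _ "U \<inter> U'"] exI[of _ "\<lambda>y. F y + G y"]) auto
qed

lemma smooth_on_mult:
  assumes f: "smooth_on q V f" and g: "smooth_on q V g"
  shows "smooth_on q V (\<lambda>x. f x * g x)"
proof (rule smooth_onI)
  fix x assume x: "x \<in> V"
  obtain U F where F: "openin (Euclidean_space q) U" "x \<in> U" "\<forall>k. Ck q k U F" "\<forall>y\<in>U \<inter> V. F y = f y"
    by (rule smooth_onE[OF f x])
  obtain U' G where G: "openin (Euclidean_space q) U'" "x \<in> U'" "\<forall>k. Ck q k U' G" "\<forall>y\<in>U' \<inter> V. G y = g y"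
    by (rule smooth_onE[OF g x])
  have "Ck q k (U \<inter> U') (\<lambda>y. F y * G y)" for k
    by (intro Ck_mult Ck_subset[OF F(3)[rule_format]] Ck_subset[OF G(3)[rule_format]]) auto
  then show "\<exists>U h. openin (Euclidean_space q) U \<and> x \<in> U \<and> (\<forall>k. Ck q k U h) \<and> (\<forall>y\<in>U \<inter> V. h y = f y * g y)"
    using F G by (intro exI[of _ "U \<inter> U'"] exI[of _ "\<lambda>y. F y * G y"]) auto
qed

lemma smooth_on_diff: "smooth_on q V f \<Longrightarrow> smooth_on q V g \<Longrightarrow> smooth_on q V (\<lambda>x. f x - g x)"
  using smooth_on_add[of q V f "\<lambda>x. (-1) * g x"] smooth_on_mult[OF smooth_on_const, of V q g "-1"]
    smooth_on_in_euc[of q V g] by simp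

lemma smooth_on_prod:
  "finite I \<Longrightarrow> V \<subseteq> euc q \<Longrightarrow> (\<And>i. i \<in> I \<Longrightarrow> smooth_on q V (f i)) \<Longrightarrow> smooth_on q V (\<lambda>x. \<Prod>i\<in>I. f i x)"
  by (induction I rule: finite_induct) (auto intro: smooth_on_const smooth_on_mult)

lemma smooth_on_continuous_map:
  assumes V: "openin (Euclidean_space q) V" and f: "smooth_on q V f"
  shows "continuous_map (subtopology (Euclidean_space q) V) euclideanreal f"
proof (subst continuous_map)
  have *: "openin (Euclidean_space q) {x \<in> V. f x \<in> T}" if T: "openin euclideanreal T" for T
  proof (subst openin_subopen, intro ballI)
    fix x assume x: "x \<in> {x \<in> V. f x \<in> T}"
    then have "x \<in> V" by simp
    then obtain U g where U: "openin (Euclidean_space q) U" "x \<in> U" "\<forall>k. Ck q k U g" "\<forall>y\<in>U \<inter> V. g y = f y"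
      by (rule smooth_onE[OF f])
    define R where "R = {y \<in> topspace (subtopology (Euclidean_space q) U). g y \<in> T}"
    have "openin (subtopology (Euclidean_space q) U) R"
      unfolding R_def by (rule openin_continuous_map_preimage[OF Ck_continuous[OF U(3)[rule_format, of 0]] T])
    then have "openin (Euclidean_space q) (R \<inter> V)" using U V by (auto simp: openin_open_subtopology)
    moreover have "x \<in> R \<inter> V" "R \<inter> V \<subseteq> {x \<in> V. f x \<in> T}"
      using x U openin_subset[OF V] by (auto simp: R_def)
    ultimately show "\<exists>T'. openin (Euclidean_space q) T' \<and> x \<in> T' \<and> T' \<subseteq> {x \<in> V. f x \<in> T}" by blast
  qed
  show "f ` topspace (subtopology (Euclidean_space q) V) \<subseteq> topspace euclideanreal \<and>
    (\<forall>T. openin euclideanreal T \<longrightarrow> openin (subtopology (Euclidean_space q) V)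
       {x \<in> topspace (subtopology (Euclidean_space q) V). f x \<in> T})"
    unfolding topspace_subtopology_subset[OF openin_subset[OF V]] openin_open_subtopology[OF V]
    by (intro conjI allI impI *) auto
qed

text \<open>Plots are not assumed continuous; openness of conditions on them comes only from here,
  by applying a test function and asking its value to be positive or below 1.\<close>

lemma openin_smooth_preimage:
  assumes V: "openin (Euclidean_space q) V" and "smooth_on q V f" "open T"
  shows "openin (Euclidean_space q) {x \<in> V. f x \<in> T}"
  using openin_continuous_map_preimage[OF smooth_on_continuous_map[OF assms(1,2)], of T] assms(3)
  unfolding topspace_subtopology_subset[OF openin_subset[OF V]] openin_open_subtopology[OF V] by simp

section \<open>A smooth step\<close>

definition smooth_real :: "(real \<Rightarrow> real) \<Rightarrow> bool" where
  "smooth_real \<sigma> \<longleftrightarrow> smooth_on 1 (euc 1) (\<lambda>x. \<sigma> (x 0))"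

lemma smooth_on_compose_real:
  assumes "smooth_real \<sigma>" "smooth_on q V f"
  shows "smooth_on q V (\<lambda>x. \<sigma> (f x))"
proof -
  have "smooth_on q V (\<lambda>x. (\<lambda>y. \<sigma> (y 0)) (trunc 1 (\<lambda>_. f x)))"
    by (rule smooth_on_compose[OF assms(1)[unfolded smooth_real_def]])
       (use assms(2) smooth_on_in_euc[OF assms(2)] in auto)
  then show ?thesis by simp
qed

lemma smooth_real_const: "smooth_real (\<lambda>_. a)"
  by (simp add: smooth_real_def smooth_on_const)

lemma smooth_real_id: "smooth_real (\<lambda>t. t)"
  by (simp add: smooth_real_def smooth_on_coord)

lemma smooth_real_compose: "smooth_real f \<Longrightarrow> smooth_real g \<Longrightarrow> smooth_real (\<lambda>t. f (g t))"
  unfolding smooth_real_def[of g] smooth_real_def[of "\<lambda>t. f (g t)"] by (rule smooth_on_compose_real)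

lemma smooth_real_mult: "smooth_real f \<Longrightarrow> smooth_real g \<Longrightarrow> smooth_real (\<lambda>t. f t * g t)"
  unfolding smooth_real_def by (rule smooth_on_mult)

lemma smooth_real_diff: "smooth_real f \<Longrightarrow> smooth_real g \<Longrightarrow> smooth_real (\<lambda>t. f t - g t)"
  unfolding smooth_real_def by (rule smooth_on_diff)

text \<open>\<open>flat 0\<close> is the classical function exp(-1/t). The negative powers of
  \<open>t\<close> are included because the derivative of \<open>flat n\<close> is a combination of
  members of the family, so that one induction on the order serves all \<open>n\<close>.\<close>

definition flat :: "nat \<Rightarrow> real \<Rightarrow> real" where
  "flat n t = (if t > 0 then (1 / t) ^ n * exp (- (1 / t)) else 0)"

lemma flat_tendsto_0: "(flat n \<longlongrightarrow> 0) (at_right 0)"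
proof -
  have "((\<lambda>x::real. x ^ n / exp x) \<longlongrightarrow> 0) at_top" by (rule tendsto_power_div_exp_0)
  then have "((\<lambda>t. (inverse t) ^ n / exp (inverse t)) \<longlongrightarrow> (0::real)) (at_right 0)"
    by (rule filterlim_compose[OF _ filterlim_inverse_at_top_right])
  then show ?thesis
    by (rule Lim_transform_eventually)
      (auto simp: flat_def eventually_at_right_field exp_minus field_simps intro!: exI[of _ 1])
qed

text \<open>The delicate point is \<open>t = 0\<close>: from the right the difference quotient is
  \<open>flat (Suc n)\<close>, which tends to 0 because the exponential beats every power.\<close>

lemma has_real_derivative_flat:
  "(flat n has_real_derivative flat (n + 2) t - real n * flat (n + 1) t) (at t)"
proof (cases t "0 :: real" rule: linorder_cases)
  case less
  have "((\<lambda>_. 0) has_real_derivative 0) (at t)" by simp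
  then have "(flat n has_real_derivative 0) (at t)"
    by (rule has_field_derivative_transform_within[where d = "- t"]) (use less in \<open>auto simp: flat_def dist_real_def\<close>)
  then show ?thesis using less by (simp add: flat_def)
next
  case equal
  have "((\<lambda>h. flat n h / h) \<longlongrightarrow> 0) (at_right 0)"
    by (rule Lim_transform_eventually[OF flat_tendsto_0[of "Suc n"]])
      (auto simp: flat_def eventually_at_right_field intro!: exI[of _ 1])
  moreover have "((\<lambda>h. flat n h / h) \<longlongrightarrow> 0) (at_left 0)"
    by (rule Lim_transform_eventually[OF tendsto_const])
      (auto simp: flat_def eventually_at_left_field intro!: exI[of _ "-1"])
  ultimately have "((\<lambda>h. flat n h / h) \<longlongrightarrow> 0) (at 0)" by (simp add: filterlim_split_at_real)
  then show ?thesis using equal by (simp add: has_field_derivative_iff flat_def)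
next
  case greater
  have u: "((\<lambda>t. 1 / t) has_real_derivative - ((1 / t)\<^sup>2)) (at t)"
    using greater by (auto intro!: derivative_eq_intros simp: power2_eq_square)
  have "((\<lambda>t. (1 / t) ^ n * exp (- (1 / t))) has_real_derivative
      real n * (- ((1 / t)\<^sup>2) * (1 / t) ^ (n - Suc 0)) * exp (- (1 / t)) + exp (- (1 / t)) * (1 / t)\<^sup>2 * (1 / t) ^ n) (at t)"
    using DERIV_mult[OF DERIV_power[OF u, of n] DERIV_fun_exp[OF DERIV_minus[OF u]]] by simp
  also have "real n * (- ((1 / t)\<^sup>2) * (1 / t) ^ (n - Suc 0)) * exp (- (1 / t)) + exp (- (1 / t)) * (1 / t)\<^sup>2 * (1 / t) ^ n
      = flat (n + 2) t - real n * flat (n + 1) t"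
    unfolding flat_def using greater by (cases n) (simp_all add: power2_eq_square algebra_simps del: power_one_over power_divide)
  finally have "((\<lambda>t. (1 / t) ^ n * exp (- (1 / t))) has_real_derivative flat (n + 2) t - real n * flat (n + 1) t) (at t)" .
  then show ?thesis
    by (rule has_field_derivative_transform_within[where d = t]) (use greater in \<open>auto simp: flat_def dist_real_def\<close>)
qed

lemma smooth_real_flat: "smooth_real (flat n)"
proof -
  have "Ck 1 k (euc 1) (\<lambda>x. flat n (x 0))" for k
  proof (induction k arbitrary: n)
    case 0
    have "continuous_on UNIV (flat n)"
      using has_real_derivative_flat by (meson DERIV_isCont continuous_at_imp_continuous_on)
    then have "continuous_map euclideanreal euclideanreal (flat n)" by simp
    from continuous_map_compose[OF continuous_map_Euclidean_coord[of 1 "euc 1" 0] this]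
    show ?case by (simp add: o_def)
  next
    case (Suc k)
    have "Ck 1 k (euc 1) (\<lambda>x. flat (n + 2) (x 0) + (- real n) * flat (n + 1) (x 0))"
      by (intro Ck_add Ck_mult Ck_const Suc)
    then have "\<exists>f'. (\<forall>x\<in>euc 1. ((\<lambda>t. flat n ((x(i := t)) 0)) has_real_derivative f' x) (at (x i))) \<and> Ck 1 k (euc 1) f'"
      if "i < 1" for i
      using that has_real_derivative_flat[of n]
      by (intro exI[of _ "\<lambda>x. flat (n + 2) (x 0) + (- real n) * flat (n + 1) (x 0)"]) auto
    moreover have "continuous_on UNIV (flat n)"
      using has_real_derivative_flat by (meson DERIV_isCont continuous_at_imp_continuous_on)
    then have "continuous_map euclideanreal euclideanreal (flat n)" by simp
    from continuous_map_compose[OF continuous_map_Euclidean_coord[of 1 "euc 1" 0] this]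
    have "continuous_map (subtopology (Euclidean_space 1) (euc 1)) euclideanreal (\<lambda>x. flat n (x 0))" by (simp add: o_def)
    ultimately show ?case by simp
  qed
  then show ?thesis
    unfolding smooth_real_def by (intro smooth_onI exI[of _ "euc 1"] exI[of _ "\<lambda>x. flat n (x 0)"]) auto
qed

text \<open>A smooth descent from 1 to 0 over the interval from \<open>a\<close> to
  \<open>b\<close>. The inner difference is constant up to \<open>a\<close> and nonpositive from
  \<open>b\<close> on; the outer \<open>flat 0\<close> turns the latter into a smooth zero. Only a
  constant is divided by, so smoothness follows from composition, difference and
  multiplication.\<close>

definition step :: "real \<Rightarrow> real \<Rightarrow> real \<Rightarrow> real" where
  "step a b t = flat 0 (flat 0 (b - a) - flat 0 (t - a)) / flat 0 (flat 0 (b - a))"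

lemma flat_0_pos: "0 < t \<Longrightarrow> 0 < flat 0 t"
  by (simp add: flat_def)

lemma flat_0_strict_mono: "0 < t \<Longrightarrow> s < t \<Longrightarrow> flat 0 s < flat 0 t"
  by (auto simp: flat_def field_simps)

lemma flat_0_nonpos [simp]: "t \<le> 0 \<Longrightarrow> flat 0 t = 0"
  by (simp add: flat_def)

lemma flat_0_mono: "s \<le> t \<Longrightarrow> flat 0 s \<le> flat 0 t"
  using flat_0_strict_mono[of t s] by (cases "t \<le> 0"; cases "s = t") auto

lemma step_eq_1 [simp]: "a < b \<Longrightarrow> t \<le> a \<Longrightarrow> step a b t = 1"
  using flat_0_pos[of "b - a"] flat_0_pos[of "flat 0 (b - a)"] by (simp add: step_def)

lemma step_eq_0 [simp]: "a < b \<Longrightarrow> b \<le> t \<Longrightarrow> step a b t = 0"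
  using flat_0_mono[of "b - a" "t - a"] by (simp add: step_def)

lemma step_pos: "a < b \<Longrightarrow> t < b \<Longrightarrow> 0 < step a b t"
  using flat_0_strict_mono[of "b - a" "t - a"] flat_0_pos[of "b - a"] flat_0_pos[of "flat 0 (b - a)"]
  by (simp add: step_def flat_0_pos)

lemma step_less_1: "a < b \<Longrightarrow> a < t \<Longrightarrow> step a b t < 1"
  using flat_0_strict_mono[of "flat 0 (b - a)" "flat 0 (b - a) - flat 0 (t - a)"] flat_0_pos[of "b - a"]
    flat_0_pos[of "t - a"] flat_0_pos[of "flat 0 (b - a)"]
  by (simp add: step_def)

lemma step_nonneg: "a < b \<Longrightarrow> 0 \<le> step a b t"
  using step_pos[of a b t] step_eq_0[of a b t] by (cases "t < b") auto

lemma step_le_1: "a < b \<Longrightarrow> step a b t \<le> 1"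
  using step_less_1[of a b t] step_eq_1[of a b t] by (cases "t \<le> a") auto

lemma smooth_real_step: "smooth_real (step a b)"
proof -
  have "smooth_real (\<lambda>t. flat 0 (flat 0 (b - a) - flat 0 (t - a)) * (1 / flat 0 (flat 0 (b - a))))"
    by (intro smooth_real_mult smooth_real_const smooth_real_compose[OF smooth_real_flat] smooth_real_diff smooth_real_id)
  then show ?thesis by (simp add: step_def[abs_def])
qed

section \<open>Collared manifolds\<close>

text \<open>Restricting an atlas shrinks the domain on which a chart is inverted; this identifies
  the restricted inverse with the original one.\<close>

lemma inv_into_subset_eq:
  "inj_on \<phi> U \<Longrightarrow> V \<subseteq> U \<Longrightarrow> y \<in> \<phi> ` V \<Longrightarrow> inv_into V \<phi> y = inv_into U \<phi> y"
  by (metis f_inv_into_f inj_on_subset inv_into_f_f inv_into_into subset_eq)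

text \<open>\<open>s_pos\<close> follows from \<open>s > n\<close>. It makes coordinate 0 a genuine
  normal coordinate and \<open>s - 1\<close> a genuine predecessor.\<close>

locale collared_manifold =
  fixes s :: nat and W :: "'b topology" and A :: "'b atlas" and \<epsilon> :: real and c :: "'b \<times> real \<Rightarrow> 'b"
  assumes mfd: "smooth_manifold_with_boundary s W A"
    and compact_boundary: "compactin W (mfd_boundary s A)"
    and collar: "collar s W A \<epsilon> c"
    and s_pos: "0 < s"
begin

definition bd :: "'b set" where "bd = mfd_boundary s A"

lemma chart:
  assumes "(U, \<phi>) \<in> A"
  shows chart_open: "openin W U"
    and chart_image: "openin (subtopology (Euclidean_space s) (half_space s)) (\<phi> ` U)"
    and chart_homeo: "homeomorphic_map (subtopology W U) (subtopology (Euclidean_space s) (\<phi> ` U)) \<phi>"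
proof -
  have "\<forall>(U, \<phi>)\<in>A. openin W U \<and>
        openin (subtopology (Euclidean_space s) (half_space s)) (\<phi> ` U) \<and>
        homeomorphic_map (subtopology W U) (subtopology (Euclidean_space s) (\<phi> ` U)) \<phi>"
    using mfd unfolding smooth_manifold_with_boundary_def smooth_atlas_def by simp
  from bspec[OF this assms] show "openin W U"
    "openin (subtopology (Euclidean_space s) (half_space s)) (\<phi> ` U)"
    "homeomorphic_map (subtopology W U) (subtopology (Euclidean_space s) (\<phi> ` U)) \<phi>" by simp_all
qed

lemma chart_at:
  assumes "x \<in> topspace W"
  obtains U \<phi> where "(U, \<phi>) \<in> A" "x \<in> U"
proof -
  have "(\<Union>(U, \<phi>)\<in>A. U) = topspace W"
    using mfd unfolding smooth_manifold_with_boundary_def smooth_atlas_def by simp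
  then show thesis using assms that by blast
qed

lemma transition:
  assumes "(U, \<phi>) \<in> A" "(V, \<psi>) \<in> A" "i < s"
  shows "smooth_on s (\<phi> ` (U \<inter> V)) (\<lambda>y. \<psi> (inv_into U \<phi> y) i)"
proof -
  have "\<forall>(U, \<phi>)\<in>A. \<forall>(V, \<psi>)\<in>A. \<forall>i<s. smooth_on s (\<phi> ` (U \<inter> V)) (\<lambda>y. \<psi> (inv_into U \<phi> y) i)"
    using mfd unfolding smooth_manifold_with_boundary_def smooth_atlas_def by simp
  from bspec[OF this assms(1)] have "\<forall>(V, \<psi>)\<in>A. \<forall>i<s. smooth_on s (\<phi> ` (U \<inter> V)) (\<lambda>y. \<psi> (inv_into U \<phi> y) i)"
    by simp
  from bspec[OF this assms(2)] assms(3) show ?thesis by simp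
qed

lemma Hausdorff_W: "Hausdorff_space W"
  using mfd by (simp add: smooth_manifold_with_boundary_def)

lemma chart_subset: "(U, \<phi>) \<in> A \<Longrightarrow> U \<subseteq> topspace W"
  by (rule openin_subset[OF chart_open])

lemma chart_inj: "(U, \<phi>) \<in> A \<Longrightarrow> inj_on \<phi> U"
  using homeomorphic_imp_injective_map[OF chart_homeo] chart_subset
  by (metis topspace_subtopology_subset)

lemma chart_in_half_space: "(U, \<phi>) \<in> A \<Longrightarrow> x \<in> U \<Longrightarrow> \<phi> x \<in> half_space s"
  using openin_subset[OF chart_image] by fastforce

lemma chart_in_euc: "(U, \<phi>) \<in> A \<Longrightarrow> x \<in> U \<Longrightarrow> \<phi> x \<in> euc s"
  using chart_in_half_space by (fastforce simp: half_space_def)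

lemma chart_nonneg: "(U, \<phi>) \<in> A \<Longrightarrow> x \<in> U \<Longrightarrow> 0 \<le> \<phi> x 0"
  using chart_in_half_space by (fastforce simp: half_space_def)

text \<open>Translates neighbourhoods in \<open>W\<close> into the Euclidean neighbourhoods that
  \<open>smooth_on_local\<close> asks for.\<close>

lemma chart_image_Int:
  assumes "(U, \<phi>) \<in> A" "openin W T"
  obtains P where "openin (Euclidean_space s) P" "\<phi> ` (U \<inter> T) = P \<inter> \<phi> ` U"
proof -
  have "openin (subtopology W U) (U \<inter> T)"
    using assms(2) by (simp add: openin_subtopology_Int2)
  then have "openin (subtopology (Euclidean_space s) (\<phi> ` U)) (\<phi> ` (U \<inter> T))"
    using homeomorphic_map_openness[OF chart_homeo[OF assms(1)], of "U \<inter> T"] chart_subset[OF assms(1)] by auto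
  then show thesis using that unfolding openin_subtopology by metis
qed

lemma chart_image_half_space:
  assumes "(U, \<phi>) \<in> A" "openin W T"
  obtains P where "openin (Euclidean_space s) P" "\<phi> ` (U \<inter> T) = P \<inter> half_space s"
proof -
  obtain Q where Q: "openin (Euclidean_space s) Q" "\<phi> ` U = Q \<inter> half_space s"
    using chart_image[OF assms(1)] unfolding openin_subtopology by blast
  obtain P where "openin (Euclidean_space s) P" "\<phi> ` (U \<inter> T) = P \<inter> \<phi> ` U"
    by (rule chart_image_Int[OF assms])
  then show thesis using Q that[of "P \<inter> Q"] by auto
qed

lemma bd_subset: "bd \<subseteq> topspace W"
  using compactin_subset_topspace[OF compact_boundary] by (simp add: bd_def)

text \<open>
  If \<open>x\<close> were interior in the chart \<open>\<phi>\<close>, then the normal coordinate of \<open>\<psi>\<close>, read in \<open>\<phi>\<close>, would have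
  a local minimum at \<open>x\<close>. Its differential there would vanish, although its derivative along the
  inward normal line of \<open>\<psi>\<close> is 1.
\<close>

lemma chart_boundary_zero:
  assumes U: "(U, \<phi>) \<in> A" "x \<in> U" and x: "x \<in> bd"
  shows "\<phi> x 0 = 0"
proof (rule ccontr)
  assume "\<phi> x 0 \<noteq> 0"
  with chart_nonneg[OF U] have pos: "\<phi> x 0 > 0" by simp
  obtain V \<psi> where V: "(V, \<psi>) \<in> A" "x \<in> V" and x0: "\<psi> x 0 = 0"
    using x by (auto simp: bd_def mfd_boundary_def)
  define D where "D = \<phi> ` (U \<inter> V)"
  obtain P where P: "openin (Euclidean_space s) P" "D = P \<inter> half_space s"
    unfolding D_def by (rule chart_image_half_space[OF U(1) chart_open[OF V(1)]])
  have xD: "\<phi> x \<in> D" using U V by (auto simp: D_def)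
  obtain O1 g where g: "openin (Euclidean_space s) O1" "\<phi> x \<in> O1" "\<forall>k. Ck s k O1 g"
      "\<forall>y\<in>O1 \<inter> D. g y = \<psi> (inv_into U \<phi> y) 0"
    using smooth_onE[OF transition[OF U(1) V(1) s_pos], of "\<phi> x"] xD unfolding D_def by metis
  \<comment> \<open>Where the normal coordinate of \<phi> is positive, a Euclidean neighbourhood
    lies inside the image of the overlap. There \<open>g\<close> is the normal coordinate of \<psi>
    itself and not merely an extension of it, hence nonnegative.\<close>
  define O2 where "O2 = {y \<in> O1 \<inter> P. y 0 \<in> {0<..}}"
  have O2: "openin (Euclidean_space s) O2" unfolding O2_def
    by (rule openin_smooth_preimage) (use g P in \<open>auto intro!: openin_Int smooth_on_coord dest: openin_subset\<close>)
  have O2D: "O2 \<subseteq> D"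
    using openin_subset[OF O2] by (auto simp: P(2) O2_def half_space_def)
  have xO2: "\<phi> x \<in> O2" using xD g(2) P pos by (auto simp: O2_def)
  have gpos: "0 \<le> g y" if "y \<in> O2" for y
  proof -
    have y: "y \<in> O1 \<inter> D" using that O2D by (auto simp: O2_def)
    then obtain z where "z \<in> U \<inter> V" "y = \<phi> z" by (auto simp: D_def)
    then show ?thesis using g(4) y chart_nonneg[OF V(1)] chart_inj[OF U(1)] by simp
  qed
  have g0: "g (\<phi> x) = 0"
    using g(2,4) xD U(2) chart_inj[OF U(1)] x0 by simp
  obtain g' where g': "\<forall>i<s. \<forall>y\<in>O2. ((\<lambda>t. g (y(i := t))) has_real_derivative g' i y) (at (y i))"
    "\<forall>i<s. Ck s 0 O2 (g' i)"
    by (rule Ck_partials[OF Ck_subset[OF g(3)[rule_format, of "Suc 0"], of O2]]) (auto simp: O2_def)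
  obtain r where r: "r > 0" "\<And>y. y \<in> euc s \<Longrightarrow> (\<And>i. i < s \<Longrightarrow> \<bar>y i - \<phi> x i\<bar> < r) \<Longrightarrow> y \<in> O2"
    using openin_Euclidean_space_box[OF O2 xO2] by metis
  have g'0: "g' i (\<phi> x) = 0" if i: "i < s" for i
  proof (rule DERIV_local_min)
    show "((\<lambda>t. g ((\<phi> x)(i := t))) has_real_derivative g' i (\<phi> x)) (at (\<phi> x i))"
      using g'(1) i xO2 by blast
    show "\<forall>t. \<bar>\<phi> x i - t\<bar> < r \<longrightarrow> g ((\<phi> x)(i := \<phi> x i)) \<le> g ((\<phi> x)(i := t))"
    proof (intro allI impI)
      fix t assume "\<bar>\<phi> x i - t\<bar> < r"
      then have "(\<phi> x)(i := t) \<in> O2"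
        using r chart_in_euc[OF U] i by (intro r(2) euc_fun_upd) auto
      then show "g ((\<phi> x)(i := \<phi> x i)) \<le> g ((\<phi> x)(i := t))" using gpos g0 by simp
    qed
  qed (rule r(1))
  obtain P' where P': "openin (Euclidean_space s) P'" "\<psi> ` (V \<inter> U) = P' \<inter> half_space s"
    by (rule chart_image_half_space[OF V(1) chart_open[OF U(1)]])
  have xD': "\<psi> x \<in> \<psi> ` (V \<inter> U)" using U V by auto
  have "\<forall>j\<in>{..<s}. \<exists>Oh. openin (Euclidean_space s) (fst Oh) \<and> \<psi> x \<in> fst Oh \<and>
      (\<forall>k. Ck s k (fst Oh) (snd Oh)) \<and> (\<forall>y\<in>fst Oh \<inter> \<psi> ` (V \<inter> U). snd Oh y = \<phi> (inv_into V \<psi> y) j)"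
  proof
    fix j assume "j \<in> {..<s}"
    then have "smooth_on s (\<psi> ` (V \<inter> U)) (\<lambda>y. \<phi> (inv_into V \<psi> y) j)" by (intro transition V U) simp
    from smooth_onE[OF this xD'] obtain O' h where "openin (Euclidean_space s) O'" "\<psi> x \<in> O'" "\<forall>k. Ck s k O' h"
      "\<forall>y\<in>O' \<inter> \<psi> ` (V \<inter> U). h y = \<phi> (inv_into V \<psi> y) j" by metis
    then show "\<exists>Oh. openin (Euclidean_space s) (fst Oh) \<and> \<psi> x \<in> fst Oh \<and>
      (\<forall>k. Ck s k (fst Oh) (snd Oh)) \<and> (\<forall>y\<in>fst Oh \<inter> \<psi> ` (V \<inter> U). snd Oh y = \<phi> (inv_into V \<psi> y) j)"
      by (intro exI[of _ "(O', h)"]) simp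
  qed
  from bchoice[OF this] obtain Oh where Oh: "\<forall>j\<in>{..<s}. openin (Euclidean_space s) (fst (Oh j)) \<and> \<psi> x \<in> fst (Oh j) \<and>
      (\<forall>k. Ck s k (fst (Oh j)) (snd (Oh j))) \<and>
      (\<forall>y\<in>fst (Oh j) \<inter> \<psi> ` (V \<inter> U). snd (Oh j) y = \<phi> (inv_into V \<psi> y) j)" ..
  define line where "line t = (\<psi> x)(0 := t)" for t
  have line0: "line 0 = \<psi> x" using x0 by (auto simp: line_def)
  \<comment> \<open>The inward normal line of \<psi>, read in \<phi>. Using extensions of the
    transition functions defines it for negative \<open>t\<close> as well, so that a two-sided
    derivative at 0 makes sense.\<close>
  define v where "v t = trunc s (\<lambda>j. snd (Oh j) (line t))" for t
  have "\<exists>d. ((\<lambda>t. snd (Oh j) (line t)) has_real_derivative d) (at 0)" if j: "j < s" for j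
  proof -
    have "Ck s (Suc 0) (fst (Oh j)) (snd (Oh j))" using Oh j by blast
    from Ck_SucE[OF this s_pos] obtain h' where
      "\<forall>y\<in>fst (Oh j). ((\<lambda>t. snd (Oh j) (y(0 := t))) has_real_derivative h' y) (at (y 0))" by metis
    moreover have "\<psi> x \<in> fst (Oh j)" using Oh j by blast
    ultimately show ?thesis using x0 unfolding line_def by metis
  qed
  then obtain d where d: "\<And>j. j < s \<Longrightarrow> ((\<lambda>t. snd (Oh j) (line t)) has_real_derivative d j) (at 0)" by metis
  have v0: "v 0 = \<phi> x"
  proof -
    have "snd (Oh j) (\<psi> x) = \<phi> x j" if "j < s" for j
      using Oh that xD' V(2) chart_inj[OF V(1)] by simp
    then have "v 0 = trunc s (\<phi> x)" by (auto simp: v_def trunc_def line0)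
    then show ?thesis using trunc_id[OF chart_in_euc[OF U]] by simp
  qed
  have "((\<lambda>t. g (v t)) has_real_derivative (\<Sum>j<s. g' j (v 0) * d j)) (at 0)"
  proof (rule has_real_derivative_along_curve[OF O2])
    show "((\<lambda>t. g (y(j := t))) has_real_derivative g' j y) (at (y j))" if "j < s" "y \<in> O2" for j y
      using g'(1) that by blast
    show "continuous_map (subtopology (Euclidean_space s) O2) euclideanreal (g' j)" if "j < s" for j
      using g'(2) that by simp
    show "((\<lambda>t. v t j) has_real_derivative d j) (at 0)" if "j < s" for j
      using d[OF that] that by (simp add: v_def)
  qed (use v0 xO2 in \<open>simp_all add: v_def\<close>)
  also have "(\<Sum>j<s. g' j (v 0) * d j) = 0" using g'0 v0 by simp
  finally have "((\<lambda>h. g (v h) / h) \<longlongrightarrow> 0) (at 0)"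
    using g0 v0 by (simp add: has_field_derivative_iff)
  then have lim0: "((\<lambda>h. g (v h) / h) \<longlongrightarrow> 0) (at_right 0)"
    by (rule tendsto_mono[rotated]) (simp add: at_le)
  \<comment> \<open>On \<open>R\<close> all the extensions are defined and half-space points come
    from the overlap, so for small \<open>t > 0\<close> the curve \<open>v\<close> consists of
    genuine points of the manifold and \<open>g (v t) = t\<close>.\<close>
  define R where "R = (euc s \<inter> (\<Inter>j<s. fst (Oh j))) \<inter> P'"
  have R: "openin (Euclidean_space s) R" unfolding R_def
    using Oh P' by (intro openin_Int openin_INT_lessThan) auto
  have "\<psi> x \<in> R" using Oh chart_in_euc[OF V] P' xD' by (auto simp: R_def)
  from openin_Euclidean_space_box[OF R this] obtain \<rho> where
    \<rho>: "\<rho> > 0" "\<And>y. y \<in> euc s \<Longrightarrow> (\<And>i. i < s \<Longrightarrow> \<bar>y i - \<psi> x i\<bar> < \<rho>) \<Longrightarrow> y \<in> R" by metis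
  have ev: "\<forall>\<^sub>F t in at_right 0. 0 < t \<and> t < \<rho>"
    using \<rho>(1) by (auto simp: eventually_at_right_field)
  have "\<forall>\<^sub>F t in at 0. \<bar>v t j - \<phi> x j\<bar> < r" if j: "j < s" for j
  proof -
    have "isCont (\<lambda>t. v t j) 0" using DERIV_isCont[OF d[OF j]] j by (simp add: v_def)
    then have "((\<lambda>t. v t j) \<longlongrightarrow> \<phi> x j) (at 0)" by (simp add: isCont_def v0)
    from tendstoD[OF this r(1)] show ?thesis by (simp add: dist_real_def)
  qed
  then have "\<forall>\<^sub>F t in at 0. \<forall>j\<in>{..<s}. \<bar>v t j - \<phi> x j\<bar> < r"
    by (intro eventually_ball_finite) auto
  then have "\<forall>\<^sub>F t in at_right 0. \<forall>j\<in>{..<s}. \<bar>v t j - \<phi> x j\<bar> < r"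
    by (rule filter_leD[rotated]) (simp add: at_le)
  with ev have "\<forall>\<^sub>F t in at_right 0. g (v t) / t = 1"
  proof eventually_elim
    case (elim t)
    have e: "line t \<in> euc s" unfolding line_def using s_pos chart_in_euc[OF V] by (rule euc_fun_upd[rotated])
    have lR: "line t \<in> R"
      using \<rho> elim x0 by (intro \<rho>(2) e) (auto simp: line_def)
    have "line t \<in> half_space s" using e elim by (auto simp: half_space_def line_def)
    with lR have lD: "line t \<in> \<psi> ` (V \<inter> U)" using P' by (auto simp: R_def)
    then obtain z where z: "z \<in> V" "z \<in> U" "line t = \<psi> z" by auto
    have "snd (Oh j) (line t) = \<phi> z j" if "j < s" for j
      using Oh that lR lD z chart_inj[OF V(1)] by (simp add: R_def)
    then have "v t = trunc s (\<phi> z)" by (auto simp: v_def trunc_def)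
    then have vz: "v t = \<phi> z" using trunc_id[OF chart_in_euc[OF U(1) z(2)]] by simp
    have "v t \<in> O2" using elim by (intro r(2)) (auto simp: v_def)
    then have "g (v t) = \<psi> z 0" using g(4) O2D vz z chart_inj[OF U(1)] by (auto simp: O2_def)
    then have "g (v t) = t" using z(3) by (metis fun_upd_same line_def)
    then show ?case using elim by simp
  qed
  then have "((\<lambda>h. g (v h) / h) \<longlongrightarrow> 1) (at_right 0)"
    by (rule tendsto_eventually)
  from tendsto_unique[OF _ this lim0] show False by simp
qed

section \<open>The function algebras of the boundary and of the interior\<close>

abbreviation tang :: "('b \<Rightarrow> nat \<Rightarrow> real) \<Rightarrow> 'b \<Rightarrow> nat \<Rightarrow> real" where
  "tang \<phi> \<equiv> \<lambda>x i. \<phi> x (Suc i)"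

abbreviation Wint :: "'b set" where "Wint \<equiv> topspace W - bd"

abbreviation Cbd :: "('b \<Rightarrow> real) set" where "Cbd \<equiv> Cinf (s - 1) (boundary_atlas s A)"

abbreviation Cinner :: "('b \<Rightarrow> real) set" where "Cinner \<equiv> Cinf s (restrict_atlas A Wint)"

text \<open>The normal coordinate dropped by \<open>tang\<close> is 0 in every chart at a boundary
  point, by \<open>chart_boundary_zero\<close>, so no information is lost.\<close>

lemma tang_inj:
  assumes "(U, \<phi>) \<in> A"
  shows "inj_on (tang \<phi>) (U \<inter> bd)"
proof (rule inj_onI)
  fix x y assume xy: "x \<in> U \<inter> bd" "y \<in> U \<inter> bd" "tang \<phi> x = tang \<phi> y"
  have "\<phi> x j = \<phi> y j" for j
    using fun_cong[OF xy(3)] chart_boundary_zero[OF assms] xy(1,2) by (cases j) auto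
  then show "x = y" using chart_inj[OF assms] xy(1,2) by (meson IntD1 ext inj_onD)
qed

lemma tang_in_euc: "(U, \<phi>) \<in> A \<Longrightarrow> w \<in> U \<Longrightarrow> tang \<phi> w \<in> euc (s - 1)"
  using chart_in_euc by (fastforce simp: topspace_Euclidean_space)

lemma Cbd_I:
  assumes "\<And>U \<phi>. (U, \<phi>) \<in> A \<Longrightarrow> smooth_on (s - 1) (tang \<phi> ` (U \<inter> bd)) (\<lambda>y. g (inv_into (U \<inter> bd) (tang \<phi>) y))"
  shows "g \<in> Cbd"
  using assms by (auto simp: Cinf_def boundary_atlas_def bd_def)

lemma Cbd_D:
  assumes "g \<in> Cbd" "(U, \<phi>) \<in> A"
  shows "smooth_on (s - 1) (tang \<phi> ` (U \<inter> bd)) (\<lambda>y. g (inv_into (U \<inter> bd) (tang \<phi>) y))"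
proof -
  have "(U \<inter> bd, tang \<phi>) \<in> boundary_atlas s A"
    using assms(2) unfolding boundary_atlas_def bd_def by (rule rev_image_eqI) simp
  then show ?thesis using assms(1) unfolding Cinf_def by fastforce
qed

lemma Cbd_cong: "g \<in> Cbd \<Longrightarrow> (\<And>w. w \<in> bd \<Longrightarrow> g w = h w) \<Longrightarrow> h \<in> Cbd"
proof (rule Cbd_I)
  fix U \<phi> assume g: "g \<in> Cbd" and eq: "\<And>w. w \<in> bd \<Longrightarrow> g w = h w" and U: "(U, \<phi>) \<in> A"
  show "smooth_on (s - 1) (tang \<phi> ` (U \<inter> bd)) (\<lambda>y. h (inv_into (U \<inter> bd) (tang \<phi>) y))"
    by (rule smooth_on_cong[OF Cbd_D[OF g U]]) (meson IntD2 eq inv_into_into)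
qed

text \<open>Factors through the coordinate representation of \<open>b\<close> in one chart, which is
  why the whole parameter set has to map into a single chart domain.\<close>

lemma Cbd_compose:
  assumes b: "b \<in> Cbd" and U: "(U, \<phi>) \<in> A" and V: "V \<subseteq> euc q" "\<And>x. x \<in> V \<Longrightarrow> w x \<in> U \<inter> bd"
    and w: "\<And>i. i < s - 1 \<Longrightarrow> smooth_on q V (\<lambda>x. \<phi> (w x) (Suc i))"
  shows "smooth_on q V (\<lambda>x. b (w x))"
proof (rule smooth_on_cong)
  show "smooth_on q V (\<lambda>x. b (inv_into (U \<inter> bd) (tang \<phi>) (tang \<phi> (w x))))"
    by (rule smooth_on_compose[OF Cbd_D[OF b U] w V(1)]) (use V(2) in auto)
  show "b (inv_into (U \<inter> bd) (tang \<phi>) (tang \<phi> (w x))) = b (w x)" if "x \<in> V" for x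
    by (simp add: inv_into_f_f[OF tang_inj[OF U] V(2)[OF that]])
qed

lemma Cinner_D:
  assumes "g \<in> Cinner" "(U, \<phi>) \<in> A"
  shows "smooth_on s (\<phi> ` (U \<inter> Wint)) (\<lambda>y. g (inv_into U \<phi> y))"
proof -
  have "(U \<inter> Wint, \<phi>) \<in> restrict_atlas A Wint"
    using assms(2) unfolding restrict_atlas_def by (rule rev_image_eqI) simp
  then have "smooth_on s (\<phi> ` (U \<inter> Wint)) (\<lambda>y. g (inv_into (U \<inter> Wint) \<phi> y))"
    using assms(1) unfolding Cinf_def by fastforce
  then show ?thesis
    by (rule smooth_on_cong) (metis chart_inj[OF assms(2)] inv_into_subset_eq inf_le1)
qed

lemma Cinner_I:
  assumes "\<And>U \<phi>. (U, \<phi>) \<in> A \<Longrightarrow> smooth_on s (\<phi> ` (U \<inter> Wint)) (\<lambda>y. g (inv_into U \<phi> y))"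
  shows "g \<in> Cinner"
proof -
  have "smooth_on s (\<phi> ` (U \<inter> Wint)) (\<lambda>y. g (inv_into (U \<inter> Wint) \<phi> y))" if "(U, \<phi>) \<in> A" for U \<phi>
    by (rule smooth_on_cong[OF assms[OF that]]) (metis chart_inj[OF that] inv_into_subset_eq inf_le1)
  then show ?thesis by (auto simp: Cinf_def restrict_atlas_def)
qed

lemma Cinner_cong: "g \<in> Cinner \<Longrightarrow> (\<And>w. w \<in> Wint \<Longrightarrow> g w = h w) \<Longrightarrow> h \<in> Cinner"
proof (rule Cinner_I)
  fix U \<phi> assume g: "g \<in> Cinner" and eq: "\<And>w. w \<in> Wint \<Longrightarrow> g w = h w" and U: "(U, \<phi>) \<in> A"
  show "smooth_on s (\<phi> ` (U \<inter> Wint)) (\<lambda>y. h (inv_into U \<phi> y))"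
  proof (rule smooth_on_cong[OF Cinner_D[OF g U]])
    fix y assume "y \<in> \<phi> ` (U \<inter> Wint)"
    then show "g (inv_into U \<phi> y) = h (inv_into U \<phi> y)" using eq chart_inj[OF U] by auto
  qed
qed

lemma Cinner_compose:
  assumes g: "g \<in> Cinner" and U: "(U, \<phi>) \<in> A" and V: "V \<subseteq> euc q" "\<And>x. x \<in> V \<Longrightarrow> w x \<in> U \<inter> Wint"
    and w: "\<And>i. i < s \<Longrightarrow> smooth_on q V (\<lambda>x. \<phi> (w x) i)"
  shows "smooth_on q V (\<lambda>x. g (w x))"
proof (rule smooth_on_cong)
  show "smooth_on q V (\<lambda>x. g (inv_into U \<phi> (\<phi> (w x))))"
    by (rule smooth_on_compose[OF Cinner_D[OF g U] w V(1)]) (use V(2) in auto)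
  show "g (inv_into U \<phi> (\<phi> (w x))) = g (w x)" if "x \<in> V" for x
    using V(2)[OF that] chart_inj[OF U] by simp
qed

lemma Cinner_mult: "g \<in> Cinner \<Longrightarrow> h \<in> Cinner \<Longrightarrow> (\<lambda>x. g x * h x) \<in> Cinner"
  by (rule Cinner_I, rule smooth_on_mult) (rule Cinner_D; assumption)+

lemma Cinner_diff: "g \<in> Cinner \<Longrightarrow> h \<in> Cinner \<Longrightarrow> (\<lambda>x. g x - h x) \<in> Cinner"
  by (rule Cinner_I, rule smooth_on_diff) (rule Cinner_D; assumption)+

lemma Cinner_const: "(\<lambda>_. a) \<in> Cinner"
  using chart_in_euc by (intro Cinner_I smooth_on_const image_subsetI) blast

lemma Cbd_const: "(\<lambda>_. a) \<in> Cbd"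
  using tang_in_euc by (intro Cbd_I smooth_on_const image_subsetI) blast

lemma Cbd_mult: "g \<in> Cbd \<Longrightarrow> h \<in> Cbd \<Longrightarrow> (\<lambda>x. g x * h x) \<in> Cbd"
  by (rule Cbd_I, rule smooth_on_mult) (rule Cbd_D; assumption)+

section \<open>The collar and its coordinates\<close>

definition nbhd :: "'b set" where "nbhd = c ` (bd \<times> {0..<\<epsilon>})"

text \<open>Its values off \<open>nbhd\<close> carry no meaning; hence the membership tests in
  \<open>tube\<close>, \<open>collar_ext\<close> and \<open>squeeze\<close>.\<close>

definition collar_inv :: "'b \<Rightarrow> 'b \<times> real" where "collar_inv = inv_into (bd \<times> {0..<\<epsilon>}) c"

lemma topspace_half_cylinder: "topspace (half_cylinder s W A \<epsilon>) = bd \<times> {0..<\<epsilon>}"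
  using bd_subset by (auto simp: half_cylinder_def bd_def)

lemma eps_pos: "0 < \<epsilon>"
  using collar by (simp add: collar_def)

lemma collar_zero: "w \<in> bd \<Longrightarrow> c (w, 0) = w"
  using collar by (simp add: collar_def bd_def)

lemma openin_nbhd: "openin W nbhd"
  using collar by (simp add: collar_def Let_def bd_def nbhd_def)

lemma nbhd_subset: "nbhd \<subseteq> topspace W"
  by (rule openin_subset[OF openin_nbhd])

lemma collar_diffeo:
  "mfd_diffeomorphism s (half_cylinder s W A \<epsilon>) (half_cylinder_atlas s A \<epsilon>) (subtopology W nbhd) (restrict_atlas A nbhd) c"
  using collar by (simp add: collar_def Let_def bd_def nbhd_def)

lemma collar_inj: "inj_on c (bd \<times> {0..<\<epsilon>})"
  using collar_diffeo unfolding mfd_diffeomorphism_def topspace_half_cylinder bij_betw_def by blast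

lemma collar_inv_collar [simp]: "w \<in> bd \<Longrightarrow> 0 \<le> t \<Longrightarrow> t < \<epsilon> \<Longrightarrow> collar_inv (c (w, t)) = (w, t)"
  unfolding collar_inv_def by (rule inv_into_f_f[OF collar_inj]) auto

lemma collar_in_nbhd [simp]: "w \<in> bd \<Longrightarrow> 0 \<le> t \<Longrightarrow> t < \<epsilon> \<Longrightarrow> c (w, t) \<in> nbhd"
  by (auto simp: nbhd_def)

lemma nbhd_cases:
  assumes "z \<in> nbhd"
  obtains w t where "z = c (w, t)" "w \<in> bd" "0 \<le> t" "t < \<epsilon>" "collar_inv z = (w, t)"
  using assms by (auto simp: nbhd_def)

text \<open>A boundary point \<open>c (w, t)\<close> is also the image of
  \<open>(c (w, t), 0)\<close>, and \<open>c\<close> is injective. It follows that collar points of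
  positive depth are interior, where charts may be used.\<close>

lemma collar_in_bd_iff: "w \<in> bd \<Longrightarrow> 0 \<le> t \<Longrightarrow> t < \<epsilon> \<Longrightarrow> c (w, t) \<in> bd \<longleftrightarrow> t = 0"
proof
  assume w: "w \<in> bd" "0 \<le> t" "t < \<epsilon>" "c (w, t) \<in> bd"
  have "collar_inv (c (c (w, t), 0)) = (c (w, t), 0)" using w(4) eps_pos by simp
  then show "t = 0" using w by (simp add: collar_zero[OF w(4)])
qed (simp add: collar_zero)

lemma bd_subset_nbhd: "bd \<subseteq> nbhd"
  using collar_in_nbhd[of _ 0] eps_pos collar_zero by fastforce

lemma collar_inv_bd: "w \<in> bd \<Longrightarrow> collar_inv w = (w, 0)"
  using collar_inv_collar[of w 0] eps_pos collar_zero by simp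

lemma continuous_collar: "continuous_map (half_cylinder s W A \<epsilon>) (subtopology W nbhd) c"
  using collar_diffeo by (simp add: mfd_diffeomorphism_def smooth_mfd_map_def)

lemma continuous_collar_inv: "continuous_map (subtopology W nbhd) (half_cylinder s W A \<epsilon>) collar_inv"
  using collar_diffeo unfolding mfd_diffeomorphism_def smooth_mfd_map_def topspace_half_cylinder collar_inv_def by blast

text \<open>The part of the collar over a chart domain of the boundary: there one cylinder chart
  provides coordinates.\<close>

definition tube :: "'b set \<Rightarrow> 'b set" where "tube U = {z \<in> nbhd. fst (collar_inv z) \<in> U}"

lemma openin_tube:
  assumes "openin W U"
  shows "openin W (tube U)"
proof -
  have "continuous_map (half_cylinder s W A \<epsilon>) (subtopology W bd) fst"
    unfolding half_cylinder_def bd_def by (rule continuous_map_fst)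
  from continuous_map_compose[OF continuous_collar_inv this]
  have "continuous_map (subtopology W nbhd) W (\<lambda>z. fst (collar_inv z))"
    by (simp add: continuous_map_in_subtopology o_def)
  from openin_continuous_map_preimage[OF this assms]
  have "openin (subtopology W nbhd) {z \<in> topspace (subtopology W nbhd). fst (collar_inv z) \<in> U}" .
  moreover have "{z \<in> topspace (subtopology W nbhd). fst (collar_inv z) \<in> U} = tube U"
    using nbhd_subset by (auto simp: tube_def)
  ultimately show ?thesis using openin_nbhd by (simp add: openin_open_subtopology)
qed

text \<open>Unpacks the inverse half of the collar diffeomorphism. In a cylinder chart coordinate 0
  is the collar parameter and coordinate \<open>Suc i\<close> is the \<open>i\<close>-th tangential
  coordinate.\<close>

lemma smooth_collar_inv:
  assumes V: "(V, \<psi>) \<in> A" and U: "(U, \<phi>) \<in> A"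
  shows "smooth_on s (\<psi> ` (V \<inter> tube U)) (\<lambda>y. snd (collar_inv (inv_into V \<psi> y)))"
    and "i < s - 1 \<Longrightarrow> smooth_on s (\<psi> ` (V \<inter> tube U)) (\<lambda>y. \<phi> (fst (collar_inv (inv_into V \<psi> y))) (Suc i))"
proof -
  define ch where "ch = (\<lambda>(w, t). case_nat t (tang \<phi> w))"
  have cyl: "((U \<inter> bd) \<times> {0..<\<epsilon>}, ch) \<in> half_cylinder_atlas s A \<epsilon>"
    unfolding half_cylinder_atlas_def boundary_atlas_def bd_def ch_def using U by force
  have VN: "(V \<inter> nbhd, \<psi>) \<in> restrict_atlas A nbhd"
    using V unfolding restrict_atlas_def by force
  have "\<forall>(U, \<phi>)\<in>restrict_atlas A nbhd. \<forall>(V, \<psi>)\<in>half_cylinder_atlas s A \<epsilon>. \<forall>i<s.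
        smooth_on s (\<phi> ` (U \<inter> collar_inv -` V)) (\<lambda>y. \<psi> (collar_inv (inv_into U \<phi> y)) i)"
    using collar_diffeo unfolding mfd_diffeomorphism_def smooth_mfd_map_def topspace_half_cylinder collar_inv_def by blast
  from bspec[OF bspec[OF this VN, unfolded prod.case] cyl, unfolded prod.case]
  have sm: "smooth_on s (\<psi> ` (V \<inter> nbhd \<inter> collar_inv -` ((U \<inter> bd) \<times> {0..<\<epsilon>}))) (\<lambda>y. ch (collar_inv (inv_into (V \<inter> nbhd) \<psi> y)) i)" if "i < s" for i
    using that by blast
  have sub: "V \<inter> tube U \<subseteq> V \<inter> nbhd \<inter> collar_inv -` ((U \<inter> bd) \<times> {0..<\<epsilon>})"
    by (auto simp: tube_def elim!: nbhd_cases)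
  have sm': "smooth_on s (\<psi> ` (V \<inter> tube U)) (\<lambda>y. ch (collar_inv (inv_into V \<psi> y)) i)" if "i < s" for i
  proof (rule smooth_on_cong[OF smooth_on_subset[OF sm[OF that] image_mono[OF sub]]])
    fix y assume "y \<in> \<psi> ` (V \<inter> tube U)"
    then have "y \<in> \<psi> ` (V \<inter> nbhd)" by (auto simp: tube_def)
    then show "ch (collar_inv (inv_into (V \<inter> nbhd) \<psi> y)) i = ch (collar_inv (inv_into V \<psi> y)) i"
      by (simp add: inv_into_subset_eq[OF chart_inj[OF V]])
  qed
  show "smooth_on s (\<psi> ` (V \<inter> tube U)) (\<lambda>y. snd (collar_inv (inv_into V \<psi> y)))"
    using sm'[OF s_pos] by (simp add: ch_def case_prod_unfold)
  show "smooth_on s (\<psi> ` (V \<inter> tube U)) (\<lambda>y. \<phi> (fst (collar_inv (inv_into V \<psi> y))) (Suc i))" if "i < s - 1"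
    using sm'[of "Suc i"] that by (simp add: ch_def case_prod_unfold)
qed

text \<open>The forward half of the diffeomorphism, for points \<open>w\<close> and depths
  \<open>t\<close> that depend on a Euclidean parameter and are known through their coordinates
  only. It is applied to the squeezed points of a plot.\<close>

lemma smooth_collar:
  assumes U: "(U, \<phi>) \<in> A" and V: "(V, \<psi>) \<in> A" and D: "D \<subseteq> euc q"
    and w: "\<And>x. x \<in> D \<Longrightarrow> w x \<in> U \<inter> bd" and t: "\<And>x. x \<in> D \<Longrightarrow> 0 \<le> t x \<and> t x < \<epsilon>"
    and c: "\<And>x. x \<in> D \<Longrightarrow> c (w x, t x) \<in> V"
    and ws: "\<And>i. i < s - 1 \<Longrightarrow> smooth_on q D (\<lambda>x. \<phi> (w x) (Suc i))"
    and ts: "smooth_on q D t" and i: "i < s"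
  shows "smooth_on q D (\<lambda>x. \<psi> (c (w x, t x)) i)"
proof -
  define ch where "ch = (\<lambda>(w, t). case_nat t (tang \<phi> w))"
  define Q where "Q = (U \<inter> bd) \<times> {0..<\<epsilon>}"
  have cyl: "(Q, ch) \<in> half_cylinder_atlas s A \<epsilon>"
    unfolding half_cylinder_atlas_def boundary_atlas_def bd_def ch_def Q_def using U by force
  have VN: "(V \<inter> nbhd, \<psi>) \<in> restrict_atlas A nbhd"
    using V unfolding restrict_atlas_def by force
  have "\<forall>(U, \<phi>)\<in>half_cylinder_atlas s A \<epsilon>. \<forall>(V, \<psi>)\<in>restrict_atlas A nbhd. \<forall>i<s.
        smooth_on s (\<phi> ` (U \<inter> c -` V)) (\<lambda>y. \<psi> (c (inv_into U \<phi> y)) i)"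
    using collar_diffeo unfolding mfd_diffeomorphism_def smooth_mfd_map_def by blast
  from bspec[OF bspec[OF this cyl, unfolded prod.case] VN, unfolded prod.case]
  have sm: "smooth_on s (ch ` (Q \<inter> c -` (V \<inter> nbhd))) (\<lambda>y. \<psi> (c (inv_into Q ch y)) i)"
    using i by blast
  have inj: "inj_on ch Q"
  proof (rule inj_onI)
    fix p p' assume p: "p \<in> Q" "p' \<in> Q" "ch p = ch p'"
    have "tang \<phi> (fst p) = tang \<phi> (fst p')"
      using fun_cong[OF p(3), of "Suc _"] by (auto simp: ch_def case_prod_unfold)
    then have "fst p = fst p'" using tang_inj[OF U] p(1,2) by (auto simp: Q_def dest: inj_onD)
    moreover have "snd p = snd p'"
      using fun_cong[OF p(3), of 0] by (auto simp: ch_def case_prod_unfold)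
    ultimately show "p = p'" by (simp add: prod_eq_iff)
  qed
  have "smooth_on q D (\<lambda>x. \<psi> (c (inv_into Q ch (ch (w x, t x)))) i)"
  proof (rule smooth_on_compose[OF sm _ D])
    show "smooth_on q D (\<lambda>x. ch (w x, t x) j)" if "j < s" for j
      using that ts ws by (cases j) (auto simp: ch_def)
    show "ch (w x, t x) \<in> ch ` (Q \<inter> c -` (V \<inter> nbhd))" if "x \<in> D" for x
      using w[OF that] t[OF that] c[OF that] by (intro imageI) (auto simp: Q_def)
  qed
  then show ?thesis
  proof (rule smooth_on_cong)
    fix x assume x: "x \<in> D"
    have "inv_into Q ch (ch (w x, t x)) = (w x, t x)"
      using w[OF x] t[OF x] by (intro inv_into_f_f[OF inj]) (auto simp: Q_def)
    then show "\<psi> (c (inv_into Q ch (ch (w x, t x)))) i = \<psi> (c (w x, t x)) i" by simp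
  qed
qed

text \<open>Compactness of the boundary enters here: a closed subcollar is compact, hence closed in
  the Hausdorff space \<open>W\<close>. Its complement is thus open, as extension by zero
  requires.\<close>

lemma closedin_collar:
  assumes "b < \<epsilon>"
  shows "closedin W (c ` (bd \<times> {0..b}))"
proof -
  have "compactin (half_cylinder s W A \<epsilon>) (bd \<times> {0..b})"
    unfolding half_cylinder_def compactin_Times
    using compact_boundary assms by (auto simp: compactin_subtopology bd_def)
  from image_compactin[OF this continuous_collar]
  have "compactin W (c ` (bd \<times> {0..b}))" by (simp add: compactin_subtopology)
  then show ?thesis by (rule compactin_imp_closedin[OF Hausdorff_W])
qed

section \<open>Test functions supported in the collar\<close>

definition collar_ext :: "(real \<Rightarrow> real) \<Rightarrow> ('b \<Rightarrow> real) \<Rightarrow> 'b \<Rightarrow> real" where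
  "collar_ext \<sigma> b z = (if z \<in> nbhd then \<sigma> (snd (collar_inv z)) * b (fst (collar_inv z)) else 0)"

lemma collar_ext_on_collar: "w \<in> bd \<Longrightarrow> 0 \<le> t \<Longrightarrow> t < \<epsilon> \<Longrightarrow> collar_ext \<sigma> b (c (w, t)) = \<sigma> t * b w"
  by (simp add: collar_ext_def)

lemma collar_ext_bd: "w \<in> bd \<Longrightarrow> collar_ext \<sigma> b w = \<sigma> 0 * b w"
  using bd_subset_nbhd by (auto simp: collar_ext_def collar_inv_bd)

text \<open>Two kinds of points: off the closed subcollar of width \<open>b'\<close> the function
  vanishes on an open set, and on the subcollar it is a product of smooth functions of the cylinder
  coordinates.\<close>

lemma collar_ext_Cinner:
  assumes \<sigma>: "smooth_real \<sigma>" and b: "b \<in> Cbd" and b': "b' < \<epsilon>" "\<And>t. b' \<le> t \<Longrightarrow> \<sigma> t = 0"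
  shows "collar_ext \<sigma> b \<in> Cinner"
proof (intro Cinner_I smooth_on_local)
  fix V \<psi> y assume V: "(V, \<psi>) \<in> A" and y: "y \<in> \<psi> ` (V \<inter> Wint)"
  then obtain z where z: "z \<in> V" "z \<in> Wint" "y = \<psi> z" by auto
  note inj = chart_inj[OF V]
  let ?f = "\<lambda>y. collar_ext \<sigma> b (inv_into V \<psi> y)"
  show "\<exists>O'. openin (Euclidean_space s) O' \<and> y \<in> O' \<and> smooth_on s (\<psi> ` (V \<inter> Wint) \<inter> O') ?f"
  proof (cases "z \<in> c ` (bd \<times> {0..b'})")
    case False
    let ?T = "topspace W - c ` (bd \<times> {0..b'})"
    have "openin W ?T" using closedin_collar[OF b'(1)] by blast
    from chart_image_Int[OF V this] obtain P where P: "openin (Euclidean_space s) P" "\<psi> ` (V \<inter> ?T) = P \<inter> \<psi> ` V"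
      by metis
    have "smooth_on s (\<psi> ` (V \<inter> Wint) \<inter> P) ?f"
    proof (rule smooth_on_cong)
      show "smooth_on s (\<psi> ` (V \<inter> Wint) \<inter> P) (\<lambda>_. 0)"
        by (rule smooth_on_const) (use chart_in_euc[OF V] in auto)
      fix y' assume "y' \<in> \<psi> ` (V \<inter> Wint) \<inter> P"
      then have "y' \<in> \<psi> ` (V \<inter> ?T)" using P(2) by auto
      then obtain z' where z': "z' \<in> V" "z' \<in> ?T" "y' = \<psi> z'" by auto
      have "collar_ext \<sigma> b z' = 0"
      proof (cases "z' \<in> nbhd")
        case True
        then obtain w t where "z' = c (w, t)" "w \<in> bd" "0 \<le> t" "t < \<epsilon>" "collar_inv z' = (w, t)" by (rule nbhd_cases)
        moreover from this z'(2) have "b' \<le> t" by force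
        ultimately show ?thesis by (simp add: collar_ext_def b'(2))
      qed (simp add: collar_ext_def)
      then show "0 = ?f y'" using z' inj by simp
    qed
    moreover have "y \<in> P" using z False P(2) by blast
    ultimately show ?thesis using P(1) by blast
  next
    case True
    then have "z \<in> nbhd" using b'(1) by (force simp: nbhd_def)
    then obtain w t where w: "z = c (w, t)" "w \<in> bd" "0 \<le> t" "t < \<epsilon>" "collar_inv z = (w, t)" by (rule nbhd_cases)
    obtain U \<phi> where U: "(U, \<phi>) \<in> A" "w \<in> U" using chart_at[of w] w(2) bd_subset by blast
    from chart_image_Int[OF V openin_tube[OF chart_open[OF U(1)]]] obtain P
      where P: "openin (Euclidean_space s) P" "\<psi> ` (V \<inter> tube U) = P \<inter> \<psi> ` V" by metis
    have "z \<in> tube U" using w U(2) by (auto simp: tube_def)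
    then have "y \<in> P" using z P(2) by blast
    moreover have "smooth_on s (\<psi> ` (V \<inter> Wint) \<inter> P) ?f"
    proof (rule smooth_on_subset)
      have tube: "inv_into V \<psi> y' \<in> tube U" if "y' \<in> \<psi> ` (V \<inter> tube U)" for y'
        using that inj by auto
      show "smooth_on s (\<psi> ` (V \<inter> tube U)) ?f"
      proof (rule smooth_on_cong)
        show "smooth_on s (\<psi> ` (V \<inter> tube U)) (\<lambda>y. \<sigma> (snd (collar_inv (inv_into V \<psi> y))) * b (fst (collar_inv (inv_into V \<psi> y))))"
        proof (rule smooth_on_mult[OF smooth_on_compose_real[OF \<sigma> smooth_collar_inv(1)[OF V U(1)]] Cbd_compose[OF b U(1)]])
          show "\<psi> ` (V \<inter> tube U) \<subseteq> euc s" using chart_in_euc[OF V] by auto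
          show "fst (collar_inv (inv_into V \<psi> y')) \<in> U \<inter> bd" if "y' \<in> \<psi> ` (V \<inter> tube U)" for y'
            using tube[OF that] by (auto simp: tube_def elim!: nbhd_cases)
        qed (rule smooth_collar_inv(2)[OF V U(1)])
        show "\<sigma> (snd (collar_inv (inv_into V \<psi> y'))) * b (fst (collar_inv (inv_into V \<psi> y'))) = ?f y'" if "y' \<in> \<psi> ` (V \<inter> tube U)" for y'
          using tube[OF that] by (auto simp: tube_def collar_ext_def)
      qed
      show "\<psi> ` (V \<inter> Wint) \<inter> P \<subseteq> \<psi> ` (V \<inter> tube U)" using P(2) by auto
    qed
    ultimately show ?thesis using P(1) by blast
  qed
qed

definition collar_const :: "('b \<Rightarrow> real) \<Rightarrow> bool" where
  "collar_const g \<longleftrightarrow> (\<exists>\<delta>>0. \<delta> < \<epsilon> \<and> (\<forall>w\<in>bd. \<forall>t. 0 \<le> t \<and> t < \<delta> \<longrightarrow> g (c (w, t)) = g w))"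

text \<open>This is the algebra \<open>C_mfd s W A \<epsilon> c\<close>, described without the gluing of \<open>W\<close> to its boundary.\<close>

definition CW :: "('b \<Rightarrow> real) set" where
  "CW = {g \<in> Cbd \<inter> Cinner. collar_const g}"

lemma collar_ext_CW:
  assumes \<sigma>: "smooth_real \<sigma>" and b: "b \<in> Cbd" and b': "b' < \<epsilon>" "\<And>t. b' \<le> t \<Longrightarrow> \<sigma> t = 0"
    and \<delta>: "0 < \<delta>" "\<And>t. t < \<delta> \<Longrightarrow> \<sigma> t = \<sigma> 0"
  shows "collar_ext \<sigma> b \<in> CW"
proof -
  have "(\<lambda>w. \<sigma> 0 * b w) \<in> Cbd" by (intro Cbd_mult Cbd_const b)
  then have "collar_ext \<sigma> b \<in> Cbd" by (rule Cbd_cong) (simp add: collar_ext_bd)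
  moreover have "collar_const (collar_ext \<sigma> b)"
    unfolding collar_const_def
  \<comment> \<open>The width has to be less than \<epsilon>, even if \<sigma> is constant for
    longer.\<close>
  proof (intro exI[of _ "min \<delta> (\<epsilon> / 2)"] conjI ballI allI impI)
    fix w t assume wt: "w \<in> bd" "0 \<le> t \<and> t < min \<delta> (\<epsilon> / 2)"
    have "\<sigma> t = \<sigma> 0" by (rule \<delta>(2)) (use wt in simp)
    then show "collar_ext \<sigma> b (c (w, t)) = collar_ext \<sigma> b w"
      using wt eps_pos by (simp add: collar_ext_bd collar_ext_on_collar)
  qed (use \<delta>(1) eps_pos in auto)
  ultimately show ?thesis using collar_ext_Cinner[OF \<sigma> b b'] by (simp add: CW_def)
qed

section \<open>Local coordinates on the boundary\<close>

text \<open>\<open>case_nat 0\<close> embeds the coordinates of the boundary as the face of the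
  half-space; on chart images it undoes \<open>tang\<close>.\<close>

lemma continuous_case_nat_zero:
  "continuous_map (Euclidean_space (s - 1)) (Euclidean_space s) (case_nat 0)"
proof (rule continuous_map_eq)
  show "continuous_map (Euclidean_space (s - 1)) (Euclidean_space s) (\<lambda>y. trunc s (\<lambda>i. case_nat 0 y i))"
    unfolding continuous_map_trunc
  proof (intro allI impI)
    fix j assume "j < s"
    show "continuous_map (Euclidean_space (s - 1)) euclideanreal (\<lambda>y. case_nat 0 y j)"
      using continuous_map_Euclidean_coord[of "s - 1" UNIV] by (cases j) auto
  qed
  show "trunc s (\<lambda>i. case_nat 0 y i) = case_nat 0 y" if "y \<in> euc (s - 1)" for y
    using that by (intro trunc_id) (auto simp: topspace_Euclidean_space split: nat.split)
qed

lemma case_nat_tang: "(V, \<psi>) \<in> A \<Longrightarrow> z \<in> V \<Longrightarrow> z \<in> bd \<Longrightarrow> case_nat 0 (tang \<psi> z) = \<psi> z"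
  using chart_boundary_zero by (auto simp: fun_eq_iff split: nat.split)

text \<open>The counterpart of \<open>chart_image_Int\<close> for boundary charts: the open set is
  pulled back along the face embedding.\<close>

lemma boundary_rel_open:
  assumes V: "(V, \<psi>) \<in> A" and T: "openin W T" and z: "z \<in> V" "z \<in> bd" "z \<in> T"
  obtains P where "openin (Euclidean_space (s - 1)) P" "tang \<psi> z \<in> P"
    "tang \<psi> ` (V \<inter> bd) \<inter> P \<subseteq> tang \<psi> ` (V \<inter> bd \<inter> T)"
proof -
  obtain Q where Q: "openin (Euclidean_space s) Q" "\<psi> ` (V \<inter> T) = Q \<inter> \<psi> ` V"
    by (rule chart_image_Int[OF V T])
  define P where "P = {y \<in> euc (s - 1). case_nat 0 y \<in> Q}"
  show thesis
  proof (rule that)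
    show "openin (Euclidean_space (s - 1)) P"
      unfolding P_def by (rule openin_continuous_map_preimage[OF continuous_case_nat_zero Q(1)])
    have "\<psi> z \<in> Q" using z Q(2) by blast
    then show "tang \<psi> z \<in> P" using z tang_in_euc[OF V] case_nat_tang[OF V] by (simp add: P_def)
    show "tang \<psi> ` (V \<inter> bd) \<inter> P \<subseteq> tang \<psi> ` (V \<inter> bd \<inter> T)"
    proof
      fix y assume "y \<in> tang \<psi> ` (V \<inter> bd) \<inter> P"
      then obtain z' where z': "z' \<in> V" "z' \<in> bd" "y = tang \<psi> z'" "y \<in> P" by auto
      then have "\<psi> z' \<in> \<psi> ` (V \<inter> T)" using Q(2) case_nat_tang[OF V] by (simp add: P_def)
      then have "z' \<in> T" using chart_inj[OF V] z'(1) by (auto dest: inj_onD)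
      then show "y \<in> tang \<psi> ` (V \<inter> bd \<inter> T)" using z' by auto
    qed
  qed
qed

text \<open>A boundary transition is a transition of \<open>W\<close> preceded by the face
  embedding, with the normal coordinate dropped afterwards.\<close>

lemma boundary_transition:
  assumes V: "(V, \<psi>) \<in> A" and U: "(U, \<phi>) \<in> A" and i: "i < s - 1"
  shows "smooth_on (s - 1) (tang \<psi> ` (V \<inter> bd \<inter> U)) (\<lambda>y. \<phi> (inv_into (V \<inter> bd) (tang \<psi>) y) (Suc i))"
proof (rule smooth_on_cong)
  have e: "tang \<psi> ` (V \<inter> bd \<inter> U) \<subseteq> euc (s - 1)" using tang_in_euc[OF V] by blast
  show "smooth_on (s - 1) (tang \<psi> ` (V \<inter> bd \<inter> U)) (\<lambda>y. \<phi> (inv_into V \<psi> (case_nat 0 y)) (Suc i))"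
  proof (rule smooth_on_compose[OF transition[OF V U, of "Suc i"] _ e])
    show "smooth_on (s - 1) (tang \<psi> ` (V \<inter> bd \<inter> U)) (\<lambda>y. case_nat 0 y j)" for j
      by (cases j) (simp_all only: nat.case smooth_on_const[OF e] smooth_on_coord[OF e])
    show "case_nat 0 y \<in> \<psi> ` (V \<inter> U)" if "y \<in> tang \<psi> ` (V \<inter> bd \<inter> U)" for y
      using that case_nat_tang[OF V] by auto
  qed (use i in simp)
  fix y assume "y \<in> tang \<psi> ` (V \<inter> bd \<inter> U)"
  then obtain z where z: "z \<in> V" "z \<in> bd" "y = tang \<psi> z" by auto
  have "inv_into V \<psi> (case_nat 0 y) = z"
    using z case_nat_tang[OF V] chart_inj[OF V] by simp
  moreover have "inv_into (V \<inter> bd) (tang \<psi>) y = z"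
    unfolding z(3) using z by (intro inv_into_f_f[OF tang_inj[OF V]]) simp
  ultimately show "\<phi> (inv_into V \<psi> (case_nat 0 y)) (Suc i) = \<phi> (inv_into (V \<inter> bd) (tang \<psi>) y) (Suc i)" by simp
qed

text \<open>Away from \<open>U\<close> the complement of \<open>K\<close> provides a neighbourhood
  on which the function is 0. For this \<open>K\<close> has to be closed in all of \<open>W\<close>,
  not only in \<open>U\<close>.\<close>

lemma chart_supported_Cbd:
  assumes U: "(U, \<phi>) \<in> A" and K: "closedin W K" "K \<subseteq> U" and G: "smooth_on (s - 1) (euc (s - 1)) G"
    and zero: "\<And>w. w \<in> U \<Longrightarrow> w \<in> bd \<Longrightarrow> w \<notin> K \<Longrightarrow> G (tang \<phi> w) = 0"
  shows "(\<lambda>w. if w \<in> U then G (tang \<phi> w) else 0) \<in> Cbd"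
proof (intro Cbd_I smooth_on_local)
  fix V \<psi> y assume V: "(V, \<psi>) \<in> A" and "y \<in> tang \<psi> ` (V \<inter> bd)"
  then obtain z where z: "z \<in> V" "z \<in> bd" "y = tang \<psi> z" by auto
  let ?iv = "inv_into (V \<inter> bd) (tang \<psi>)"
  let ?f = "\<lambda>y. if ?iv y \<in> U then G (tang \<phi> (?iv y)) else 0"
  have iv: "?iv y' \<in> V \<inter> bd \<inter> T" if "y' \<in> tang \<psi> ` (V \<inter> bd \<inter> T)" for y' T
  proof -
    from that obtain z' where z': "z' \<in> V \<inter> bd \<inter> T" "y' = tang \<psi> z'" by auto
    then have "?iv y' = z'" by (simp add: inv_into_f_f[OF tang_inj[OF V]])
    then show ?thesis using z' by simp
  qed
  show "\<exists>O'. openin (Euclidean_space (s - 1)) O' \<and> y \<in> O' \<and> smooth_on (s - 1) (tang \<psi> ` (V \<inter> bd) \<inter> O') ?f"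
  proof (cases "z \<in> U")
    case True
    obtain P where P: "openin (Euclidean_space (s - 1)) P" "tang \<psi> z \<in> P"
      "tang \<psi> ` (V \<inter> bd) \<inter> P \<subseteq> tang \<psi> ` (V \<inter> bd \<inter> U)"
      by (rule boundary_rel_open[OF V chart_open[OF U] z(1,2) True])
    have "smooth_on (s - 1) (tang \<psi> ` (V \<inter> bd \<inter> U)) ?f"
    proof (rule smooth_on_cong)
      show "smooth_on (s - 1) (tang \<psi> ` (V \<inter> bd \<inter> U)) (\<lambda>y. G (tang \<phi> (?iv y)))"
      proof (rule smooth_on_compose[OF G boundary_transition[OF V U]])
        show "tang \<psi> ` (V \<inter> bd \<inter> U) \<subseteq> euc (s - 1)" using tang_in_euc[OF V] by blast
        show "tang \<phi> (?iv y') \<in> euc (s - 1)" if "y' \<in> tang \<psi> ` (V \<inter> bd \<inter> U)" for y'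
          using iv[OF that] by (intro tang_in_euc[OF U]) simp
      qed
      show "G (tang \<phi> (?iv y')) = ?f y'" if "y' \<in> tang \<psi> ` (V \<inter> bd \<inter> U)" for y'
        using iv[OF that] by simp
    qed
    from smooth_on_subset[OF this P(3)] show ?thesis using P z(3) by blast
  next
    case False
    let ?T = "topspace W - K"
    have T: "openin W ?T" using K(1) by blast
    have "z \<in> ?T" using False K(2) z(2) bd_subset by blast
    from boundary_rel_open[OF V T z(1,2) this] obtain P where P: "openin (Euclidean_space (s - 1)) P" "tang \<psi> z \<in> P"
      "tang \<psi> ` (V \<inter> bd) \<inter> P \<subseteq> tang \<psi> ` (V \<inter> bd \<inter> ?T)" by metis
    have "smooth_on (s - 1) (tang \<psi> ` (V \<inter> bd \<inter> ?T)) ?f"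
    proof (rule smooth_on_cong)
      have "tang \<psi> ` (V \<inter> bd \<inter> ?T) \<subseteq> euc (s - 1)" using tang_in_euc[OF V] by blast
      then show "smooth_on (s - 1) (tang \<psi> ` (V \<inter> bd \<inter> ?T)) (\<lambda>_. 0)" by (rule smooth_on_const)
      show "0 = ?f y'" if "y' \<in> tang \<psi> ` (V \<inter> bd \<inter> ?T)" for y'
        using iv[OF that] zero by simp
    qed
    from smooth_on_subset[OF this P(3)] show ?thesis using P z(3) by blast
  qed
qed

text \<open>The closed coordinate box is compact, so its preimage is compact and therefore closed in
  the Hausdorff space \<open>W\<close>. It serves as the set \<open>K\<close> of the previous
  lemma.\<close>

lemma chart_compact_box:
  assumes U: "(U, \<phi>) \<in> A" and w0: "w0 \<in> U"
  obtains r K where "r > 0" "closedin W K" "K \<subseteq> U"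
    "\<And>w. w \<in> U \<Longrightarrow> w \<notin> K \<Longrightarrow> \<exists>i<s. \<bar>\<phi> w i - \<phi> w0 i\<bar> > r"
proof -
  obtain Q where Q: "openin (Euclidean_space s) Q" "\<phi> ` U = Q \<inter> half_space s"
    using chart_image[OF U] unfolding openin_subtopology by blast
  have "\<phi> w0 \<in> Q" using Q(2) w0 by blast
  from openin_Euclidean_space_box[OF Q(1) this] obtain r where
    r: "r > 0" "\<And>y. y \<in> euc s \<Longrightarrow> (\<And>i. i < s \<Longrightarrow> \<bar>y i - \<phi> w0 i\<bar> < r) \<Longrightarrow> y \<in> Q" by metis
  \<comment> \<open>A product of compact sets over all indices. The maximum with 0 keeps it in the
    half-space, the singletons from \<open>s\<close> on put it in the space of dimension
    \<open>s\<close>, and half the radius keeps the closed box within the open one.\<close>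
  define I where "I i = (if i = 0 then {max 0 (\<phi> w0 0 - r / 2)..\<phi> w0 0 + r / 2}
      else if i < s then {\<phi> w0 i - r / 2..\<phi> w0 i + r / 2} else {0})" for i
  define Bx where "Bx = PiE UNIV I"
  have Bx_iff: "x \<in> Bx \<longleftrightarrow> x \<in> half_space s \<and> (\<forall>i<s. \<bar>x i - \<phi> w0 i\<bar> \<le> r / 2)" for x
  proof
    assume x: "x \<in> Bx"
    have I: "x i \<in> I i" for i using x by (simp add: Bx_def PiE_iff)
    have "0 \<le> x 0" using I[of 0] by (simp add: I_def)
    moreover have "x i = 0" if "i \<ge> s" for i using I[of i] that s_pos by (simp add: I_def)
    moreover have "\<bar>x i - \<phi> w0 i\<bar> \<le> r / 2" if "i < s" for i
    proof -
      have "\<phi> w0 i - r / 2 \<le> x i" "x i \<le> \<phi> w0 i + r / 2"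
        using I[of i] that by (cases "i = 0"; simp add: I_def)+
      then show ?thesis by linarith
    qed
    ultimately show "x \<in> half_space s \<and> (\<forall>i<s. \<bar>x i - \<phi> w0 i\<bar> \<le> r / 2)"
      by (simp add: half_space_def topspace_Euclidean_space)
  next
    assume x: "x \<in> half_space s \<and> (\<forall>i<s. \<bar>x i - \<phi> w0 i\<bar> \<le> r / 2)"
    have "x i \<in> I i" for i
    proof (cases "i < s")
      case True
      with x have "\<bar>x i - \<phi> w0 i\<bar> \<le> r / 2" by blast
      then have "\<phi> w0 i - r / 2 \<le> x i" "x i \<le> \<phi> w0 i + r / 2" by linarith+
      then show ?thesis using True x by (cases "i = 0") (simp_all add: I_def half_space_def)
    qed (use x s_pos in \<open>auto simp: I_def half_space_def topspace_Euclidean_space\<close>)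
    then show "x \<in> Bx" by (auto simp: Bx_def PiE_iff)
  qed
  have BxU: "Bx \<subseteq> \<phi> ` U"
  proof
    fix x assume x: "x \<in> Bx"
    have "x \<in> Q"
    proof (rule r(2))
      show "x \<in> euc s" using x by (simp add: Bx_iff half_space_def)
      fix i assume "i < s"
      then have "\<bar>x i - \<phi> w0 i\<bar> \<le> r / 2" using x by (simp add: Bx_iff)
      then show "\<bar>x i - \<phi> w0 i\<bar> < r" using r(1) by linarith
    qed
    then show "x \<in> \<phi> ` U" using x Q(2) by (simp add: Bx_iff)
  qed
  have "compactin (powertop_real UNIV) Bx"
    unfolding Bx_def compactin_PiE by (auto simp: I_def)
  then have comp: "compactin (subtopology (Euclidean_space s) (\<phi> ` U)) Bx"
    using BxU chart_in_euc[OF U] unfolding Euclidean_space_def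
    by (auto simp: compactin_subtopology topspace_Euclidean_space)
  obtain g where g: "homeomorphic_maps (subtopology W U) (subtopology (Euclidean_space s) (\<phi> ` U)) \<phi> g"
    using chart_homeo[OF U] by (auto simp: homeomorphic_map_maps)
  have g\<phi>: "g (\<phi> w) = w" if "w \<in> U" for w
    using g that chart_subset[OF U] by (auto simp: homeomorphic_maps_def)
  have "compactin (subtopology W U) (g ` Bx)"
    using image_compactin[OF comp, of "subtopology W U" g] g by (simp add: homeomorphic_maps_def)
  then have "compactin W (g ` Bx)" "g ` Bx \<subseteq> U" by (simp_all add: compactin_subtopology)
  moreover have "\<exists>i<s. \<bar>\<phi> w i - \<phi> w0 i\<bar> > r / 2" if "w \<in> U" "w \<notin> g ` Bx" for w
  proof (rule ccontr)
    assume "\<not> ?thesis"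
    then have "\<phi> w \<in> Bx" using chart_in_half_space[OF U that(1)] by (auto simp: Bx_iff)
    then show False using that g\<phi> by force
  qed
  ultimately show thesis
    using r(1) compactin_imp_closedin[OF Hausdorff_W] by (intro that[of "r / 2" "g ` Bx"]) auto
qed

text \<open>Chart coordinates are not functions on the whole boundary and cannot test a plot. Here
  they are replaced by global ones: \<beta> marks a neighbourhood of \<open>w0\<close> by being
  positive, and there the functions \<open>k i\<close> are the coordinates.\<close>

lemma boundary_coordinates:
  assumes U: "(U, \<phi>) \<in> A" and w0: "w0 \<in> U" "w0 \<in> bd"
  obtains \<beta> k where "\<beta> \<in> Cbd" "\<beta> w0 > 0" "\<And>i. i < s - 1 \<Longrightarrow> k i \<in> Cbd"
    "\<And>w. w \<in> bd \<Longrightarrow> \<beta> w > 0 \<Longrightarrow> w \<in> U \<and> (\<forall>i<s - 1. k i w = \<phi> w (Suc i))"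
proof -
  obtain r K where r: "r > 0" and K: "closedin W K" "K \<subseteq> U"
    and out: "\<And>w. w \<in> U \<Longrightarrow> w \<notin> K \<Longrightarrow> \<exists>i<s. \<bar>\<phi> w i - \<phi> w0 i\<bar> > r"
    using chart_compact_box[OF U w0(1)] by metis
  \<comment> \<open>Squares replace absolute values for the sake of smoothness; thresholds are
    accordingly compared with \<open>r * r\<close>.\<close>
  define bump where "bump a b y = (\<Prod>i<s - 1. step a b ((y i - \<phi> w0 (Suc i)) * (y i - \<phi> w0 (Suc i))))" for a b y
  have sm: "smooth_on (s - 1) (euc (s - 1)) (bump a b)" for a b
    unfolding bump_def[abs_def]
    by (intro smooth_on_prod smooth_on_compose_real[OF smooth_real_step] smooth_on_mult smooth_on_diff smooth_on_coord smooth_on_const) auto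
  have bump0: "bump a b (tang \<phi> w) = 0" if w: "w \<in> U" "w \<in> bd" "w \<notin> K" "a < b" "b \<le> r * r" for w a b
  proof -
    obtain i where i: "i < s" "\<bar>\<phi> w i - \<phi> w0 i\<bar> > r" using out[OF w(1,3)] by blast
    \<comment> \<open>Both points lie on the boundary and have normal coordinate 0, so only a
      tangential coordinate can separate them.\<close>
    moreover have "i \<noteq> 0" using i(2) r chart_boundary_zero[OF U] w(1,2) w0 by (cases i) auto
    ultimately obtain j where j: "i = Suc j" "j < s - 1" by (cases i) auto
    have "r * r \<le> \<bar>\<phi> w i - \<phi> w0 i\<bar> * \<bar>\<phi> w i - \<phi> w0 i\<bar>" using i(2) r by (intro mult_mono) auto
    then have "step a b ((\<phi> w (Suc j) - \<phi> w0 (Suc j)) * (\<phi> w (Suc j) - \<phi> w0 (Suc j))) = 0"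
      using w j by (intro step_eq_0) (auto simp flip: abs_mult)
    then show ?thesis unfolding bump_def using j(2) by (intro prod_zero) auto
  qed
  \<comment> \<open>Nested cutoffs: the one in \<beta> falls between \<open>q\<close> and
    \<open>2 * q\<close>, the one in \<open>k\<close> between \<open>2 * q\<close> and
    \<open>4 * q = r * r\<close>. Where \<beta> is positive the second is still 1, and outside
    \<open>K\<close> both are 0.\<close>
  define q where "q = r * r / 4"
  have q: "q > 0" "4 * q = r * r" using r by (simp_all add: q_def)
  define \<beta> where "\<beta> = (\<lambda>w. if w \<in> U then bump q (2 * q) (tang \<phi> w) else 0)"
  define k where "k i = (\<lambda>w. if w \<in> U then (\<lambda>y. y i * bump (2 * q) (4 * q) y) (tang \<phi> w) else 0)" for i
  show thesis
  proof (rule that[of \<beta> k])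
    show "\<beta> \<in> Cbd" unfolding \<beta>_def
      by (rule chart_supported_Cbd[OF U K sm]) (use bump0 q in auto)
    show "k i \<in> Cbd" for i unfolding k_def
    proof (rule chart_supported_Cbd[OF U K])
      show "smooth_on (s - 1) (euc (s - 1)) (\<lambda>y. y i * bump (2 * q) (4 * q) y)"
        by (intro smooth_on_mult smooth_on_coord sm) simp
    qed (use bump0 q in auto)
    show "\<beta> w0 > 0" using w0 q by (simp add: \<beta>_def bump_def)
    fix w assume w: "w \<in> bd" "\<beta> w > 0"
    then have wU: "w \<in> U" and pos: "bump q (2 * q) (tang \<phi> w) > 0" by (auto simp: \<beta>_def split: if_splits)
    have "step (2 * q) (4 * q) ((\<phi> w (Suc i) - \<phi> w0 (Suc i)) * (\<phi> w (Suc i) - \<phi> w0 (Suc i))) = 1" if "i < s - 1" for i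
    proof (rule step_eq_1)
      show "(\<phi> w (Suc i) - \<phi> w0 (Suc i)) * (\<phi> w (Suc i) - \<phi> w0 (Suc i)) \<le> 2 * q"
      proof (rule ccontr)
        assume "\<not> ?thesis"
        then have "step q (2 * q) ((\<phi> w (Suc i) - \<phi> w0 (Suc i)) * (\<phi> w (Suc i) - \<phi> w0 (Suc i))) = 0"
          using q by (intro step_eq_0) auto
        then have "bump q (2 * q) (tang \<phi> w) = 0" unfolding bump_def using that by (intro prod_zero) auto
        then show False using pos by simp
      qed
    qed (use q in simp)
    then have "bump (2 * q) (4 * q) (tang \<phi> w) = 1" unfolding bump_def by (intro prod.neutral) simp
    then show "w \<in> U \<and> (\<forall>i<s - 1. k i w = \<phi> w (Suc i))" using wU by (simp add: k_def)
  qed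
qed

section \<open>Squeezing the collar\<close>

text \<open>Depths up to a third of the collar are sent to 0 at \<tau> = 0, and depths from two
  thirds on never move. The outer third leaves room for joining \<open>squeeze\<close> to the
  identity off the collar. As \<open>step 0 1\<close> is defined on the whole line, \<tau> may be
  any real number, as the definition of homotopy demands.\<close>

definition profile :: "real \<Rightarrow> real \<Rightarrow> real" where
  "profile \<tau> t = t * (1 - step 0 1 \<tau> * step (\<epsilon> / 3) (2 * \<epsilon> / 3) t)"

definition squeeze :: "real \<Rightarrow> 'b \<Rightarrow> 'b" where
  "squeeze \<tau> z = (if z \<in> nbhd then c (fst (collar_inv z), profile \<tau> (snd (collar_inv z))) else z)"

lemma eps_thirds: "\<epsilon> / 3 < 2 * \<epsilon> / 3"
  using eps_pos by simp

text \<open>The factor multiplying \<open>t\<close> lies between 0 and 1. Squeezed points therefore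
  stay in the collar, and also in any strip along which a given function is constant.\<close>

lemma profile_bounds:
  assumes "0 \<le> t"
  shows "0 \<le> profile \<tau> t" "profile \<tau> t \<le> t"
proof -
  have "0 \<le> step 0 1 \<tau> * step (\<epsilon> / 3) (2 * \<epsilon> / 3) t" "step 0 1 \<tau> * step (\<epsilon> / 3) (2 * \<epsilon> / 3) t \<le> 1"
    using step_nonneg[OF eps_thirds, of t] step_le_1[OF eps_thirds, of t] step_nonneg[of 0 1 \<tau>] step_le_1[of 0 1 \<tau>]
    by (auto intro: mult_le_one)
  then show "0 \<le> profile \<tau> t" "profile \<tau> t \<le> t"
    using assms by (auto simp: profile_def algebra_simps mult_left_le)
qed

lemma squeeze_collar: "w \<in> bd \<Longrightarrow> 0 \<le> t \<Longrightarrow> t < \<epsilon> \<Longrightarrow> squeeze \<tau> (c (w, t)) = c (w, profile \<tau> t)"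
  by (simp add: squeeze_def)

lemma squeeze_bd: "w \<in> bd \<Longrightarrow> squeeze \<tau> w = w"
  using squeeze_collar[of w 0 \<tau>] eps_pos collar_zero by (simp add: profile_def)

lemma squeeze_in_W: "z \<in> topspace W \<Longrightarrow> squeeze \<tau> z \<in> topspace W"
proof (cases "z \<in> nbhd")
  case True
  then obtain w t where w: "z = c (w, t)" "w \<in> bd" "0 \<le> t" "t < \<epsilon>" "collar_inv z = (w, t)" by (rule nbhd_cases)
  then show ?thesis
    using profile_bounds[OF w(3), of \<tau>] collar_in_nbhd[OF w(2), of "profile \<tau> t"] nbhd_subset by (auto simp: squeeze_collar)
qed (simp add: squeeze_def)

lemma squeeze_1: "squeeze 1 z = z"
proof (cases "z \<in> nbhd")
  case True
  then obtain w t where "z = c (w, t)" "w \<in> bd" "0 \<le> t" "t < \<epsilon>" "collar_inv z = (w, t)" by (rule nbhd_cases)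
  then show ?thesis by (simp add: squeeze_collar profile_def)
qed (simp add: squeeze_def)

lemma squeeze_0: "w \<in> bd \<Longrightarrow> 0 \<le> t \<Longrightarrow> t \<le> \<epsilon> / 3 \<Longrightarrow> squeeze 0 (c (w, t)) = w"
  using eps_pos by (simp add: squeeze_collar profile_def collar_zero)

lemma squeeze_outer: "z \<notin> nbhd \<or> 2 * \<epsilon> / 3 \<le> snd (collar_inv z) \<Longrightarrow> squeeze \<tau> z = z"
proof (cases "z \<in> nbhd")
  case True
  assume *: "z \<notin> nbhd \<or> 2 * \<epsilon> / 3 \<le> snd (collar_inv z)"
  from True obtain w t where "z = c (w, t)" "w \<in> bd" "0 \<le> t" "t < \<epsilon>" "collar_inv z = (w, t)" by (rule nbhd_cases)
  with * show ?thesis using step_eq_0[OF eps_thirds, of t] eps_pos True by (simp add: squeeze_collar profile_def)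
qed (simp add: squeeze_def)

text \<open>A detector of depth: 1 down to depth \<open>a\<close>, 0 from depth \<open>b\<close> on
  and off the collar. Strict inequalities on its value are open conditions along a plot.\<close>

abbreviation collar_step :: "real \<Rightarrow> real \<Rightarrow> 'b \<Rightarrow> real" where
  "collar_step a b \<equiv> collar_ext (step a b) (\<lambda>_. 1)"

lemma step_ext_CW:
  assumes "0 < a" "a < b" "b < \<epsilon>" "h \<in> Cbd"
  shows "collar_ext (step a b) h \<in> CW"
  by (rule collar_ext_CW[OF smooth_real_step assms(4,3) _ assms(1)]) (use assms in auto)

lemma collar_step_posD:
  assumes "collar_step a b z > 0" "a < b"
  obtains w t where "z = c (w, t)" "w \<in> bd" "0 \<le> t" "t < \<epsilon>" "collar_inv z = (w, t)" "t < b"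
proof -
  have "z \<in> nbhd" using assms(1) by (auto simp: collar_ext_def split: if_splits)
  then obtain w t where w: "z = c (w, t)" "w \<in> bd" "0 \<le> t" "t < \<epsilon>" "collar_inv z = (w, t)" by (rule nbhd_cases)
  moreover have "t < b" using assms w step_eq_0[of a b t] by (fastforce simp: collar_ext_on_collar)
  ultimately show thesis by (rule that)
qed

lemma collar_step_less_1D: "collar_step a b z < 1 \<Longrightarrow> a < b \<Longrightarrow> z \<in> nbhd \<Longrightarrow> a < snd (collar_inv z)"
  by (rule ccontr) (simp add: collar_ext_def)

text \<open>With \<delta> a width on which \<open>g\<close> is constant in \<open>t\<close>, three
  zones overlap. At depth below \<open>2 * \<delta> / 3\<close> squeezing does not change the value
  of \<open>g\<close>; off the collar or beyond depth \<open>2 * \<epsilon> / 3\<close> it does not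
  change the point; between depths \<open>\<delta> / 3\<close> and \<open>5 * \<epsilon> / 6\<close>
  both collar coordinates of \<open>u\<close> are recovered from test functions and the squeezed
  point is computed from them.\<close>

lemma smooth_on_squeeze:
  assumes V: "openin (Euclidean_space q) V" and uW: "\<And>x. x \<in> V \<Longrightarrow> u x \<in> topspace W"
    and u: "\<And>k. k \<in> CW \<Longrightarrow> smooth_on q V (\<lambda>x. k (u x))"
    and \<tau>: "smooth_on q V \<tau>" and g: "g \<in> CW"
  shows "smooth_on q V (\<lambda>x. g (squeeze (\<tau> x) (u x)))"
proof (rule smooth_on_local)
  fix x assume x: "x \<in> V"
  let ?f = "\<lambda>x. g (squeeze (\<tau> x) (u x))"
  note Ve = openin_subset[OF V]
  have locally_smoothI: "\<exists>O'. openin (Euclidean_space q) O' \<and> x \<in> O' \<and> smooth_on q (V \<inter> O') ?f"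
    if "openin (Euclidean_space q) V'" "x \<in> V'" "V' \<subseteq> V" "smooth_on q V' h" "\<And>y. y \<in> V' \<Longrightarrow> h y = ?f y" for V' h
    using that smooth_on_cong[OF that(4,5)] by (intro exI[of _ V']) (simp add: Int_absorb1)
  obtain \<delta> where \<delta>: "0 < \<delta>" "\<delta> < \<epsilon>" "\<And>w t. w \<in> bd \<Longrightarrow> 0 \<le> t \<Longrightarrow> t < \<delta> \<Longrightarrow> g (c (w, t)) = g w"
    using g by (auto simp: CW_def collar_const_def)
  have gbd: "g \<in> Cbd" and gin: "g \<in> Cinner" using g by (auto simp: CW_def)
  have k1: "collar_step (\<delta> / 3) (2 * \<delta> / 3) \<in> CW"
    using \<delta> by (intro step_ext_CW Cbd_const) auto
  have k2: "collar_step (2 * \<epsilon> / 3) (5 * \<epsilon> / 6) \<in> CW"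
    using eps_pos by (intro step_ext_CW Cbd_const) auto
  show "\<exists>O'. openin (Euclidean_space q) O' \<and> x \<in> O' \<and> smooth_on q (V \<inter> O') ?f"
  proof (cases "collar_step (\<delta> / 3) (2 * \<delta> / 3) (u x) > 0")
    case True
    let ?V' = "{y \<in> V. collar_step (\<delta> / 3) (2 * \<delta> / 3) (u y) \<in> {0<..}}"
    show ?thesis
    proof (rule locally_smoothI)
      show "openin (Euclidean_space q) ?V'" by (rule openin_smooth_preimage[OF V u[OF k1]]) simp
      show "smooth_on q ?V' (\<lambda>x. g (u x))" by (rule smooth_on_subset[OF u[OF g]]) auto
      fix y assume "y \<in> ?V'"
      then have "collar_step (\<delta> / 3) (2 * \<delta> / 3) (u y) > 0" by simp
      then obtain w t where w: "u y = c (w, t)" "w \<in> bd" "0 \<le> t" "t < \<epsilon>" "collar_inv (u y) = (w, t)" "t < 2 * \<delta> / 3"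
        by (rule collar_step_posD) (use \<delta> in simp)
      then show "g (u y) = ?f y"
        using profile_bounds[OF w(3), of "\<tau> y"] \<delta>(1) by (simp add: squeeze_collar \<delta>(3))
    qed (use x True in auto)
  next
    case notnear: False
    show ?thesis
    proof (cases "collar_step (2 * \<epsilon> / 3) (5 * \<epsilon> / 6) (u x) < 1")
      case True
      let ?V' = "{y \<in> V. collar_step (2 * \<epsilon> / 3) (5 * \<epsilon> / 6) (u y) \<in> {..<1}}"
      show ?thesis
      proof (rule locally_smoothI)
        show "openin (Euclidean_space q) ?V'" by (rule openin_smooth_preimage[OF V u[OF k2]]) simp
        show "smooth_on q ?V' (\<lambda>x. g (u x))" by (rule smooth_on_subset[OF u[OF g]]) auto
        fix y assume "y \<in> ?V'"
        then have "u y \<notin> nbhd \<or> 2 * \<epsilon> / 3 < snd (collar_inv (u y))"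
          using collar_step_less_1D[of "2 * \<epsilon> / 3" "5 * \<epsilon> / 6" "u y"] eps_pos by auto
        then show "g (u y) = ?f y" using squeeze_outer[of "u y" "\<tau> y"] by (metis less_imp_le)
      qed (use x True in auto)
    next
      case notfar: False
      define V1 where "V1 = {y \<in> V. collar_step (\<delta> / 3) (2 * \<delta> / 3) (u y) \<in> {..<1}}"
      define V2 where "V2 = {y \<in> V1. collar_step (2 * \<epsilon> / 3) (5 * \<epsilon> / 6) (u y) \<in> {0<..}}"
      have V1: "openin (Euclidean_space q) V1"
        unfolding V1_def by (rule openin_smooth_preimage[OF V u[OF k1]]) simp
      have V1V: "V1 \<subseteq> V" by (auto simp: V1_def)
      have V2: "openin (Euclidean_space q) V2"
        unfolding V2_def by (rule openin_smooth_preimage[OF V1 smooth_on_subset[OF u[OF k2] V1V]]) simp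
      have V2V: "V2 \<subseteq> V" using V1V by (auto simp: V2_def)
      have xV2: "x \<in> V2" using x notnear notfar by (auto simp: V1_def V2_def)
      define w where "w y = fst (collar_inv (u y))" for y
      define t where "t y = snd (collar_inv (u y))" for y
      have wt: "u y = c (w y, t y)" "w y \<in> bd" "\<delta> / 3 < t y" "t y < 5 * \<epsilon> / 6" "t y < \<epsilon>" "0 \<le> t y" if y: "y \<in> V2" for y
      proof -
        have "collar_step (2 * \<epsilon> / 3) (5 * \<epsilon> / 6) (u y) > 0" using y by (simp add: V2_def)
        then obtain w' t' where w': "u y = c (w', t')" "w' \<in> bd" "0 \<le> t'" "t' < \<epsilon>" "collar_inv (u y) = (w', t')" "t' < 5 * \<epsilon> / 6"
          by (rule collar_step_posD) (use eps_pos in simp)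
        moreover have "u y \<in> nbhd" using w' by simp
        then have "\<delta> / 3 < snd (collar_inv (u y))"
          using y \<delta>(1) by (intro collar_step_less_1D[where b = "2 * \<delta> / 3"]) (auto simp: V1_def V2_def)
        ultimately show "u y = c (w y, t y)" "w y \<in> bd" "\<delta> / 3 < t y" "t y < 5 * \<epsilon> / 6" "t y < \<epsilon>" "0 \<le> t y"
          by (simp_all add: w_def t_def)
      qed
      \<comment> \<open>It is 1 at every depth that occurs on \<open>V2\<close> and vanishes before
        the collar ends, so that multiplying by it turns a function on the boundary into a test
        function without changing it along \<open>u\<close>.\<close>
      let ?st = "step (5 * \<epsilon> / 6) (11 * \<epsilon> / 12)"
      have st_CW: "collar_ext ?st h \<in> CW" if "h \<in> Cbd" for h
        using eps_pos that by (intro step_ext_CW) auto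
      have st: "collar_ext ?st h (u y) = h (w y)" if "y \<in> V2" for h y
        using wt[OF that] eps_pos by (simp add: collar_ext_on_collar)
      have st_smooth: "smooth_on q V2 (\<lambda>y. h (w y))" if "h \<in> Cbd" for h
        by (rule smooth_on_cong[OF smooth_on_subset[OF u[OF st_CW[OF that]] V2V]]) (simp add: st)
      \<comment> \<open>This recovers the depth itself. The first factor is 0 up to
        \<open>\<delta> / 6\<close>, which puts the extension into \<open>CW\<close>, and equals
        \<open>r\<close> from \<open>\<delta> / 3\<close> on; the second cuts off before the end of
        the collar.\<close>
      define \<sigma> where "\<sigma> r = (r - r * step (\<delta> / 6) (\<delta> / 3) r) * ?st r" for r
      have "collar_ext \<sigma> (\<lambda>_. 1) \<in> CW"
      proof (rule collar_ext_CW)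
        show "smooth_real \<sigma>" unfolding \<sigma>_def[abs_def]
          by (intro smooth_real_mult smooth_real_diff smooth_real_id smooth_real_step)
        show "0 < \<delta> / 6" using \<delta> by simp
        show "\<sigma> r = \<sigma> 0" if "r < \<delta> / 6" for r using that \<delta> by (simp add: \<sigma>_def)
        show "11 * \<epsilon> / 12 < \<epsilon>" using eps_pos by simp
        show "\<sigma> r = 0" if "11 * \<epsilon> / 12 \<le> r" for r using that eps_pos by (simp add: \<sigma>_def)
      qed (rule Cbd_const)
      from smooth_on_subset[OF u[OF this] V2V] have t_smooth: "smooth_on q V2 t"
      proof (rule smooth_on_cong)
        fix y assume y: "y \<in> V2"
        show "collar_ext \<sigma> (\<lambda>_. 1) (u y) = t y"
          using wt[OF y] \<delta>(1) eps_pos by (simp add: collar_ext_on_collar \<sigma>_def)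
      qed
      define L where "L y = profile (\<tau> y) (t y)" for y
      have L: "smooth_on q V2 L"
        unfolding L_def profile_def
        using openin_subset[OF V2] smooth_on_subset[OF \<tau> V2V] t_smooth
        by (intro smooth_on_mult smooth_on_diff smooth_on_const smooth_on_compose_real[OF smooth_real_step])
      have Lb: "0 \<le> L y" "L y \<le> t y" "L y < \<epsilon>" if "y \<in> V2" for y
        using wt[OF that] profile_bounds[of "t y" "\<tau> y"] by (auto simp: L_def)
      have feq: "?f y = g (c (w y, L y))" if "y \<in> V2" for y
        using wt[OF that] by (simp add: squeeze_collar L_def)
      \<comment> \<open>The depth \<open>L\<close> after squeezing may be 0 although
        \<open>t\<close> is not. Below \<delta> the value of \<open>g\<close> depends on the
        boundary point alone; from \<delta> on, the squeezed point is interior near \<open>x\<close>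
        and a chart of \<open>W\<close> applies.\<close>
      show ?thesis
      proof (cases "L x < \<delta>")
        case True
        show ?thesis
        proof (rule locally_smoothI)
          show "openin (Euclidean_space q) {y \<in> V2. L y \<in> {..<\<delta>}}"
            by (rule openin_smooth_preimage[OF V2 L]) simp
          show "smooth_on q {y \<in> V2. L y \<in> {..<\<delta>}} (\<lambda>y. g (w y))"
            by (rule smooth_on_subset[OF st_smooth[OF gbd]]) auto
          show "g (w y) = ?f y" if "y \<in> {y \<in> V2. L y \<in> {..<\<delta>}}" for y
            using that \<delta>(3)[of "w y" "L y"] wt[of y] Lb[of y] feq[of y] by simp
        qed (use xV2 True V2V in auto)
      next
        case Lx: False
        obtain U \<phi> where U: "(U, \<phi>) \<in> A" "w x \<in> U"
          using chart_at[of "w x"] wt(2)[OF xV2] bd_subset by blast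
        \<comment> \<open>Through these functions on the boundary the coordinates of
          \<open>w y\<close> become smooth functions of the parameter.\<close>
        obtain \<beta> k where \<beta>: "\<beta> \<in> Cbd" "\<beta> (w x) > 0" "\<And>i. i < s - 1 \<Longrightarrow> k i \<in> Cbd"
          "\<And>w. w \<in> bd \<Longrightarrow> \<beta> w > 0 \<Longrightarrow> w \<in> U \<and> (\<forall>i<s - 1. k i w = \<phi> w (Suc i))"
          using boundary_coordinates[OF U wt(2)[OF xV2]] by metis
        define V3 where "V3 = {y \<in> V2. L y \<in> {0<..}}"
        define V4 where "V4 = {y \<in> V3. \<beta> (w y) \<in> {0<..}}"
        have V3: "openin (Euclidean_space q) V3" unfolding V3_def
          by (rule openin_smooth_preimage[OF V2 L]) simp
        have V4: "openin (Euclidean_space q) V4" unfolding V4_def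
          by (rule openin_smooth_preimage[OF V3 smooth_on_subset[OF st_smooth[OF \<beta>(1)]]]) (auto simp: V3_def)
        have V42: "V4 \<subseteq> V2" by (auto simp: V3_def V4_def)
        have xV4: "x \<in> V4" using xV2 Lx \<delta>(1) \<beta>(2) by (simp add: V3_def V4_def)
        have wU: "w y \<in> U \<inter> bd" if "y \<in> V4" for y
          using that \<beta>(4)[of "w y"] wt(2)[of y] V42 by (auto simp: V4_def)
        have w_smooth: "smooth_on q V4 (\<lambda>y. \<phi> (w y) (Suc i))" if "i < s - 1" for i
          by (rule smooth_on_cong[OF smooth_on_subset[OF st_smooth[OF \<beta>(3)[OF that]] V42]])
            (use \<beta>(4) wt(2) V42 that in \<open>auto simp: V4_def\<close>)
        note V4top = topspace_subtopology_subset[OF openin_subset[OF V4]]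
        \<comment> \<open>Nothing is assumed about continuity of \<open>u\<close>. It is regained
          for \<open>w\<close> from the smooth coordinates and the inverse of the chart, and is
          needed for \<open>V5\<close> to be open.\<close>
        have w_cont: "continuous_map (subtopology (Euclidean_space q) V4) (subtopology W bd) w"
        proof -
          obtain h where h: "homeomorphic_maps (subtopology W U) (subtopology (Euclidean_space s) (\<phi> ` U)) \<phi> h"
            using chart_homeo[OF U(1)] by (auto simp: homeomorphic_map_maps)
          have h\<phi>: "h (\<phi> z) = z" if "z \<in> U" for z
            using h that chart_subset[OF U(1)] by (auto simp: homeomorphic_maps_def)
          have "continuous_map (subtopology (Euclidean_space q) V4) (Euclidean_space s) (\<lambda>y. trunc s (\<lambda>i. \<phi> (w y) i))"
            unfolding continuous_map_trunc
          proof (intro allI impI)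
            fix j assume j: "j < s"
            show "continuous_map (subtopology (Euclidean_space q) V4) euclideanreal (\<lambda>y. \<phi> (w y) j)"
            proof (cases j)
              case 0
              show ?thesis unfolding 0
                by (rule continuous_map_eq[of _ _ "\<lambda>_. 0"])
                  (use wU chart_boundary_zero[OF U(1)] V4top in auto)
            next
              case (Suc i)
              then show ?thesis using smooth_on_continuous_map[OF V4 w_smooth[of i]] j by simp
            qed
          qed
          then have "continuous_map (subtopology (Euclidean_space q) V4) (Euclidean_space s) (\<lambda>y. \<phi> (w y))"
          proof (rule continuous_map_eq)
            fix y assume "y \<in> topspace (subtopology (Euclidean_space q) V4)"
            then have "w y \<in> U" using wU V4top by auto
            then show "trunc s (\<lambda>i. \<phi> (w y) i) = \<phi> (w y)" using trunc_id[OF chart_in_euc[OF U(1)]] by simp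
          qed
          then have "continuous_map (subtopology (Euclidean_space q) V4) (subtopology (Euclidean_space s) (\<phi> ` U)) (\<lambda>y. \<phi> (w y))"
            using wU V4top by (auto simp: continuous_map_in_subtopology)
          from continuous_map_compose[OF this, of "subtopology W U" h] h
          have "continuous_map (subtopology (Euclidean_space q) V4) (subtopology W U) (\<lambda>y. h (\<phi> (w y)))"
            by (simp add: homeomorphic_maps_def o_def)
          then have "continuous_map (subtopology (Euclidean_space q) V4) (subtopology W U) w"
            by (rule continuous_map_eq) (use wU V4top h\<phi> in auto)
          then show ?thesis using wU V4top by (auto simp: continuous_map_in_subtopology)
        qed
        have L_cont: "continuous_map (subtopology (Euclidean_space q) V4) (top_of_set {0..<\<epsilon>}) L"
          using smooth_on_continuous_map[OF V4 smooth_on_subset[OF L V42]] Lb V42 V4top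
          by (auto simp: continuous_map_in_subtopology)
        have cyl: "continuous_map (subtopology (Euclidean_space q) V4) (half_cylinder s W A \<epsilon>) (\<lambda>y. (w y, L y))"
          using w_cont L_cont unfolding half_cylinder_def bd_def by (simp add: continuous_map_paired)
        have "continuous_map (subtopology (Euclidean_space q) V4) W (\<lambda>y. c (w y, L y))"
          using continuous_map_compose[OF cyl continuous_collar] by (simp add: continuous_map_in_subtopology o_def)
        note cont = this
        have inW: "c (w y, L y) \<in> Wint" if "y \<in> V4" for y
        proof -
          have y: "y \<in> V2" "L y > 0" using that by (auto simp: V4_def V3_def)
          show ?thesis using collar_in_bd_iff[of "w y" "L y"] collar_in_nbhd[of "w y" "L y"] nbhd_subset wt(2)[OF y(1)] Lb[OF y(1)] y(2)
            by auto
        qed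
        obtain U1 \<phi>1 where U1: "(U1, \<phi>1) \<in> A" "c (w x, L x) \<in> U1"
          using chart_at[of "c (w x, L x)"] inW[OF xV4] by blast
        define V5 where "V5 = {y \<in> V4. c (w y, L y) \<in> U1}"
        have V5: "openin (Euclidean_space q) V5"
          using openin_continuous_map_preimage[OF cont chart_open[OF U1(1)]]
          unfolding V4top openin_open_subtopology[OF V4] V5_def by simp
        have V54: "V5 \<subseteq> V4" by (auto simp: V5_def)
        have V52: "V5 \<subseteq> V2" using V54 V42 by blast
        have "smooth_on q V5 (\<lambda>y. g (c (w y, L y)))"
        proof (rule Cinner_compose[OF gin U1(1) openin_subset[OF V5]])
          show "c (w y, L y) \<in> U1 \<inter> Wint" if "y \<in> V5" for y
            using that inW by (auto simp: V5_def)
          show "smooth_on q V5 (\<lambda>y. \<phi>1 (c (w y, L y)) i)" if "i < s" for i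
          proof (rule smooth_collar[OF U(1) U1(1) openin_subset[OF V5] _ _ _ _ _ that])
            show "w y \<in> U \<inter> bd" if "y \<in> V5" for y using that wU V54 by blast
            show "0 \<le> L y \<and> L y < \<epsilon>" if "y \<in> V5" for y using that Lb V52 by blast
            show "c (w y, L y) \<in> U1" if "y \<in> V5" for y using that by (simp add: V5_def)
            show "smooth_on q V5 (\<lambda>y. \<phi> (w y) (Suc j))" if "j < s - 1" for j
              by (rule smooth_on_subset[OF w_smooth[OF that] V54])
            show "smooth_on q V5 L" by (rule smooth_on_subset[OF L V52])
          qed
        qed
        moreover have "x \<in> V5" using xV4 U1(2) by (simp add: V5_def)
        ultimately show ?thesis
          using V52 V2V feq by (intro locally_smoothI[OF V5, of "\<lambda>y. g (c (w y, L y))"]) auto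
      qed
    qed
  qed
qed

end

section \<open>Gluing\<close>

lemma glue_class_eq:
  assumes "b \<in> B" "b \<in> Q" "f b \<in> P"
  shows "glue_class P Q B f (Inr b) = glue_class P Q B f (Inl (f b))"
proof -
  have "(Inr b, Inl (f b)) \<in> glue_rel P Q B f"
    using assms by (auto simp: glue_rel_def intro!: r_into_equivclp)
  then show ?thesis unfolding glue_class_def by (rule equiv_class_eq[OF equiv_glue_rel])
qed

text \<open>\<open>glue_desc\<close> evaluates at a chosen representative. The choice is harmless
  because \<open>case_sum a d\<close> is invariant under the generating relation, hence, by
  induction, under the equivalence it generates.\<close>

lemma glue_desc_class:
  assumes ad: "\<And>b. b \<in> B \<Longrightarrow> a (f b) = d b" and p: "p \<in> P <+> Q"
  shows "glue_desc a d (glue_class P Q B f p) = case_sum a d p"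
proof -
  have "p \<in> glue_class P Q B f p"
    unfolding glue_class_def by (rule equiv_class_self[OF equiv_glue_rel p])
  then have some: "(SOME p'. p' \<in> glue_class P Q B f p) \<in> glue_class P Q B f p" by (rule someI)
  define p' where "p' = (SOME p'. p' \<in> glue_class P Q B f p)"
  have "p' \<in> glue_class P Q B f p" using some by (simp add: p'_def)
  then have "equivclp (\<lambda>u v. \<exists>b\<in>B. u = Inr b \<and> v = Inl (f b)) p p'"
    by (simp add: glue_class_def glue_rel_def)
  then have "case_sum a d p = case_sum a d p'"
    by (induction rule: equivclp_induct) (auto simp: ad)
  then show ?thesis by (simp add: glue_desc_def p'_def)
qed

text \<open>Stated with properties of the algebra \<open>C\<close> instead of a stratifold, so that
  it also covers the boundary glued to \<open>W\<close> along the identity, from which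
  \<open>C_mfd\<close> is defined.\<close>

locale collared_adjunction = collared_manifold s W A \<epsilon> c
  for s :: nat and W :: "'b topology" and A :: "'b atlas" and \<epsilon> :: real and c :: "'b \<times> real \<Rightarrow> 'b" +
  fixes S :: "'a topology" and C :: "('a \<Rightarrow> real) set" and f :: "'b \<Rightarrow> 'a"
  assumes C_cong: "\<phi> \<in> C \<Longrightarrow> (\<And>x. x \<in> topspace S \<Longrightarrow> \<phi> x = \<psi> x) \<Longrightarrow> \<psi> \<in> C"
    and C_const: "(\<lambda>_. r) \<in> C"
    and attach_in_S: "w \<in> bd \<Longrightarrow> f w \<in> topspace S"
    and attach_pull: "\<phi> \<in> C \<Longrightarrow> (\<lambda>w. \<phi> (f w)) \<in> Cbd"
begin

definition cl :: "'a + 'b \<Rightarrow> ('a + 'b) set" where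
  "cl = glue_class (topspace S) (topspace W) bd f"

lemma cl_bd: "w \<in> bd \<Longrightarrow> cl (Inr w) = cl (Inl (f w))"
  unfolding cl_def using attach_in_S bd_subset by (intro glue_class_eq) auto

lemma desc_Inl: "(\<And>w. w \<in> bd \<Longrightarrow> a (f w) = d w) \<Longrightarrow> x \<in> topspace S \<Longrightarrow> glue_desc a d (cl (Inl x)) = a x"
  unfolding cl_def by (subst glue_desc_class) auto

lemma desc_Inr: "(\<And>w. w \<in> bd \<Longrightarrow> a (f w) = d w) \<Longrightarrow> w \<in> topspace W \<Longrightarrow> glue_desc a d (cl (Inr w)) = d w"
  unfolding cl_def by (subst glue_desc_class) auto

lemma C_ad_iff:
  "g \<in> C_ad S C s W A \<epsilon> c f \<longleftrightarrow>
    (\<lambda>x. g (cl (Inl x))) \<in> C \<and> (\<lambda>w. g (cl (Inr w))) \<in> Cinner \<and>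
    (\<exists>\<delta>>0. \<delta> < \<epsilon> \<and> (\<forall>w\<in>bd. \<forall>t. 0 \<le> t \<and> t < \<delta> \<longrightarrow> g (cl (Inr (c (w, t)))) = g (cl (Inl (f w)))))"
  by (simp add: C_ad_def Let_def cl_def bd_def)

text \<open>Smoothness on the boundary is not part of \<open>C_ad\<close>; it is inherited from
  \<open>S\<close>, where the function lies in \<open>C\<close> and is pulled back along
  \<open>f\<close>.\<close>

lemma C_ad_on_W:
  assumes "g \<in> C_ad S C s W A \<epsilon> c f"
  shows "(\<lambda>w. g (cl (Inr w))) \<in> CW"
proof -
  have "(\<lambda>w. g (cl (Inl (f w)))) \<in> Cbd"
    using assms attach_pull[of "\<lambda>x. g (cl (Inl x))"] by (simp add: C_ad_iff)
  then have "(\<lambda>w. g (cl (Inr w))) \<in> Cbd" by (rule Cbd_cong) (simp add: cl_bd)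
  then show ?thesis using assms by (simp add: C_ad_iff CW_def collar_const_def cl_bd)
qed

lemma collar_in_W: "w \<in> bd \<Longrightarrow> 0 \<le> t \<Longrightarrow> t < \<epsilon> \<Longrightarrow> c (w, t) \<in> topspace W"
  using collar_in_nbhd nbhd_subset by blast

text \<open>All test functions on the adjunction space are obtained here, from matching functions on
  the two pieces.\<close>

lemma glue_desc_C_ad:
  assumes \<phi>: "\<phi> \<in> C" and k: "k \<in> CW" and eq: "\<And>w. w \<in> bd \<Longrightarrow> \<phi> (f w) = k w"
  shows "glue_desc \<phi> k \<in> C_ad S C s W A \<epsilon> c f"
  unfolding C_ad_iff
proof (intro conjI)
  show "(\<lambda>x. glue_desc \<phi> k (cl (Inl x))) \<in> C"
    using \<phi> by (rule C_cong) (simp add: desc_Inl eq)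
  have "k \<in> Cinner" using k by (simp add: CW_def)
  then show "(\<lambda>w. glue_desc \<phi> k (cl (Inr w))) \<in> Cinner"
    by (rule Cinner_cong) (simp add: desc_Inr eq)
  obtain \<delta> where \<delta>: "\<delta> > 0" "\<delta> < \<epsilon>" "\<forall>w\<in>bd. \<forall>t. 0 \<le> t \<and> t < \<delta> \<longrightarrow> k (c (w, t)) = k w"
    using k by (auto simp: CW_def collar_const_def)
  show "\<exists>\<delta>>0. \<delta> < \<epsilon> \<and> (\<forall>w\<in>bd. \<forall>t. 0 \<le> t \<and> t < \<delta> \<longrightarrow>
      glue_desc \<phi> k (cl (Inr (c (w, t)))) = glue_desc \<phi> k (cl (Inl (f w))))"
  proof (intro exI[of _ \<delta>] conjI ballI allI impI)
    fix w t assume wt: "w \<in> bd" "0 \<le> t \<and> t < \<delta>"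
    then show "glue_desc \<phi> k (cl (Inr (c (w, t)))) = glue_desc \<phi> k (cl (Inl (f w)))"
      using \<delta> by (simp add: desc_Inl desc_Inr eq collar_in_W attach_in_S)
  qed (use \<delta> in auto)
qed

end

context collared_manifold
begin

lemma CW_cong:
  assumes g: "g \<in> CW" and eq: "\<And>w. w \<in> topspace W \<Longrightarrow> g w = h w"
  shows "h \<in> CW"
proof -
  have "h \<in> Cbd" by (rule Cbd_cong[of g]) (use g eq bd_subset in \<open>auto simp: CW_def\<close>)
  moreover have "h \<in> Cinner" by (rule Cinner_cong[of g]) (use g eq in \<open>auto simp: CW_def\<close>)
  moreover obtain \<delta> where \<delta>: "\<delta> > 0" "\<delta> < \<epsilon>" "\<forall>w\<in>bd. \<forall>t. 0 \<le> t \<and> t < \<delta> \<longrightarrow> g (c (w, t)) = g w"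
    using g by (auto simp: CW_def collar_const_def)
  have "h (c (w, t)) = h w" if "w \<in> bd" "0 \<le> t" "t < \<delta>" for w t
  proof -
    have "c (w, t) \<in> topspace W" using that \<delta>(2) collar_in_nbhd[of w t] nbhd_subset by auto
    then show ?thesis using that \<delta>(3) eq bd_subset by (metis subsetD)
  qed
  then have "collar_const h" using \<delta>(1,2) unfolding collar_const_def by blast
  ultimately show ?thesis by (simp add: CW_def)
qed

text \<open>For the boundary glued along the identity, \<open>C_ad_on_W\<close> is one inclusion;
  for the other, \<open>g\<close> is glued to its own restriction to the boundary.\<close>

lemma C_mfd_eq: "C_mfd s W A \<epsilon> c = CW"
proof -
  interpret b: collared_adjunction s W A \<epsilon> c "subtopology W bd" Cbd id
  proof unfold_locales
    show "\<psi> \<in> Cbd" if "\<phi> \<in> Cbd" "\<And>x. x \<in> topspace (subtopology W bd) \<Longrightarrow> \<phi> x = \<psi> x" for \<phi> \<psi>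
      by (rule Cbd_cong[OF that(1)]) (use that(2) bd_subset in auto)
    show "(\<lambda>_. r) \<in> Cbd" for r by (rule Cbd_const)
  qed (use bd_subset in auto)
  have top: "topspace (subtopology W bd) = bd" using bd_subset by auto
  have iff: "g \<in> C_mfd s W A \<epsilon> c \<longleftrightarrow> (\<exists>g'\<in>C_ad (subtopology W bd) Cbd s W A \<epsilon> c id. \<forall>w\<in>topspace W. g w = g' (b.cl (Inr w)))" for g
    unfolding C_mfd_def Let_def b.cl_def top by (simp add: bd_def)
  show ?thesis
  proof (intro set_eqI iffI)
    fix g assume "g \<in> C_mfd s W A \<epsilon> c"
    then obtain g' where g': "g' \<in> C_ad (subtopology W bd) Cbd s W A \<epsilon> c id" "\<forall>w\<in>topspace W. g w = g' (b.cl (Inr w))"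
      unfolding iff by blast
    show "g \<in> CW" by (rule CW_cong[OF b.C_ad_on_W[OF g'(1)]]) (use g'(2) in simp)
  next
    fix g assume g: "g \<in> CW"
    then have "g \<in> Cbd" by (simp add: CW_def)
    from b.glue_desc_C_ad[OF this g] have "glue_desc g g \<in> C_ad (subtopology W bd) Cbd s W A \<epsilon> c id" by simp
    moreover have "g w = glue_desc g g (b.cl (Inr w))" if "w \<in> topspace W" for w
      using b.desc_Inr[of g g w] that by simp
    ultimately show "g \<in> C_mfd s W A \<epsilon> c" unfolding iff by blast
  qed
qed

end

context collared_adjunction
begin

section \<open>Plots of the two adjunction spaces\<close>

definition pts :: "('a + 'b) set set" where
  "pts = (topspace S <+> topspace W) // glue_rel (topspace S) (topspace W) bd f"

abbreviation X_ad :: "('a + 'b) set diffeology" where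
  "X_ad \<equiv> adjunction_diffeology (k_diff S C) (k_diff W CW) bd f"

abbreviation Y_ad :: "('a + 'b) set diffeology" where
  "Y_ad \<equiv> k_diff (adjunction_space S W bd f) (C_ad S C s W A \<epsilon> c f)"

lemma cl_in_pts: "x \<in> topspace S \<Longrightarrow> cl (Inl x) \<in> pts" "w \<in> topspace W \<Longrightarrow> cl (Inr w) \<in> pts"
  unfolding cl_def glue_class_def pts_def by (auto intro!: quotientI)

lemma pts_cases:
  assumes "z \<in> pts"
  obtains (S) x where "x \<in> topspace S" "z = cl (Inl x)" | (W) w where "w \<in> topspace W" "z = cl (Inr w)"
  using assms unfolding pts_def cl_def glue_class_def by (auto elim!: quotientE)

lemma points_X: "points X_ad = pts"
  by (simp add: adjunction_diffeology_def quotient_diffeology_def coprod_diffeology_def k_diff_def pts_def)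

lemma points_Y: "points Y_ad = pts"
  by (simp add: k_diff_def topspace_adjunction_space pts_def)

lemma plots_Y:
  "(q, U, u) \<in> plots Y_ad \<longleftrightarrow> openin (Euclidean_space q) U \<and> u ` U \<subseteq> pts \<and>
    (\<forall>g\<in>C_ad S C s W A \<epsilon> c f. smooth_on q U (\<lambda>x. g (u x)))"
  by (simp add: k_diff_def topspace_adjunction_space pts_def parametrizations_def o_def)

lemma plots_X:
  "(q, U, u) \<in> plots X_ad \<longleftrightarrow> openin (Euclidean_space q) U \<and> u ` U \<subseteq> pts \<and>
    (\<forall>x\<in>U. \<exists>V v. openin (Euclidean_space q) V \<and> x \<in> V \<and> V \<subseteq> U \<and>
      (q, V, v) \<in> plots (coprod_diffeology (k_diff S C) (k_diff W CW)) \<and> (\<forall>y\<in>V. u y = cl (v y)))"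
  by (simp add: adjunction_diffeology_def quotient_diffeology_def parametrizations_def pts_def cl_def
      glue_class_def coprod_diffeology_def k_diff_def)

lemma plots_k_diff:
  "(q, U, u) \<in> plots (k_diff T D) \<longleftrightarrow> openin (Euclidean_space q) U \<and> u ` U \<subseteq> topspace T \<and>
    (\<forall>\<phi>\<in>D. smooth_on q U (\<lambda>x. \<phi> (u x)))"
  by (simp add: k_diff_def parametrizations_def o_def)

lemma plots_k_diff_smooth:
  "(q, U, u) \<in> plots (k_diff T D) \<Longrightarrow> \<phi> \<in> D \<Longrightarrow> smooth_on q U (\<lambda>x. \<phi> (u x))"
  unfolding plots_k_diff by (elim conjE) (drule bspec)

lemma plots_coprod:
  "(q, U, u) \<in> plots (coprod_diffeology (k_diff S C) (k_diff W CW)) \<longleftrightarrow>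
    openin (Euclidean_space q) U \<and> u ` U \<subseteq> topspace S <+> topspace W \<and>
    (\<forall>x\<in>U. \<exists>V. openin (Euclidean_space q) V \<and> x \<in> V \<and> V \<subseteq> U \<and>
          ((\<exists>v. (q, V, v) \<in> plots (k_diff S C) \<and> (\<forall>y\<in>V. u y = Inl (v y))) \<or>
           (\<exists>v. (q, V, v) \<in> plots (k_diff W CW) \<and> (\<forall>y\<in>V. u y = Inr (v y)))))"
  by (simp add: coprod_diffeology_def parametrizations_def k_diff_def)

text \<open>Merges the two local conditions, that of the quotient and that of the coproduct, into
  one: near each parameter there is a lift to \<open>S\<close> or to \<open>W\<close>.\<close>

lemma plots_X_I:
  assumes U: "openin (Euclidean_space q) U" "u ` U \<subseteq> pts"
    and loc: "\<And>x. x \<in> U \<Longrightarrow> \<exists>V. openin (Euclidean_space q) V \<and> x \<in> V \<and> V \<subseteq> U \<and>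
      ((\<exists>v. (q, V, v) \<in> plots (k_diff S C) \<and> (\<forall>y\<in>V. u y = cl (Inl (v y)))) \<or>
       (\<exists>v. (q, V, v) \<in> plots (k_diff W CW) \<and> (\<forall>y\<in>V. u y = cl (Inr (v y)))))"
  shows "(q, U, u) \<in> plots X_ad"
  unfolding plots_X
proof (intro conjI ballI U)
  fix x assume "x \<in> U"
  from loc[OF this] obtain V where V: "openin (Euclidean_space q) V" "x \<in> V" "V \<subseteq> U"
    and "(\<exists>v. (q, V, v) \<in> plots (k_diff S C) \<and> (\<forall>y\<in>V. u y = cl (Inl (v y)))) \<or>
       (\<exists>v. (q, V, v) \<in> plots (k_diff W CW) \<and> (\<forall>y\<in>V. u y = cl (Inr (v y))))" by blast
  then consider v where "(q, V, v) \<in> plots (k_diff S C)" "\<forall>y\<in>V. u y = cl (Inl (v y))"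
    | v where "(q, V, v) \<in> plots (k_diff W CW)" "\<forall>y\<in>V. u y = cl (Inr (v y))" by blast
  then show "\<exists>V v. openin (Euclidean_space q) V \<and> x \<in> V \<and> V \<subseteq> U \<and>
      (q, V, v) \<in> plots (coprod_diffeology (k_diff S C) (k_diff W CW)) \<and> (\<forall>y\<in>V. u y = cl (v y))"
  proof cases
    case (1 v)
    have "(q, V, \<lambda>y. Inl (v y)) \<in> plots (coprod_diffeology (k_diff S C) (k_diff W CW))"
      unfolding plots_coprod
      using V(1) 1(1) by (intro conjI ballI exI[of _ V] disjI1 exI[of _ v]) (auto simp: plots_k_diff)
    then show ?thesis using V 1(2) by (intro exI[of _ V] exI[of _ "\<lambda>y. Inl (v y)"]) simp
  next
    case (2 v)
    have "(q, V, \<lambda>y. Inr (v y)) \<in> plots (coprod_diffeology (k_diff S C) (k_diff W CW))"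
      unfolding plots_coprod
      using V(1) 2(1) by (intro conjI ballI exI[of _ V] disjI2 exI[of _ v]) (auto simp: plots_k_diff)
    then show ?thesis using V 2(2) by (intro exI[of _ V] exI[of _ "\<lambda>y. Inr (v y)"]) simp
  qed
qed

lemma plots_X_E:
  assumes "(q, U, u) \<in> plots X_ad" "x \<in> U"
  obtains (S) V v where "openin (Euclidean_space q) V" "x \<in> V" "V \<subseteq> U" "(q, V, v) \<in> plots (k_diff S C)"
      "\<forall>y\<in>V. u y = cl (Inl (v y))"
    | (W) V v where "openin (Euclidean_space q) V" "x \<in> V" "V \<subseteq> U" "(q, V, v) \<in> plots (k_diff W CW)"
      "\<forall>y\<in>V. u y = cl (Inr (v y))"
proof -
  obtain V v where V: "openin (Euclidean_space q) V" "x \<in> V" "V \<subseteq> U"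
      "(q, V, v) \<in> plots (coprod_diffeology (k_diff S C) (k_diff W CW))" "\<forall>y\<in>V. u y = cl (v y)"
    using assms unfolding plots_X by blast
  obtain V' where V': "openin (Euclidean_space q) V'" "x \<in> V'" "V' \<subseteq> V"
     "(\<exists>v'. (q, V', v') \<in> plots (k_diff S C) \<and> (\<forall>y\<in>V'. v y = Inl (v' y))) \<or>
      (\<exists>v'. (q, V', v') \<in> plots (k_diff W CW) \<and> (\<forall>y\<in>V'. v y = Inr (v' y)))"
    using V(2,4) unfolding plots_coprod by blast
  from V'(4) show thesis
  proof
    assume "\<exists>v'. (q, V', v') \<in> plots (k_diff S C) \<and> (\<forall>y\<in>V'. v y = Inl (v' y))"
    then obtain v' where "(q, V', v') \<in> plots (k_diff S C)" "\<forall>y\<in>V'. v y = Inl (v' y)" by blast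
    moreover from this V(5) V'(3) have "\<forall>y\<in>V'. u y = cl (Inl (v' y))" by auto
    ultimately show thesis by (intro S[OF V'(1,2) subset_trans[OF V'(3) V(3)]])
  next
    assume "\<exists>v'. (q, V', v') \<in> plots (k_diff W CW) \<and> (\<forall>y\<in>V'. v y = Inr (v' y))"
    then obtain v' where "(q, V', v') \<in> plots (k_diff W CW)" "\<forall>y\<in>V'. v y = Inr (v' y)" by blast
    moreover from this V(5) V'(3) have "\<forall>y\<in>V'. u y = cl (Inr (v' y))" by auto
    ultimately show thesis by (intro W[OF V'(1,2) subset_trans[OF V'(3) V(3)]])
  qed
qed

section \<open>The deformation of the adjunction space\<close>

definition squeeze_ad :: "('a + 'b) set \<Rightarrow> real \<Rightarrow> ('a + 'b) set" where
  "squeeze_ad z \<tau> = glue_desc (\<lambda>x. cl (Inl x)) (\<lambda>w. cl (Inr (squeeze \<tau> w))) z"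

text \<open>The two branches agree at glued points because \<open>squeeze\<close> fixes the
  boundary.\<close>

lemma squeeze_ad_Inl: "x \<in> topspace S \<Longrightarrow> squeeze_ad (cl (Inl x)) \<tau> = cl (Inl x)"
  unfolding squeeze_ad_def by (rule desc_Inl) (simp_all add: squeeze_bd cl_bd)

lemma squeeze_ad_Inr: "w \<in> topspace W \<Longrightarrow> squeeze_ad (cl (Inr w)) \<tau> = cl (Inr (squeeze \<tau> w))"
  unfolding squeeze_ad_def by (rule desc_Inr) (simp_all add: squeeze_bd cl_bd)

lemma squeeze_ad_in_pts: "z \<in> pts \<Longrightarrow> squeeze_ad z \<tau> \<in> pts"
  by (erule pts_cases) (simp_all add: squeeze_ad_Inl squeeze_ad_Inr cl_in_pts squeeze_in_W)

lemma squeeze_ad_1: "z \<in> pts \<Longrightarrow> squeeze_ad z 1 = z"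
  by (erule pts_cases) (simp_all add: squeeze_ad_Inl squeeze_ad_Inr squeeze_1)

text \<open>The depth detector on the adjunction space; points of \<open>S\<close> count as having
  depth 0.\<close>

definition near :: "real \<Rightarrow> real \<Rightarrow> ('a + 'b) set \<Rightarrow> real" where
  "near a b = glue_desc (\<lambda>_. 1) (collar_step a b)"

context
  fixes a b :: real
  assumes ab: "0 < a" "a < b" "b < \<epsilon>"
begin

lemma collar_step_bd: "w \<in> bd \<Longrightarrow> collar_step a b w = 1"
  using ab by (simp add: collar_ext_bd)

lemma near_C_ad: "near a b \<in> C_ad S C s W A \<epsilon> c f"
  unfolding near_def using ab
  by (intro glue_desc_C_ad C_const step_ext_CW Cbd_const) (simp_all add: collar_step_bd)

lemma near_Inl: "x \<in> topspace S \<Longrightarrow> near a b (cl (Inl x)) = 1"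
  unfolding near_def by (rule desc_Inl) (simp_all add: collar_step_bd)

lemma near_Inr: "w \<in> topspace W \<Longrightarrow> near a b (cl (Inr w)) = collar_step a b w"
  unfolding near_def by (rule desc_Inr) (simp_all add: collar_step_bd)

text \<open>A function in \<open>CW\<close> need not factor through \<open>f\<close> on the boundary
  and so may have no extension over \<open>S\<close>. Cutting it off near the boundary allows
  extension by 0.\<close>

lemma extend_by_zero_C_ad:
  assumes "k \<in> CW"
  shows "glue_desc (\<lambda>_. 0) (\<lambda>w. k w * (1 - collar_step a b w)) \<in> C_ad S C s W A \<epsilon> c f"
proof (rule glue_desc_C_ad[OF C_const])
  have "collar_step a b \<in> Cinner" "k \<in> Cinner"
    using step_ext_CW[OF ab Cbd_const] assms by (auto simp: CW_def)
  then have "(\<lambda>w. k w * (1 - collar_step a b w)) \<in> Cinner"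
    by (intro Cinner_mult Cinner_diff Cinner_const)
  moreover have "(\<lambda>w. k w * (1 - collar_step a b w)) \<in> Cbd"
    by (rule Cbd_cong[OF Cbd_const[of 0]]) (simp add: collar_step_bd)
  moreover have "collar_const (\<lambda>w. k w * (1 - collar_step a b w))"
    unfolding collar_const_def using ab
    by (intro exI[of _ a]) (auto simp: collar_step_bd collar_ext_on_collar)
  ultimately show "(\<lambda>w. k w * (1 - collar_step a b w)) \<in> CW" by (simp add: CW_def)
qed (simp add: collar_step_bd)

end

text \<open>Since \<open>near\<close> is 1 on \<open>S\<close>, the plot avoids \<open>S\<close> on
  \<open>V\<close>, and representatives in \<open>W\<close> can be chosen pointwise. Their
  smoothness against \<open>k\<close> is tested on the adjunction space, by an extension by zero
  that agrees with \<open>k\<close> at the depths occurring there.\<close>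

lemma lift_to_W:
  assumes u: "(q, U, u) \<in> plots Y_ad" and ab: "0 < a" "a < b" "b < \<epsilon>"
  defines "V \<equiv> {y \<in> U. near a b (u y) < 1}"
  obtains v where "(q, V, v) \<in> plots (k_diff W CW)" "\<forall>y\<in>V. u y = cl (Inr (v y))"
proof -
  have U: "openin (Euclidean_space q) U" and upts: "\<And>y. y \<in> U \<Longrightarrow> u y \<in> pts"
    and us: "\<And>g. g \<in> C_ad S C s W A \<epsilon> c f \<Longrightarrow> smooth_on q U (\<lambda>x. g (u x))"
    using u unfolding plots_Y by auto
  have "openin (Euclidean_space q) {y \<in> U. near a b (u y) \<in> {..<1}}"
    by (rule openin_smooth_preimage[OF U us[OF near_C_ad[OF ab]]]) simp
  then have V: "openin (Euclidean_space q) V" by (simp add: V_def)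
  have "\<exists>w. w \<in> topspace W \<and> u y = cl (Inr w)" if y: "y \<in> V" for y
  proof -
    have "u y \<in> pts" using y upts by (simp add: V_def)
    then show ?thesis
    proof (cases rule: pts_cases)
      case (S x)
      then show ?thesis using y near_Inl[OF ab] by (simp add: V_def)
    qed blast
  qed
  then obtain v where v: "\<And>y. y \<in> V \<Longrightarrow> v y \<in> topspace W \<and> u y = cl (Inr (v y))" by metis
  \<comment> \<open>The cutoff is complete at depth \<open>a\<close>, and lifted points lie deeper
    than \<open>a\<close> or off the collar, where the factor
    \<open>1 - collar_step (a / 2) a\<close> is 1.\<close>
  have ab': "0 < a / 2" "a / 2 < a" "a < \<epsilon>" using ab by auto
  have "smooth_on q V (\<lambda>y. k (v y))" if k: "k \<in> CW" for k
  proof (rule smooth_on_cong)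
    let ?g = "glue_desc (\<lambda>_. 0) (\<lambda>w. k w * (1 - collar_step (a / 2) a w)) :: ('a + 'b) set \<Rightarrow> real"
    show "smooth_on q V (\<lambda>y. ?g (u y))"
      by (rule smooth_on_subset[OF us[OF extend_by_zero_C_ad[OF ab' k]]]) (auto simp: V_def)
    fix y assume y: "y \<in> V"
    have "collar_step a b (v y) < 1" using y v[OF y] near_Inr[OF ab, of "v y"] by (simp add: V_def)
    then have "v y \<in> nbhd \<Longrightarrow> a < snd (collar_inv (v y))" using ab by (intro collar_step_less_1D) auto
    then have "collar_step (a / 2) a (v y) = 0"
      using ab by (cases "v y \<in> nbhd") (simp_all add: collar_ext_def)
    moreover have "?g (cl (Inr (v y))) = k (v y) * (1 - collar_step (a / 2) a (v y))"
      by (rule desc_Inr) (simp_all add: collar_step_bd[OF ab'] v[OF y])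
    ultimately show "?g (u y) = k (v y)" using v[OF y] by simp
  qed
  then show thesis using V v by (intro that[of v]) (auto simp: plots_k_diff)
qed

lemma plots_prod_realD:
  assumes "(q, U, p) \<in> plots (prod_diffeology Z real_diffeology)"
  shows "(q, U, \<lambda>x. fst (p x)) \<in> plots Z" "smooth_on q U (\<lambda>x. snd (p x))"
  using assms by (auto simp: prod_diffeology_def real_diffeology_def o_def)

lemma squeeze_plot:
  assumes v: "(q, V, v) \<in> plots (k_diff W CW)" and \<tau>: "smooth_on q V \<tau>"
  shows "(q, V, \<lambda>y. squeeze (\<tau> y) (v y)) \<in> plots (k_diff W CW)"
  using assms squeeze_in_W unfolding plots_k_diff by (auto intro!: smooth_on_squeeze)

text \<open>Near \<open>S\<close> a function of the algebra cannot tell a point from its squeezed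
  image; elsewhere the plot lifts to \<open>W\<close> and \<open>squeeze_plot\<close> applies.
  Crossing the seam thus never requires a lift.\<close>

lemma smooth_homotopy_Y:
  "smooth_map (prod_diffeology Y_ad real_diffeology) Y_ad (\<lambda>(z, \<tau>). squeeze_ad z \<tau>)"
  unfolding smooth_map_def
proof (intro conjI)
  show "(\<lambda>(z, \<tau>). squeeze_ad z \<tau>) ` points (prod_diffeology Y_ad real_diffeology) \<subseteq> points Y_ad"
    using squeeze_ad_in_pts by (auto simp: prod_diffeology_def points_Y)
  have "(q, U, \<lambda>x. squeeze_ad (fst (p x)) (snd (p x))) \<in> plots Y_ad"
    if p: "(q, U, p) \<in> plots (prod_diffeology Y_ad real_diffeology)" for q U p
  proof -
    define u where "u x = fst (p x)" for x
    define \<tau> where "\<tau> x = snd (p x)" for x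
    have u: "(q, U, u) \<in> plots Y_ad" and \<tau>: "smooth_on q U \<tau>"
      using plots_prod_realD[OF p] by (simp_all add: u_def[abs_def] \<tau>_def[abs_def])
    have U: "openin (Euclidean_space q) U" and upts: "\<And>y. y \<in> U \<Longrightarrow> u y \<in> pts"
      and us: "\<And>g. g \<in> C_ad S C s W A \<epsilon> c f \<Longrightarrow> smooth_on q U (\<lambda>x. g (u x))"
      using u unfolding plots_Y by auto
    have "smooth_on q U (\<lambda>x. g (squeeze_ad (u x) (\<tau> x)))" if g: "g \<in> C_ad S C s W A \<epsilon> c f" for g
    proof (rule smooth_on_local)
      fix x assume x: "x \<in> U"
      obtain \<delta> where \<delta>: "0 < \<delta>" "\<delta> < \<epsilon>"
        "\<And>w t. w \<in> bd \<Longrightarrow> 0 \<le> t \<Longrightarrow> t < \<delta> \<Longrightarrow> g (cl (Inr (c (w, t)))) = g (cl (Inl (f w)))"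
        using g by (auto simp: C_ad_iff)
      let ?n = "near (\<delta> / 3) (2 * \<delta> / 3)"
      have ab: "0 < \<delta> / 3" "\<delta> / 3 < 2 * \<delta> / 3" "2 * \<delta> / 3 < \<epsilon>" using \<delta> by auto
      let ?F = "\<lambda>x. g (squeeze_ad (u x) (\<tau> x))"
      show "\<exists>O'. openin (Euclidean_space q) O' \<and> x \<in> O' \<and> smooth_on q (U \<inter> O') ?F"
      proof (cases "?n (u x) > 0")
        case True
        let ?V = "{y \<in> U. ?n (u y) \<in> {0<..}}"
        have "openin (Euclidean_space q) ?V" by (rule openin_smooth_preimage[OF U us[OF near_C_ad[OF ab]]]) simp
        moreover have "smooth_on q (U \<inter> ?V) ?F"
        proof (rule smooth_on_cong)
          show "smooth_on q (U \<inter> ?V) (\<lambda>x. g (u x))" by (rule smooth_on_subset[OF us[OF g]]) auto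
          fix y assume y: "y \<in> U \<inter> ?V"
          then have "u y \<in> pts" using upts by simp
          then show "g (u y) = ?F y"
          proof (cases rule: pts_cases)
            case (S x)
            then show ?thesis by (simp add: squeeze_ad_Inl)
          next
            case (W w)
            have "collar_step (\<delta> / 3) (2 * \<delta> / 3) w > 0" using y W near_Inr[OF ab] by simp
            then obtain w' t where w': "w = c (w', t)" "w' \<in> bd" "0 \<le> t" "t < \<epsilon>" "collar_inv w = (w', t)" "t < 2 * \<delta> / 3"
              by (rule collar_step_posD) (use ab in simp)
            then show ?thesis
              using W profile_bounds[OF w'(3), of "\<tau> y"] \<delta>(1)
              by (simp add: squeeze_ad_Inr squeeze_collar \<delta>(3))
          qed
        qed
        moreover have "x \<in> ?V" using x True by simp
        ultimately show ?thesis by (intro exI[of _ ?V] conjI)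
      next
        case False
        let ?V = "{y \<in> U. ?n (u y) < 1}"
        obtain v where v: "(q, ?V, v) \<in> plots (k_diff W CW)" "\<forall>y\<in>?V. u y = cl (Inr (v y))"
          by (rule lift_to_W[OF u ab])
        have "smooth_on q ?V \<tau>" by (rule smooth_on_subset[OF \<tau>]) auto
        then have "smooth_on q ?V (\<lambda>y. g (cl (Inr (squeeze (\<tau> y) (v y)))))"
          by (rule plots_k_diff_smooth[OF squeeze_plot[OF v(1)] C_ad_on_W[OF g]])
        then have "smooth_on q ?V ?F"
        proof (rule smooth_on_cong)
          fix y assume y: "y \<in> ?V"
          then have "v y \<in> topspace W" using v(1) unfolding plots_k_diff by blast
          moreover have "u y = cl (Inr (v y))" using v(2) y by blast
          ultimately show "g (cl (Inr (squeeze (\<tau> y) (v y)))) = ?F y" by (simp add: squeeze_ad_Inr)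
        qed
        then have "smooth_on q (U \<inter> ?V) ?F" by (rule smooth_on_subset) auto
        moreover have "openin (Euclidean_space q) ?V" using v(1) unfolding plots_k_diff by blast
        moreover have "x \<in> ?V" using x False by simp
        ultimately show ?thesis by (intro exI[of _ ?V] conjI)
      qed
    qed
    then show ?thesis using U upts squeeze_ad_in_pts unfolding plots_Y u_def \<tau>_def by auto
  qed
  then show "\<forall>(q, U, u)\<in>plots (prod_diffeology Y_ad real_diffeology). (q, U, (\<lambda>(z, \<tau>). squeeze_ad z \<tau>) \<circ> u) \<in> plots Y_ad"
    by (auto simp: o_def case_prod_unfold)
qed

text \<open>Here plots come with local lifts, and the deformation respects the pieces: it fixes
  \<open>S\<close> and acts on \<open>W\<close> by \<open>squeeze\<close>.\<close>

lemma smooth_homotopy_X: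
  "smooth_map (prod_diffeology X_ad real_diffeology) X_ad (\<lambda>(z, \<tau>). squeeze_ad z \<tau>)"
  unfolding smooth_map_def
proof (intro conjI)
  show "(\<lambda>(z, \<tau>). squeeze_ad z \<tau>) ` points (prod_diffeology X_ad real_diffeology) \<subseteq> points X_ad"
    using squeeze_ad_in_pts by (auto simp: prod_diffeology_def points_X)
  have "(q, U, \<lambda>x. squeeze_ad (fst (p x)) (snd (p x))) \<in> plots X_ad"
    if p: "(q, U, p) \<in> plots (prod_diffeology X_ad real_diffeology)" for q U p
  proof (rule plots_X_I)
    note u = plots_prod_realD(1)[OF p]
    note \<tau> = plots_prod_realD(2)[OF p]
    show "openin (Euclidean_space q) U" using u unfolding plots_X by blast
    have "fst (p x) \<in> pts" if "x \<in> U" for x using u that unfolding plots_X by blast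
    then show "(\<lambda>x. squeeze_ad (fst (p x)) (snd (p x))) ` U \<subseteq> pts" using squeeze_ad_in_pts by blast
    fix x assume "x \<in> U"
    with u show "\<exists>V. openin (Euclidean_space q) V \<and> x \<in> V \<and> V \<subseteq> U \<and>
      ((\<exists>v. (q, V, v) \<in> plots (k_diff S C) \<and> (\<forall>y\<in>V. squeeze_ad (fst (p y)) (snd (p y)) = cl (Inl (v y)))) \<or>
       (\<exists>v. (q, V, v) \<in> plots (k_diff W CW) \<and> (\<forall>y\<in>V. squeeze_ad (fst (p y)) (snd (p y)) = cl (Inr (v y)))))"
    proof (cases rule: plots_X_E)
      case (S V v)
      have "squeeze_ad (fst (p y)) (snd (p y)) = cl (Inl (v y))" if "y \<in> V" for y
      proof -
        have "v y \<in> topspace S" using S(4) that unfolding plots_k_diff by blast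
        then show ?thesis using S(5) that by (simp add: squeeze_ad_Inl)
      qed
      then show ?thesis using S by (intro exI[of _ V] conjI disjI1 exI[of _ v]) auto
    next
      case (W V v)
      have "squeeze_ad (fst (p y)) (snd (p y)) = cl (Inr (squeeze (snd (p y)) (v y)))" if "y \<in> V" for y
      proof -
        have "v y \<in> topspace W" using W(4) that unfolding plots_k_diff by blast
        then show ?thesis using W(5) that by (simp add: squeeze_ad_Inr)
      qed
      then show ?thesis using W squeeze_plot[OF W(4) smooth_on_subset[OF \<tau> W(3)]]
        by (intro exI[of _ V] conjI disjI2 exI[of _ "\<lambda>y. squeeze (snd (p y)) (v y)"]) auto
    qed
  qed
  then show "\<forall>(q, U, u)\<in>plots (prod_diffeology X_ad real_diffeology). (q, U, (\<lambda>(z, \<tau>). squeeze_ad z \<tau>) \<circ> u) \<in> plots X_ad"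
    by (auto simp: o_def case_prod_unfold)
qed

text \<open>The only map that must produce lifts. Near the seam it retracts to \<open>S\<close>,
  which gives a lift to \<open>S\<close> even for plots that cross the seam; away from the seam the
  lift to \<open>W\<close> is squeezed.\<close>

lemma smooth_squeeze_ad_0: "smooth_map Y_ad X_ad (\<lambda>z. squeeze_ad z 0)"
  unfolding smooth_map_def
proof (intro conjI)
  show "(\<lambda>z. squeeze_ad z 0) ` points Y_ad \<subseteq> points X_ad"
    using squeeze_ad_in_pts by (auto simp: points_X points_Y)
  have "(q, U, \<lambda>x. squeeze_ad (u x) 0) \<in> plots X_ad" if u: "(q, U, u) \<in> plots Y_ad" for q U u
  proof (rule plots_X_I)
    show U: "openin (Euclidean_space q) U" using u unfolding plots_Y by blast
    have upts: "u y \<in> pts" if "y \<in> U" for y using u that unfolding plots_Y by blast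
    then show "(\<lambda>x. squeeze_ad (u x) 0) ` U \<subseteq> pts" using squeeze_ad_in_pts by blast
    have us: "smooth_on q U (\<lambda>x. g (u x))" if "g \<in> C_ad S C s W A \<epsilon> c f" for g
      using u that unfolding plots_Y by blast
    fix x assume x: "x \<in> U"
    \<comment> \<open>Positivity confines the point to \<open>S\<close> or to depth below
      \<open>\<epsilon> / 3\<close>, exactly the strip that \<open>squeeze 0\<close>
      collapses.\<close>
    let ?n = "near (\<epsilon> / 6) (\<epsilon> / 3)"
    have ab: "0 < \<epsilon> / 6" "\<epsilon> / 6 < \<epsilon> / 3" "\<epsilon> / 3 < \<epsilon>" using eps_pos by auto
    show "\<exists>V. openin (Euclidean_space q) V \<and> x \<in> V \<and> V \<subseteq> U \<and>
      ((\<exists>v. (q, V, v) \<in> plots (k_diff S C) \<and> (\<forall>y\<in>V. squeeze_ad (u y) 0 = cl (Inl (v y)))) \<or>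
       (\<exists>v. (q, V, v) \<in> plots (k_diff W CW) \<and> (\<forall>y\<in>V. squeeze_ad (u y) 0 = cl (Inr (v y)))))"
    proof (cases "?n (u x) > 0")
      case True
      define V where "V = {y \<in> U. ?n (u y) \<in> {0<..}}"
      have V: "openin (Euclidean_space q) V"
        unfolding V_def by (rule openin_smooth_preimage[OF U us[OF near_C_ad[OF ab]]]) simp
      \<comment> \<open>The retraction to \<open>S\<close> as a map into \<open>S\<close> itself: on
        the collar it follows the fibre to the boundary and applies \<open>f\<close>.\<close>
      define r where "r = (glue_desc (\<lambda>x. x) (\<lambda>w. f (fst (collar_inv w))) :: ('a + 'b) set \<Rightarrow> 'a)"
      have r: "r (u y) \<in> topspace S \<and> squeeze_ad (u y) 0 = cl (Inl (r (u y))) \<and>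
          (\<forall>\<phi>\<in>C. glue_desc \<phi> (collar_ext (step (\<epsilon> / 3) (\<epsilon> / 2)) (\<lambda>w. \<phi> (f w))) (u y) = \<phi> (r (u y)))"
        if y: "y \<in> V" for y
      proof -
        have bdeq: "\<phi> (f w) = collar_ext (step (\<epsilon> / 3) (\<epsilon> / 2)) (\<lambda>w. \<phi> (f w)) w" if "w \<in> bd" for w \<phi>
          using that eps_pos by (simp add: collar_ext_bd)
        have "u y \<in> pts" using y upts by (simp add: V_def)
        then show ?thesis
        proof (cases rule: pts_cases)
          case (S x)
          have "r (u y) = x" unfolding r_def S(2) by (rule desc_Inl) (simp_all add: collar_inv_bd S(1))
          moreover have "glue_desc \<phi> (collar_ext (step (\<epsilon> / 3) (\<epsilon> / 2)) (\<lambda>w. \<phi> (f w))) (u y) = \<phi> x" for \<phi>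
            unfolding S(2) by (rule desc_Inl[OF bdeq S(1)])
          ultimately show ?thesis using S by (simp add: squeeze_ad_Inl)
        next
          case (W w)
          have "collar_step (\<epsilon> / 6) (\<epsilon> / 3) w > 0" using y W near_Inr[OF ab] by (simp add: V_def)
          then obtain w' t where w': "w = c (w', t)" "w' \<in> bd" "0 \<le> t" "t < \<epsilon>" "collar_inv w = (w', t)" "t < \<epsilon> / 3"
            by (rule collar_step_posD) (use ab in simp)
          have "r (u y) = f (fst (collar_inv w))" unfolding r_def W(2) by (rule desc_Inr) (simp_all add: collar_inv_bd W(1))
          then have rw: "r (u y) = f w'" using w' by simp
          have "squeeze_ad (u y) 0 = cl (Inl (f w'))"
            using W w' by (simp add: squeeze_ad_Inr squeeze_0 cl_bd)
          moreover have "glue_desc \<phi> (collar_ext (step (\<epsilon> / 3) (\<epsilon> / 2)) (\<lambda>w. \<phi> (f w))) (u y) = \<phi> (f w')" for \<phi>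
          proof -
            have "glue_desc \<phi> (collar_ext (step (\<epsilon> / 3) (\<epsilon> / 2)) (\<lambda>w. \<phi> (f w))) (u y) =
                collar_ext (step (\<epsilon> / 3) (\<epsilon> / 2)) (\<lambda>w. \<phi> (f w)) w"
              unfolding W(2) by (rule desc_Inr[OF bdeq W(1)])
            also have "\<dots> = \<phi> (f w')" using w' eps_pos by (simp add: collar_ext_on_collar)
            finally show ?thesis .
          qed
          ultimately show ?thesis using rw attach_in_S[OF w'(2)] by simp
        qed
      qed
      have "(q, V, \<lambda>y. r (u y)) \<in> plots (k_diff S C)"
        unfolding plots_k_diff
      proof (intro conjI ballI V)
        show "(\<lambda>y. r (u y)) ` V \<subseteq> topspace S" using r by blast
        fix \<phi> assume \<phi>: "\<phi> \<in> C"
        \<comment> \<open>Extends \<phi> along the fibres of the collar. Its cutoff is still 1 at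
          all depths occurring on \<open>V\<close>, so \<open>?g\<close> agrees with the composite
          of \<phi> and \<open>r\<close> there.\<close>
        let ?g = "glue_desc \<phi> (collar_ext (step (\<epsilon> / 3) (\<epsilon> / 2)) (\<lambda>w. \<phi> (f w)))"
        have "?g \<in> C_ad S C s W A \<epsilon> c f"
          using eps_pos by (intro glue_desc_C_ad \<phi> step_ext_CW attach_pull) (simp_all add: collar_ext_bd)
        from smooth_on_subset[OF us[OF this], of V] have "smooth_on q V (\<lambda>y. ?g (u y))" by (auto simp: V_def)
        then show "smooth_on q V (\<lambda>y. \<phi> (r (u y)))" by (rule smooth_on_cong) (use r \<phi> in blast)
      qed
      moreover have "x \<in> V" "V \<subseteq> U" using x True by (auto simp: V_def)
      moreover have "\<forall>y\<in>V. squeeze_ad (u y) 0 = cl (Inl (r (u y)))" using r by blast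
      ultimately show ?thesis using V by (intro exI[of _ V] conjI disjI1 exI[of _ "\<lambda>y. r (u y)"])
    next
      case False
      let ?V = "{y \<in> U. ?n (u y) < 1}"
      obtain v where v: "(q, ?V, v) \<in> plots (k_diff W CW)" "\<forall>y\<in>?V. u y = cl (Inr (v y))"
        by (rule lift_to_W[OF u ab])
      have V: "openin (Euclidean_space q) ?V" using v(1) unfolding plots_k_diff by blast
      have "squeeze_ad (u y) 0 = cl (Inr (squeeze 0 (v y)))" if y: "y \<in> ?V" for y
      proof -
        have "v y \<in> topspace W" using y v(1) unfolding plots_k_diff by blast
        moreover have "u y = cl (Inr (v y))" using v(2) y by blast
        ultimately show ?thesis by (simp add: squeeze_ad_Inr)
      qed
      moreover have "(q, ?V, \<lambda>y. squeeze 0 (v y)) \<in> plots (k_diff W CW)"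
        by (rule squeeze_plot[OF v(1) smooth_on_const[OF openin_subset[OF V]]])
      moreover have "x \<in> ?V" using x False by simp
      ultimately show ?thesis using V
        by (intro exI[of _ ?V] conjI disjI2 exI[of _ "\<lambda>y. squeeze 0 (v y)"]) auto
    qed
  qed
  then show "\<forall>(q, U, u)\<in>plots Y_ad. (q, U, (\<lambda>z. squeeze_ad z 0) \<circ> u) \<in> plots X_ad"
    by (auto simp: o_def)
qed

lemma l_map_id: "z \<in> pts \<Longrightarrow> l_map S W bd f z = z"
  by (rule l_map_eq_id) (simp add: topspace_adjunction_space pts_def)

text \<open>A function in \<open>C_ad\<close> restricts to a function in \<open>C\<close> on
  \<open>S\<close> and, by \<open>C_ad_on_W\<close>, to one in \<open>CW\<close> on
  \<open>W\<close>; these are the functions that test the local lifts.\<close>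

lemma smooth_l_map: "smooth_map X_ad Y_ad (l_map S W bd f)"
  unfolding smooth_map_def
proof (intro conjI)
  show "l_map S W bd f ` points X_ad \<subseteq> points Y_ad"
    by (auto simp: points_X points_Y l_map_id)
  have "(q, U, \<lambda>x. l_map S W bd f (u x)) \<in> plots Y_ad" if u: "(q, U, u) \<in> plots X_ad" for q U u
    unfolding plots_Y
  proof (intro conjI ballI)
    show "openin (Euclidean_space q) U" using u unfolding plots_X by blast
    have upts: "u y \<in> pts" if "y \<in> U" for y using u that unfolding plots_X by blast
    then show "(\<lambda>x. l_map S W bd f (u x)) ` U \<subseteq> pts" by (auto simp: l_map_id)
    fix g assume g: "g \<in> C_ad S C s W A \<epsilon> c f"
    have "smooth_on q U (\<lambda>x. g (u x))"
    proof (rule smooth_on_local)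
      fix x assume "x \<in> U"
      with u show "\<exists>O'. openin (Euclidean_space q) O' \<and> x \<in> O' \<and> smooth_on q (U \<inter> O') (\<lambda>x. g (u x))"
      proof (cases rule: plots_X_E)
        case (S V v)
        have "(\<lambda>x. g (cl (Inl x))) \<in> C" using g by (simp add: C_ad_iff)
        then have "smooth_on q V (\<lambda>y. g (cl (Inl (v y))))" by (rule plots_k_diff_smooth[OF S(4)])
        then have "smooth_on q V (\<lambda>y. g (u y))" by (rule smooth_on_cong) (simp add: S(5))
        then show ?thesis using S(1-3) by (intro exI[of _ V]) (simp add: Int_absorb1)
      next
        case (W V v)
        have "smooth_on q V (\<lambda>y. g (cl (Inr (v y))))"
          by (rule plots_k_diff_smooth[OF W(4) C_ad_on_W[OF g]])
        then have "smooth_on q V (\<lambda>y. g (u y))" by (rule smooth_on_cong) (simp add: W(5))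
        then show ?thesis using W(1-3) by (intro exI[of _ V]) (simp add: Int_absorb1)
      qed
    qed
    then show "smooth_on q U (\<lambda>x. g (l_map S W bd f (u x)))"
      by (rule smooth_on_cong) (simp add: upts l_map_id)
  qed
  then show "\<forall>(q, U, u)\<in>plots X_ad. (q, U, l_map S W bd f \<circ> u) \<in> plots Y_ad"
    by (auto simp: o_def)
qed

text \<open>As \<open>l\<close> is the identity on points, both composites are the deformation at
  time 0, and the same formula is the homotopy on either side; only its smoothness had to be proved
  twice.\<close>

lemma smooth_homotopy_equivalence_l_map: "smooth_homotopy_equivalence X_ad Y_ad (l_map S W bd f)"
  unfolding smooth_homotopy_equivalence_def
proof (intro conjI exI[of _ "\<lambda>z. squeeze_ad z 0"])
  show "smoothly_homotopic X_ad X_ad ((\<lambda>z. squeeze_ad z 0) \<circ> l_map S W bd f) id"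
    unfolding smoothly_homotopic_def
    by (intro exI[of _ "\<lambda>(z, \<tau>). squeeze_ad z \<tau>"] conjI smooth_homotopy_X)
      (simp add: points_X l_map_id squeeze_ad_1)
  show "smoothly_homotopic Y_ad Y_ad (l_map S W bd f \<circ> (\<lambda>z. squeeze_ad z 0)) id"
    unfolding smoothly_homotopic_def
    by (intro exI[of _ "\<lambda>(z, \<tau>). squeeze_ad z \<tau>"] conjI smooth_homotopy_Y)
      (simp add: points_Y l_map_id squeeze_ad_1 squeeze_ad_in_pts)
qed (rule smooth_l_map smooth_squeeze_ad_0)+

end

theorem theoremA3:
  fixes S :: "'a topology" and C :: "('a \<Rightarrow> real) set" and n :: nat
    and W :: "'b topology" and A :: "'b atlas" and s :: nat
    and \<epsilon> :: real and c :: "'b \<times> real \<Rightarrow> 'b" and f :: "'b \<Rightarrow> 'a"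
  assumes "stratifold n S C"
    and "smooth_manifold_with_boundary s W A"
    and "compactin W (mfd_boundary s A)"
    and "collar s W A \<epsilon> c"
    and "s > n"
    and "stratifold_morphism (subtopology W (mfd_boundary s A)) (Cinf (s - 1) (boundary_atlas s A))
           S C f"
  shows "smooth_homotopy_equivalence
           (adjunction_diffeology (k_diff S C) (k_diff W (C_mfd s W A \<epsilon> c)) (mfd_boundary s A) f)
           (k_diff (adjunction_space S W (mfd_boundary s A) f) (C_ad S C s W A \<epsilon> c f))
           (l_map S W (mfd_boundary s A) f)"
proof -
  interpret collared_manifold s W A \<epsilon> c
    by unfold_locales (use assms in auto)
  have diff: "differential_space S C" using assms(1) by (simp add: stratifold_def)
  \<comment> \<open>Local detectability with the whole space as neighbourhood shows that membership
    in \<open>C\<close> ignores values outside \<open>topspace S\<close>, as \<open>C_cong\<close>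
    demands.\<close>
  have local_detect: "\<psi> \<in> C \<longleftrightarrow>
      (\<forall>x\<in>topspace S. \<exists>U. openin S U \<and> x \<in> U \<and> (\<exists>g\<in>C. \<forall>y\<in>U. \<psi> y = g y))" for \<psi>
    using diff unfolding differential_space_def by blast
  interpret collared_adjunction s W A \<epsilon> c S C f
  proof unfold_locales
    fix \<phi> \<psi> assume \<phi>: "\<phi> \<in> C" "\<And>x. x \<in> topspace S \<Longrightarrow> \<phi> x = \<psi> x"
    show "\<psi> \<in> C"
      unfolding local_detect[of \<psi>] using \<phi> by (intro ballI exI[of _ "topspace S"] conjI bexI[of _ \<phi>]) auto
  next
    show "(\<lambda>_. r) \<in> C" for r using diff by (simp add: differential_space_def)
  next
    fix w assume "w \<in> bd"
    moreover have "continuous_map (subtopology W bd) S f"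
      using assms(6) by (simp add: stratifold_morphism_def bd_def)
    then have "f ` topspace (subtopology W bd) \<subseteq> topspace S" by (rule continuous_map_image_subset_topspace)
    ultimately show "f w \<in> topspace S" using bd_subset by auto
  next
    show "(\<lambda>w. \<phi> (f w)) \<in> Cbd" if "\<phi> \<in> C" for \<phi>
      using assms(6) that by (simp add: stratifold_morphism_def o_def)
  qed
  show ?thesis
    using smooth_homotopy_equivalence_l_map unfolding C_mfd_eq bd_def .
qed

end
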